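(* Let $\omega\in\widehat{\mathcal{D}}$. Then the following statements are equivalent: (i) $T_c(D^1_\omega,H^\infty)$ consists of constant functions only; (ii) $\displaystyle\limsup_{r\to1^-}\frac{1-r}{\widehat\omega(r)}>0$; (iii) $\displaystyle\limsup_{r\to1^-}(1-r)\sum_{k=1}^\infty\frac{r^k}{(k+1)\omega_k}>0$; (iv) the identity map $I:D^1_\omega\to D^1_0$ is not compact.
   Context: $\mathbb{D}$ is the open unit disc, $\mathcal{H}(\mathbb{D})$ the analytic functions on it, $dA(z)=\frac{dx\,dy}{\pi}$. A radial weight is a non-negative $\omega\in L^1([0,1))$ extended by $\omega(z)=\omega(|z|)$; always assume $\widehat\omega(r)=\int_r^1\omega(s)\,ds>0$ for all $0\le r<1$. $\omega\in\widehat{\mathcal{D}}$ means there is $C\ge1$ with $\widehat\omega(r)\le C\widehat\omega(\frac{1+r}{2})$ for all $0\le r<1$. Moments: $\omega_x=\int_0^1 r^x\omega(r)\,dr$. $D^1_\omega$ consists of $f\in\mathcal H(\mathbb D)$ with $\|f\|_{D^1_\omega}=\int_{\mathbb D}|f'|\omega\,dA+|f(0)|<\infty$; $D^1_0$ is the case $\omega\equiv1$. For $g\in\mathcal H(\mathbb D)$, $T_g(f)(z)=\int_0^z f(\zeta)g'(\zeta)\,d\zeta$. $T_c(X,H^\infty)$ is the set of $g\in\mathcal H(\mathbb D)$ such that $T_g:X\to H^\infty$ is compact. *)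

theory Defs
  imports "HOL-Complex_Analysis.Complex_Analysis"
begin

text \<open>Radial weights on [0,1); the weight at z in the disc is omega (cmod z).\<close>

definition omega_hat :: "(real \<Rightarrow> real) \<Rightarrow> real \<Rightarrow> real" where
  "omega_hat \<omega> r = (LBINT s:{r..<1}. \<omega> s)"

definition radial_weight :: "(real \<Rightarrow> real) \<Rightarrow> bool" where
  "radial_weight \<omega> \<longleftrightarrow>
     (\<forall>s\<in>{0..<1}. 0 \<le> \<omega> s) \<and> set_integrable lborel {0..<1::real} \<omega> \<and>
     (\<forall>r\<in>{0..<1}. omega_hat \<omega> r > 0)"

definition D_hat :: "(real \<Rightarrow> real) \<Rightarrow> bool" where
  "D_hat \<omega> \<longleftrightarrow> (\<exists>C\<ge>1. \<forall>r\<in>{0..<1::real}. omega_hat \<omega> r \<le> C * omega_hat \<omega> ((1 + r) / 2))"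

definition moment :: "(real \<Rightarrow> real) \<Rightarrow> nat \<Rightarrow> real" where
  "moment \<omega> k = (LBINT s:{0..<1}. s ^ k * \<omega> s)"

text \<open>Area integral with dA = dx dy / pi over the unit disc.\<close>

definition D1_integral :: "(real \<Rightarrow> real) \<Rightarrow> (complex \<Rightarrow> complex) \<Rightarrow> ennreal" where
  "D1_integral \<omega> f = (\<integral>\<^sup>+ z \<in> ball 0 1. ennreal (cmod (deriv f z) * \<omega> (cmod z) / pi) \<partial>lborel)"

definition D1_space :: "(real \<Rightarrow> real) \<Rightarrow> (complex \<Rightarrow> complex) set" where
  "D1_space \<omega> = {f. f holomorphic_on ball 0 1 \<and> D1_integral \<omega> f < \<infinity>}"

definition D1_norm :: "(real \<Rightarrow> real) \<Rightarrow> (complex \<Rightarrow> complex) \<Rightarrow> real" where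
  "D1_norm \<omega> f = enn2real (D1_integral \<omega> f) + cmod (f 0)"

definition T_op :: "(complex \<Rightarrow> complex) \<Rightarrow> (complex \<Rightarrow> complex) \<Rightarrow> complex \<Rightarrow> complex" where
  "T_op g f z = contour_integral (linepath 0 z) (\<lambda>\<zeta>. f \<zeta> * deriv g \<zeta>)"

text \<open>T_g : D^1_omega -> H^infinity is compact: it maps into bounded functions on the disc,
  and the image of every norm-bounded sequence has a subsequence that is Cauchy in the
  sup norm of H^infinity (H^infinity is complete, so this is relative compactness of the
  image of the unit ball).\<close>

definition T_compact_D1_Hinf :: "(real \<Rightarrow> real) \<Rightarrow> (complex \<Rightarrow> complex) \<Rightarrow> bool" where
  "T_compact_D1_Hinf \<omega> g \<longleftrightarrow>
     (\<forall>f\<in>D1_space \<omega>. bounded (T_op g f ` ball 0 1)) \<and>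
     (\<forall>F :: nat \<Rightarrow> complex \<Rightarrow> complex. \<forall>B::real.
        (\<forall>n. F n \<in> D1_space \<omega> \<and> D1_norm \<omega> (F n) \<le> B) \<longrightarrow>
        (\<exists>\<phi>::nat \<Rightarrow> nat. strict_mono \<phi> \<and>
           (\<forall>e>0. \<exists>N. \<forall>m\<ge>N. \<forall>n\<ge>N. \<forall>z\<in>ball 0 1.
              cmod (T_op g (F (\<phi> m)) z - T_op g (F (\<phi> n)) z) < e)))"

definition Tc_D1_Hinf :: "(real \<Rightarrow> real) \<Rightarrow> (complex \<Rightarrow> complex) set" where
  "Tc_D1_Hinf \<omega> = {g. g holomorphic_on ball 0 1 \<and> T_compact_D1_Hinf \<omega> g}"

definition identity_compact_D1 :: "(real \<Rightarrow> real) \<Rightarrow> bool" where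
  "identity_compact_D1 \<omega> \<longleftrightarrow>
     D1_space \<omega> \<subseteq> D1_space (\<lambda>_. 1) \<and>
     (\<forall>F :: nat \<Rightarrow> complex \<Rightarrow> complex. \<forall>B::real.
        (\<forall>n. F n \<in> D1_space \<omega> \<and> D1_norm \<omega> (F n) \<le> B) \<longrightarrow>
        (\<exists>\<phi>::nat \<Rightarrow> nat. strict_mono \<phi> \<and>
           (\<forall>e>0. \<exists>N. \<forall>m\<ge>N. \<forall>n\<ge>N.
              D1_norm (\<lambda>_. 1) (\<lambda>z. F (\<phi> m) z - F (\<phi> n) z) < e)))"

end

theory Submission
  imports Defs
begin

text \<open>
  In polar coordinates the \<open>D\<^sup>1\<close> integral of \<open>f\<close> is the integral of \<open>2 r \<omega>(r)\<close> against the
  circular mean \<open>M(r)\<close> of \<open>|f'|\<close>, and \<open>M\<close> is increasing. Write \<open>W\<close> for the tail integral of the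
  weight.

  If \<open>(1 - r) / W(r)\<close> tends to 0, monotonicity of \<open>M\<close> (via the layer-cake formula) shows that the
  part of the unweighted integral near the circle is a small multiple of the weighted one;
  together with Montel's theorem this makes the identity compact. If the identity is compact, so
  is the operator with symbol \<open>g(z) = z\<close>, because integration maps the unweighted space boundedly
  into the bounded functions. Finally, suppose that \<open>(1 - r) / W(r)\<close> does not tend to 0. The
  doubling condition bounds the moment of order \<open>n\<close> by a multiple of \<open>W(1 - 1/n)\<close>, hence \<open>n\<close> times
  that moment is bounded along a subsequence. Primitives of rotated Fejer kernels with frequencies
  between \<open>n\<close> and \<open>3n\<close>, divided by \<open>n\<close> times the moment, are bounded in the weighted space, tend to
  0 locally uniformly, and are at least a constant times \<open>n\<close> at a prescribed point of the circle
  of radius \<open>1 - 1/n\<close>. If the operator with symbol \<open>g\<close> is compact, Cauchy's estimate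
  applied to their images forces \<open>g'\<close> to vanish by the maximum principle.

  The Abel means in (iii) have coefficients comparable to \<open>(1 - r) / W(r)\<close> at \<open>r = 1 - 1/k\<close>.
\<close>

subsection \<open>Polar coordinates\<close>

text \<open>Cauchy's estimate at distance about \<open>1/n\<close> from the unit circle bounds the
  derivative of an image only by about \<open>e * n\<close>, where \<open>e\<close> is the sup norm
  of the image. Monomials \<open>z ^ n\<close> are too weak against this: normalised in the weighted
  space they have size about \<open>1 / (n * moment)\<close> at radius \<open>1 - 1/n\<close>, so a
  contradiction would require the square of \<open>n\<close> times the moment to be bounded. A Fejer
  kernel has circular mean about \<open>n\<close> but peak about the square of \<open>n\<close>; its
  normalised primitive reaches about \<open>1 / moment\<close> at one point, and what is then
  required is exactly that \<open>n * moment\<close> be bounded along a subsequence. The price is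
  that the gain is local, while nothing tells where \<open>g'\<close> is large; hence the rotation.
  A limsup moreover grants only some circles, and the maximum principle supplies on each of them a
  point where \<open>g'\<close> is at least as large as at a fixed interior point. Doubling enters
  through the upper bound for the moments; the lower bound comes from the monotonicity of
  powers.\<close>

lemma measurable_Complex_pair [measurable]:
  "(\<lambda>(x, y). Complex x y) \<in> borel_measurable (borel \<Otimes>\<^sub>M borel)"
  unfolding borel_prod by (intro borel_measurable_continuous_onI)
      (auto intro!: continuous_intros simp: case_prod_unfold Complex_eq)

lemma measurable_Complex [measurable (raw)]:
  assumes "f \<in> borel_measurable M" "g \<in> borel_measurable M"
  shows "(\<lambda>x. Complex (f x) (g x)) \<in> borel_measurable M"
  using measurable_compose[OF measurable_Pair[OF assms] measurable_Complex_pair] by simp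

text \<open>Lebesgue measure is determined by boxes, and \<open>box l u\<close> pulls back to a
  product of two open intervals, one for each of the basis vectors \<open>1\<close> and
  \<open>\<i>\<close>.\<close>

lemma lborel_complex_eq_pair:
  "(lborel :: complex measure) = distr (lborel \<Otimes>\<^sub>M lborel) borel (\<lambda>(x, y). Complex x y)"
proof (rule lborel_eqI)
  have C [measurable]: "(\<lambda>(x, y). Complex x y) \<in> borel_measurable (lborel \<Otimes>\<^sub>M lborel)"
    by measurable
  fix l u :: complex assume lu: "\<And>b. b \<in> Basis \<Longrightarrow> l \<bullet> b \<le> u \<bullet> b"
  have le: "Re l \<le> Re u" "Im l \<le> Im u"
    using lu[of 1] lu[of \<i>] by (auto simp: Basis_complex_def)
  have "emeasure (distr (lborel \<Otimes>\<^sub>M lborel) borel (\<lambda>(x, y). Complex x y)) (box l u)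
      = emeasure (lborel \<Otimes>\<^sub>M lborel) ({Re l<..<Re u} \<times> {Im l<..<Im u})"
    by (subst emeasure_distr[OF C])
       (auto intro!: arg_cong2[where f=emeasure] simp: box_def Basis_complex_def space_pair_measure)
  also have "\<dots> = ennreal ((Re u - Re l) * (Im u - Im l))"
    using le by (subst lborel.emeasure_pair_measure_Times) (auto simp: ennreal_mult)
  also have "(Re u - Re l) * (Im u - Im l) = (\<Prod>b\<in>Basis. (u - l) \<bullet> b)"
    by (simp add: Basis_complex_def)
  finally show "emeasure (distr (lborel \<Otimes>\<^sub>M lborel) borel (\<lambda>(x, y). Complex x y)) (box l u)
      = ennreal (\<Prod>b\<in>Basis. (u - l) \<bullet> b)" .
qed auto

lemma nn_integral_complex_iterated:
  assumes [measurable]: "u \<in> borel_measurable (borel :: complex measure)"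
  shows "(\<integral>\<^sup>+z. u z \<partial>lborel) = (\<integral>\<^sup>+x. \<integral>\<^sup>+y. u (Complex x y) \<partial>lborel \<partial>lborel)"
proof -
  have "(\<integral>\<^sup>+z. u z \<partial>lborel) = (\<integral>\<^sup>+p. u (case p of (x, y) \<Rightarrow> Complex x y) \<partial>(lborel \<Otimes>\<^sub>M lborel))"
    by (subst lborel_complex_eq_pair, subst nn_integral_distr) (auto simp: case_prod_unfold)
  also have "\<dots> = (\<integral>\<^sup>+x. \<integral>\<^sup>+y. u (Complex x y) \<partial>lborel \<partial>lborel)"
    by (subst lborel.nn_integral_fst[symmetric]) (auto simp: case_prod_unfold)
  finally show ?thesis .
qed

text \<open>The substitution rule for compact intervals is applied between
  \<open>arctan (- n)\<close> and \<open>arctan n\<close>; letting \<open>n\<close> grow exhausts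
  both sides.\<close>

lemma nn_integral_tan_substitution:
  fixes v :: "real \<Rightarrow> ennreal"
  assumes [measurable]: "v \<in> borel_measurable borel"
  shows "(\<integral>\<^sup>+t. v t \<partial>lborel) =
    (\<integral>\<^sup>+s. v (tan s) * ennreal (inverse ((cos s)\<^sup>2)) * indicator {-pi/2<..<pi/2} s \<partial>lborel)"
proof -
  have [measurable]: "tan \<in> borel_measurable (borel :: real measure)"
    unfolding tan_def[abs_def] by measurable
  define A where "A n = {- real n..real n}" for n
  define B where "B n = {arctan (- real n)..arctan (real n)}" for n
  have incA: "incseq A"
    unfolding A_def by (intro incseq_SucI) auto
  have incB: "incseq B"
    unfolding B_def by (intro incseq_SucI atLeastatMost_subset_iff[THEN iffD2] disjI2 conjI)
      (auto simp: arctan_le_iff simp del: arctan_minus)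
  have UA: "(\<Union>n. A n) = UNIV"
  proof (rule UNIV_eq_I[symmetric])
    fix x :: real
    obtain n where "\<bar>x\<bar> \<le> real n" using real_arch_simple by blast
    then have "x \<in> A n" by (auto simp: A_def)
    then show "x \<in> (\<Union>n. A n)" by blast
  qed
  have UB: "(\<Union>n. B n) = {-pi/2<..<pi/2}"
  proof safe
    fix x n assume "x \<in> B n"
    then show "x \<in> {-pi/2<..<pi/2}"
      using arctan_lbound[of "- real n"] arctan_ubound[of "real n"] by (auto simp: B_def)
  next
    fix x assume x: "x \<in> {-pi/2<..<pi/2}"
    obtain n where n: "\<bar>tan x\<bar> \<le> real n" using real_arch_simple by blast
    have "arctan (tan x) = x" using x by (intro arctan_tan) auto
    moreover have "arctan (- real n) \<le> arctan (tan x)" "arctan (tan x) \<le> arctan (real n)"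
      using n by (auto simp: arctan_le_iff simp del: arctan_minus)
    ultimately show "x \<in> (\<Union>n. B n)" by (auto simp: B_def)
  qed
  have eq: "(\<integral>\<^sup>+t. v t * indicator (A n) t \<partial>lborel) =
    (\<integral>\<^sup>+s. v (tan s) * ennreal (inverse ((cos s)\<^sup>2)) * indicator (B n) s \<partial>lborel)" for n
  \<comment> \<open>The substitution rule wants a nondegenerate interval; for \<open>n = 0\<close>
    both sides are integrals over a single point.\<close>
  proof (cases "n = 0")
    case True
    have "(\<integral>\<^sup>+t. v t * indicator {0} t \<partial>lborel) = 0" 
      by (intro nn_integral_null_set) auto
    moreover have "(\<integral>\<^sup>+s. v (tan s) * ennreal (inverse ((cos s)\<^sup>2)) * indicator {0} s \<partial>lborel) = 0"
      by (intro nn_integral_null_set) auto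
    ultimately show ?thesis using True by (simp add: A_def B_def)
  next
    case False
    have cos: "cos x \<noteq> 0" if "x \<in> B n" for x
    proof -
      have "x \<in> {-pi/2<..<pi/2}" using that UB by blast
      then show ?thesis using cos_gt_zero_pi[of x] by auto
    qed
    have "(\<integral>\<^sup>+t. v t * indicator {tan (arctan (- real n))..tan (arctan (real n))} t \<partial>lborel) =
      (\<integral>\<^sup>+s. v (tan s) * ennreal (inverse ((cos s)\<^sup>2)) * indicator {arctan (- real n)..arctan (real n)} s \<partial>lborel)"
    proof (rule nn_integral_substitution_aux)
      show "(tan has_real_derivative inverse ((cos x)\<^sup>2)) (at x)" 
        if "x \<in> {arctan (- real n)..arctan (real n)}" for x
        using cos[of x] that by (intro DERIV_tan) (auto simp: B_def)
      show "continuous_on {arctan (- real n)..arctan (real n)} (\<lambda>x. inverse ((cos x)\<^sup>2))"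
        using cos by (intro continuous_intros) (auto simp: B_def)
      show "arctan (- real n) < arctan (real n)" using False by (auto simp: arctan_less_iff simp del: arctan_minus)
    qed auto
    then show ?thesis by (simp add: A_def B_def tan_arctan del: arctan_minus)
  qed
  \<comment> \<open>Monotone convergence, in the form of continuity from below of the measure with
    density \<open>w\<close>.\<close>
  have lim: "(\<lambda>n. \<integral>\<^sup>+t. w t * indicator (S n) t \<partial>lborel) \<longlonglongrightarrow> (\<integral>\<^sup>+t. w t * indicator (\<Union>n. S n) t \<partial>lborel)"
    if "incseq S" and [measurable]: "w \<in> borel_measurable borel" "\<And>n. S n \<in> sets borel" for w and S :: "nat \<Rightarrow> real set"
  proof -
    have "range S \<subseteq> sets (density lborel w)" by auto
    from Lim_emeasure_incseq[OF this \<open>incseq S\<close>] show ?thesis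
      by (simp add: emeasure_density sets.countable_UN)
  qed
  have "(\<lambda>n. \<integral>\<^sup>+t. v t * indicator (A n) t \<partial>lborel) \<longlonglongrightarrow> (\<integral>\<^sup>+t. v t * indicator (\<Union>n. A n) t \<partial>lborel)"
    by (rule lim[OF incA]) (auto simp: A_def)
  moreover have "(\<lambda>n. \<integral>\<^sup>+s. v (tan s) * ennreal (inverse ((cos s)\<^sup>2)) * indicator (B n) s \<partial>lborel)
     \<longlonglongrightarrow> (\<integral>\<^sup>+s. v (tan s) * ennreal (inverse ((cos s)\<^sup>2)) * indicator (\<Union>n. B n) s \<partial>lborel)"
    by (rule lim[OF incB]) (auto simp: B_def)
  ultimately have "(\<integral>\<^sup>+t. v t * indicator (\<Union>n. A n) t \<partial>lborel) = 
     (\<integral>\<^sup>+s. v (tan s) * ennreal (inverse ((cos s)\<^sup>2)) * indicator (\<Union>n. B n) s \<partial>lborel)"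
    unfolding eq by (rule LIMSEQ_unique)
  then show ?thesis by (simp add: UA UB)
qed

text \<open>Lines through the origin are parametrised by slope: \<open>y = x * t\<close>, then
  \<open>t = tan s\<close>, then \<open>x = r * cos s\<close>. The three Jacobian factors multiply
  to \<open>\<bar>r\<bar>\<close>. The radius is signed, so half a turn of \<open>s\<close> covers
  the plane up to the null line \<open>x = 0\<close>.\<close>

lemma nn_integral_polar_full_lines:
  assumes [measurable]: "u \<in> borel_measurable (borel :: complex measure)"
  shows "(\<integral>\<^sup>+z. u z \<partial>lborel) =
    (\<integral>\<^sup>+s. (\<integral>\<^sup>+r. ennreal \<bar>r\<bar> * u (of_real r * cis s) \<partial>lborel) * indicator {-pi/2<..<pi/2} s \<partial>lborel)"
proof -
  have "(\<integral>\<^sup>+z. u z \<partial>lborel) = (\<integral>\<^sup>+x. \<integral>\<^sup>+y. u (Complex x y) \<partial>lborel \<partial>lborel)"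
    by (rule nn_integral_complex_iterated) simp
  also have "\<dots> = (\<integral>\<^sup>+x. \<integral>\<^sup>+t. ennreal \<bar>x\<bar> * u (Complex x (x * t)) \<partial>lborel \<partial>lborel)"
  proof (rule nn_integral_cong_AE, use AE_lborel_singleton[of 0] in eventually_elim)
    fix x :: real assume "x \<noteq> 0"
    then show "(\<integral>\<^sup>+y. u (Complex x y) \<partial>lborel) = (\<integral>\<^sup>+t. ennreal \<bar>x\<bar> * u (Complex x (x * t)) \<partial>lborel)"
      by (subst nn_integral_real_affine[of _ x 0]) (auto simp: nn_integral_cmult)
  qed
  also have "\<dots> = (\<integral>\<^sup>+t. \<integral>\<^sup>+x. ennreal \<bar>x\<bar> * u (Complex x (x * t)) \<partial>lborel \<partial>lborel)"
    by (rule lborel_pair.Fubini') measurable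
  also have "\<dots> = (\<integral>\<^sup>+s. (\<integral>\<^sup>+x. ennreal \<bar>x\<bar> * u (Complex x (x * tan s)) \<partial>lborel) *
      ennreal (inverse ((cos s)\<^sup>2)) * indicator {-pi/2<..<pi/2} s \<partial>lborel)"
    by (rule nn_integral_tan_substitution) measurable
  also have "\<dots> = (\<integral>\<^sup>+s. (\<integral>\<^sup>+r. ennreal \<bar>r\<bar> * u (of_real r * cis s) \<partial>lborel) * indicator {-pi/2<..<pi/2} s \<partial>lborel)"
  proof (rule nn_integral_cong)
    fix s :: real
    show "(\<integral>\<^sup>+x. ennreal \<bar>x\<bar> * u (Complex x (x * tan s)) \<partial>lborel) *
      ennreal (inverse ((cos s)\<^sup>2)) * indicator {-pi/2<..<pi/2} s
      = (\<integral>\<^sup>+r. ennreal \<bar>r\<bar> * u (of_real r * cis s) \<partial>lborel) * indicator {-pi/2<..<pi/2} s"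
    proof (cases "s \<in> {-pi/2<..<pi/2}")
      case True
      then have c: "cos s > 0" using cos_gt_zero_pi[of s] by auto
      have "(\<integral>\<^sup>+x. ennreal \<bar>x\<bar> * u (Complex x (x * tan s)) \<partial>lborel) =
         ennreal \<bar>cos s\<bar> * (\<integral>\<^sup>+r. ennreal \<bar>0 + cos s * r\<bar> * u (Complex (0 + cos s * r) ((0 + cos s * r) * tan s)) \<partial>lborel)"
        using c by (intro nn_integral_real_affine) auto
      also have "(\<integral>\<^sup>+r. ennreal \<bar>0 + cos s * r\<bar> * u (Complex (0 + cos s * r) ((0 + cos s * r) * tan s)) \<partial>lborel)
        = (\<integral>\<^sup>+r. ennreal (cos s) * (ennreal \<bar>r\<bar> * u (of_real r * cis s)) \<partial>lborel)"
      proof (rule nn_integral_cong)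
        fix r
        have "Complex (0 + cos s * r) ((0 + cos s * r) * tan s) = of_real r * cis s"
          using c by (auto simp: complex_eq_iff tan_def)
        moreover have "ennreal \<bar>0 + cos s * r\<bar> = ennreal (cos s) * ennreal \<bar>r\<bar>"
          using c by (simp add: abs_mult ennreal_mult)
        ultimately show "ennreal \<bar>0 + cos s * r\<bar> * u (Complex (0 + cos s * r) ((0 + cos s * r) * tan s))
          = ennreal (cos s) * (ennreal \<bar>r\<bar> * u (of_real r * cis s))" by (simp add: mult.assoc)
      qed
      also have "\<dots> = ennreal (cos s) * (\<integral>\<^sup>+r. ennreal \<bar>r\<bar> * u (of_real r * cis s) \<partial>lborel)"
        by (rule nn_integral_cmult) (simp add: cis.code)
      finally have e: "(\<integral>\<^sup>+x. ennreal \<bar>x\<bar> * u (Complex x (x * tan s)) \<partial>lborel)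
         = ennreal ((cos s)\<^sup>2) * (\<integral>\<^sup>+r. ennreal \<bar>r\<bar> * u (of_real r * cis s) \<partial>lborel)"
        using c by (simp add: power2_eq_square ennreal_mult mult.assoc)
      have "ennreal ((cos s)\<^sup>2) * X * ennreal (inverse ((cos s)\<^sup>2)) = X" for X
      proof -
        have "ennreal ((cos s)\<^sup>2) * X * ennreal (inverse ((cos s)\<^sup>2)) = X * (ennreal ((cos s)\<^sup>2) * ennreal (inverse ((cos s)\<^sup>2)))"
          by (simp add: mult_ac)
        also have "ennreal ((cos s)\<^sup>2) * ennreal (inverse ((cos s)\<^sup>2)) = 1"
          using c by (subst ennreal_mult[symmetric]) auto
        finally show ?thesis by simp
      qed
      then show ?thesis using e True by simp
    qed auto
  qed
  finally show ?thesis .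
qed

lemma borel_measurable_cis [measurable]: "cis \<in> borel_measurable borel"
  by (intro borel_measurable_continuous_onI continuous_intros)

text \<open>A negative radius is a positive one after half a turn, which completes the half turn of
  angles: the arc from \<open>-1/4\<close> to \<open>1/4\<close> is joined to the arc from
  \<open>1/4\<close> to \<open>3/4\<close>, and the common endpoint is null. Measuring angles in
  turns makes the inner integral a mean of total mass one.\<close>

lemma nn_integral_polar:
  assumes [measurable]: "u \<in> borel_measurable (borel :: complex measure)"
  shows "(\<integral>\<^sup>+z. u z \<partial>lborel) = (\<integral>\<^sup>+r. ennreal (2 * pi * r) *
    (\<integral>\<^sup>+t. u (of_real r * cis (2 * pi * t)) * indicator {-1/4<..<3/4} t \<partial>lborel) * indicator {0<..} r \<partial>lborel)"
proof -
  have split: "(\<integral>\<^sup>+r. g r \<partial>lborel) = (\<integral>\<^sup>+r. (g r + g (- r)) * indicator {0<..} r \<partial>lborel)"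
    if [measurable]: "g \<in> borel_measurable borel" for g :: "real \<Rightarrow> ennreal"
  proof -
    have "(\<integral>\<^sup>+r. g r \<partial>lborel) = (\<integral>\<^sup>+r. g r * indicator {0<..} r + g r * indicator {..<0} r \<partial>lborel)"
      by (rule nn_integral_cong_AE, use AE_lborel_singleton[of 0] in eventually_elim)
         (auto simp: indicator_def)
    also have "\<dots> = (\<integral>\<^sup>+r. g r * indicator {0<..} r \<partial>lborel) + (\<integral>\<^sup>+r. g r * indicator {..<0} r \<partial>lborel)"
      by (rule nn_integral_add) auto
    also have "(\<integral>\<^sup>+r. g r * indicator {..<0} r \<partial>lborel) = (\<integral>\<^sup>+r. g (-r) * indicator {0<..} r \<partial>lborel)"
      by (subst nn_integral_real_affine[of _ "-1" 0])
         (auto intro!: nn_integral_cong simp: indicator_def)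
    also have "(\<integral>\<^sup>+r. g r * indicator {0<..} r \<partial>lborel) + \<dots> = (\<integral>\<^sup>+r. (g r + g (- r)) * indicator {0<..} r \<partial>lborel)"
      by (subst nn_integral_add[symmetric]) (auto simp: distrib_right)
    finally show ?thesis .
  qed
  have angle: "(\<integral>\<^sup>+s. (u (of_real r * cis s) + u (of_real (-r) * cis s)) * indicator {-pi/2<..<pi/2} s \<partial>lborel)
      = ennreal (2 * pi) * (\<integral>\<^sup>+t. u (of_real r * cis (2 * pi * t)) * indicator {-1/4<..<3/4} t \<partial>lborel)" for r
  proof -
    have "(\<integral>\<^sup>+s. u (of_real r * cis s) * indicator {-pi/2<..<pi/2} s \<partial>lborel)
       = ennreal \<bar>2 * pi\<bar> * (\<integral>\<^sup>+t. u (of_real r * cis (0 + 2 * pi * t)) * indicator {-pi/2<..<pi/2} (0 + 2 * pi * t) \<partial>lborel)"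
      by (rule nn_integral_real_affine) auto
    also have "(\<lambda>t. indicator {-pi/2<..<pi/2} (0 + 2 * pi * t)) = (indicator {-1/4<..<1/4} :: real \<Rightarrow> ennreal)"
    proof
      fix t :: real
      have "-pi/2 < 0 + 2 * pi * t \<longleftrightarrow> pi * (-1/4) < pi * t" by (simp add: field_simps)
      moreover have "0 + 2 * pi * t < pi / 2 \<longleftrightarrow> pi * t < pi * (1/4)" by (simp add: field_simps)
      ultimately show "indicator {-pi/2<..<pi/2} (0 + 2 * pi * t) = (indicator {-1/4<..<1/4} t :: ennreal)"
        unfolding mult_less_cancel_left_pos[OF pi_gt_zero] by (auto simp: indicator_def)
    qed
    finally have 1: "(\<integral>\<^sup>+s. u (of_real r * cis s) * indicator {-pi/2<..<pi/2} s \<partial>lborel)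
       = ennreal (2 * pi) * (\<integral>\<^sup>+t. u (of_real r * cis (2 * pi * t)) * indicator {-1/4<..<1/4} t \<partial>lborel)"
      by simp
    have "(\<integral>\<^sup>+s. u (of_real (-r) * cis s) * indicator {-pi/2<..<pi/2} s \<partial>lborel)
       = ennreal \<bar>2 * pi\<bar> * (\<integral>\<^sup>+t. u (of_real (-r) * cis (-pi + 2 * pi * t)) * indicator {-pi/2<..<pi/2} (-pi + 2 * pi * t) \<partial>lborel)"
      by (rule nn_integral_real_affine) auto
    also have "(\<lambda>t. indicator {-pi/2<..<pi/2} (-pi + 2 * pi * t)) = (indicator {1/4<..<3/4} :: real \<Rightarrow> ennreal)"
    proof
      fix t :: real
      have "-pi/2 < -pi + 2 * pi * t \<longleftrightarrow> pi * (1/4) < pi * t" by (simp add: field_simps)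
      moreover have "-pi + 2 * pi * t < pi / 2 \<longleftrightarrow> pi * t < pi * (3/4)" by (simp add: field_simps)
      ultimately show "indicator {-pi/2<..<pi/2} (-pi + 2 * pi * t) = (indicator {1/4<..<3/4} t :: ennreal)"
        unfolding mult_less_cancel_left_pos[OF pi_gt_zero] by (auto simp: indicator_def)
    qed
    also have "(\<lambda>t. of_real (-r) * cis (-pi + 2 * pi * t)) = (\<lambda>t. of_real r * cis (2 * pi * t))"
      by (auto simp: fun_eq_iff complex_eq_iff cos_diff sin_diff)
    finally have 2: "(\<integral>\<^sup>+s. u (of_real (-r) * cis s) * indicator {-pi/2<..<pi/2} s \<partial>lborel)
       = ennreal (2 * pi) * (\<integral>\<^sup>+t. u (of_real r * cis (2 * pi * t)) * indicator {1/4<..<3/4} t \<partial>lborel)"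
      by simp
    have "(\<integral>\<^sup>+s. (u (of_real r * cis s) + u (of_real (-r) * cis s)) * indicator {-pi/2<..<pi/2} s \<partial>lborel)
        = (\<integral>\<^sup>+s. u (of_real r * cis s) * indicator {-pi/2<..<pi/2} s \<partial>lborel)
        + (\<integral>\<^sup>+s. u (of_real (-r) * cis s) * indicator {-pi/2<..<pi/2} s \<partial>lborel)"
      by (subst nn_integral_add[symmetric]) (auto simp: distrib_right)
    also have "\<dots> = ennreal (2 * pi) * (\<integral>\<^sup>+t. u (of_real r * cis (2 * pi * t)) * indicator {-1/4<..<1/4} t
        + u (of_real r * cis (2 * pi * t)) * indicator {1/4<..<3/4} t \<partial>lborel)"
      unfolding 1 2 by (subst nn_integral_add) (auto simp: distrib_left)
    also have "(\<integral>\<^sup>+t. u (of_real r * cis (2 * pi * t)) * indicator {-1/4<..<1/4} t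
        + u (of_real r * cis (2 * pi * t)) * indicator {1/4<..<3/4} t \<partial>lborel)
        = (\<integral>\<^sup>+t. u (of_real r * cis (2 * pi * t)) * indicator {-1/4<..<3/4} t \<partial>lborel)"
      by (rule nn_integral_cong_AE, use AE_lborel_singleton[of "1/4"] in eventually_elim)
         (auto simp: indicator_def)
    finally show ?thesis .
  qed
  have "(\<integral>\<^sup>+z. u z \<partial>lborel) =
    (\<integral>\<^sup>+s. (\<integral>\<^sup>+r. ennreal \<bar>r\<bar> * u (of_real r * cis s) \<partial>lborel) * indicator {-pi/2<..<pi/2} s \<partial>lborel)"
    by (rule nn_integral_polar_full_lines) simp
  also have "\<dots> = (\<integral>\<^sup>+s. \<integral>\<^sup>+r. ennreal r * ((u (of_real r * cis s) + u (of_real (-r) * cis s))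
      * indicator {-pi/2<..<pi/2} s) * indicator {0<..} r \<partial>lborel \<partial>lborel)"
  proof (rule nn_integral_cong)
    fix s :: real
    have "(\<integral>\<^sup>+r. ennreal \<bar>r\<bar> * u (of_real r * cis s) \<partial>lborel) * indicator {-pi/2<..<pi/2} s
      = (\<integral>\<^sup>+r. (ennreal \<bar>r\<bar> * u (of_real r * cis s)) * indicator {-pi/2<..<pi/2} s \<partial>lborel)"
      by (rule nn_integral_multc[symmetric]) auto
    also have "\<dots> = (\<integral>\<^sup>+r. ennreal r * ((u (of_real r * cis s) + u (of_real (-r) * cis s))
      * indicator {-pi/2<..<pi/2} s) * indicator {0<..} r \<partial>lborel)"
      by (subst split) (auto intro!: nn_integral_cong simp: indicator_def distrib_left)
    finally show "(\<integral>\<^sup>+r. ennreal \<bar>r\<bar> * u (of_real r * cis s) \<partial>lborel) * indicator {-pi/2<..<pi/2} s = \<dots>" .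
  qed
  also have "\<dots> = (\<integral>\<^sup>+r. \<integral>\<^sup>+s. ennreal r * ((u (of_real r * cis s) + u (of_real (-r) * cis s))
      * indicator {-pi/2<..<pi/2} s) * indicator {0<..} r \<partial>lborel \<partial>lborel)"
    by (rule lborel_pair.Fubini') measurable
  also have "\<dots> = (\<integral>\<^sup>+r. ennreal (2 * pi * r) *
    (\<integral>\<^sup>+t. u (of_real r * cis (2 * pi * t)) * indicator {-1/4<..<3/4} t \<partial>lborel) * indicator {0<..} r \<partial>lborel)"
  proof (rule nn_integral_cong)
    fix r :: real
    have "(\<integral>\<^sup>+s. ennreal r * ((u (of_real r * cis s) + u (of_real (-r) * cis s))
      * indicator {-pi/2<..<pi/2} s) * indicator {0<..} r \<partial>lborel) =
      ennreal r * (\<integral>\<^sup>+s. (u (of_real r * cis s) + u (of_real (-r) * cis s)) * indicator {-pi/2<..<pi/2} s \<partial>lborel)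
      * indicator {0<..} r"
      by (subst nn_integral_multc, simp, subst nn_integral_cmult) auto
    also have "\<dots> = ennreal r * (ennreal (2 * pi) * (\<integral>\<^sup>+t. u (of_real r * cis (2 * pi * t)) * indicator {-1/4<..<3/4} t \<partial>lborel))
      * indicator {0<..} r"
      unfolding angle ..
    also have "\<dots> = ennreal (2 * pi * r) *
      (\<integral>\<^sup>+t. u (of_real r * cis (2 * pi * t)) * indicator {-1/4<..<3/4} t \<partial>lborel) * indicator {0<..} r"
      by (auto simp: indicator_def ennreal_mult mult_ac)
    finally show "(\<integral>\<^sup>+s. ennreal r * ((u (of_real r * cis s) + u (of_real (-r) * cis s))
      * indicator {-pi/2<..<pi/2} s) * indicator {0<..} r \<partial>lborel) = \<dots>" .
  qed
  finally show ?thesis .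
qed

subsection \<open>Circular means of analytic functions\<close>

text \<open>The integral mean of order one from Hardy space theory, with the angle measured in
  turns.\<close>

definition circle_mean :: "(complex \<Rightarrow> complex) \<Rightarrow> real \<Rightarrow> real" where
  "circle_mean F r = integral {0..1} (\<lambda>t. cmod (F (of_real r * cis (2 * pi * t))))"

text \<open>The difference \<open>G (x + 1) - G x\<close> has derivative
  \<open>f (x + 1) - f x = 0\<close>. The base point \<open>b\<close> of the primitive
  \<open>G\<close> lies strictly to the left of both \<open>a\<close> and \<open>0\<close>, so that
  two-sided derivatives exist at both.\<close>

lemma integral_period_one_shift:
  fixes f :: "real \<Rightarrow> real"
  assumes cont: "continuous_on UNIV f" and per: "\<And>t. f (t + 1) = f t"
  shows "integral {a..a+1} f = integral {0..1} f"
proof -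
  define b where "b = min a 0 - 1"
  have int: "f integrable_on {c..d}" for c d
    by (intro integrable_continuous_real continuous_on_subset[OF cont]) auto
  define G where "G x = integral {b..x} f" for x
  have G: "(G has_real_derivative f x) (at x)" if "x > b" for x
  proof -
    have "(G has_real_derivative f x) (at x within {b..x+1})"
      unfolding G_def using that
      by (intro integral_has_real_derivative continuous_on_subset[OF cont]) auto
    moreover have "x \<in> interior {b..x+1}" using that by simp
    ultimately show ?thesis by (metis at_within_interior)
  qed
  have "((\<lambda>x. G (x + 1) - G x) has_real_derivative 0) (at x)" if "x > b" for x
    using that by (auto intro!: derivative_eq_intros DERIV_chain2[OF G] G simp: per)
  then have D: "((\<lambda>x. G (x + 1) - G x) has_real_derivative 0) (at x within {b<..})" if "x \<in> {b<..}" for x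
    using that by (meson DERIV_subset greaterThan_iff has_field_derivative_at_within)
  have "(G (a + 1) - G a) = (G (0 + 1) - G 0)"
  proof -
    have "\<exists>c. \<forall>x\<in>{b<..}. G (x + 1) - G x = c"
      using D by (intro has_field_derivative_zero_constant) auto
    moreover have "a \<in> {b<..}" "0 \<in> {b<..}" by (auto simp: b_def)
    ultimately show ?thesis by metis
  qed
  moreover have "G (c + 1) - G c = integral {c..c+1} f" if "c \<ge> b" for c
    using Henstock_Kurzweil_Integration.integral_combine[of b c "c+1" f] that int
    by (simp add: G_def)
  moreover have "a \<ge> b" "0 \<ge> b" by (auto simp: b_def)
  ultimately show ?thesis by (metis add.left_neutral)
qed

text \<open>Shifting the parameter by the argument of \<open>z\<close>, measured in turns, replaces
  \<open>z\<close> by its modulus. The free \<open>a\<close> accommodates the arc that polar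
  coordinates produce, the free \<open>z\<close> the maximum principle argument for
  monotonicity.\<close>

lemma circle_mean_arc:
  assumes F: "continuous_on (ball 0 1) F" and z: "cmod z < 1"
  shows "integral {a..a+1} (\<lambda>t. cmod (F (z * cis (2 * pi * t)))) = circle_mean F (cmod z)"
    and "continuous_on UNIV (\<lambda>t. F (z * cis (2 * pi * t)))"
proof -
  have c: "continuous_on UNIV (\<lambda>t. F (w * cis (2 * pi * t)))" if "cmod w < 1" for w
    using that by (intro continuous_on_compose2[OF F] continuous_intros) (auto simp: norm_mult)
  then show "continuous_on UNIV (\<lambda>t. F (z * cis (2 * pi * t)))" using z by blast
  have shift: "integral {a..a+1} (\<lambda>t. cmod (F (w * cis (2 * pi * t)))) = integral {0..1} (\<lambda>t. cmod (F (w * cis (2 * pi * t))))"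
    if w: "cmod w < 1" for a w
  proof (rule integral_period_one_shift)
    show "continuous_on UNIV (\<lambda>t. cmod (F (w * cis (2 * pi * t))))"
      using c[OF w] by (rule continuous_on_norm)
    fix t :: real
    have "cis (2 * pi * (t + 1)) = cis (2 * pi * t)"
      by (simp add: distrib_left flip: cis_mult)
    then show "cmod (F (w * cis (2 * pi * (t + 1)))) = cmod (F (w * cis (2 * pi * t)))" by simp
  qed
  define b where "b = Arg z / (2 * pi)"
  have zb: "z * cis (2 * pi * t) = of_real (cmod z) * cis (2 * pi * (t + b))" for t
  proof -
    have "z = of_real (cmod z) * cis (2 * pi * b)"
      by (cases "z = 0") (auto simp: b_def cis_Arg sgn_eq)
    then have "z * cis (2 * pi * t) = of_real (cmod z) * (cis (2 * pi * b) * cis (2 * pi * t))"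
      by (metis mult.assoc)
    then show ?thesis by (simp add: cis_mult distrib_left add_ac)
  qed
  have "integral {a..a+1} (\<lambda>t. cmod (F (z * cis (2 * pi * t)))) =
      integral {a..a+1} ((\<lambda>t. cmod (F (of_real (cmod z) * cis (2 * pi * t)))) \<circ> ((+) b))"
    unfolding zb o_def by (simp add: add.commute)
  also have "\<dots> = integral {a + b..(a + 1) + b} (\<lambda>t. cmod (F (of_real (cmod z) * cis (2 * pi * t))))"
    by (rule integral_shift_Icc_real)
  also have "(a + 1) + b = (a + b) + 1"
    by simp
  finally show "integral {a..a+1} (\<lambda>t. cmod (F (z * cis (2 * pi * t)))) = circle_mean F (cmod z)"
    using shift[of "of_real (cmod z)" "a+b"] z by (simp add: circle_mean_def)
qed

lemma circle_mean_eq_nn_integral: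
  assumes F: "continuous_on (ball 0 1) F" and r: "0 \<le> r" "r < 1"
  shows "(\<integral>\<^sup>+t. ennreal (cmod (F (of_real r * cis (2 * pi * t)))) * indicator {a<..<a+1} t \<partial>lborel)
    = ennreal (circle_mean F r)"
proof -
  have z: "cmod (of_real r) < 1" using r by simp
  let ?g = "\<lambda>t. cmod (F (of_real r * cis (2 * pi * t)))"
  have "(?g has_integral circle_mean F r) {a..a+1}"
    using circle_mean_arc[OF F z] r
    by (auto simp: has_integral_iff intro!: integrable_continuous_real continuous_on_norm
         continuous_on_subset[of UNIV])
  then have "(\<integral>\<^sup>+t. ennreal (?g t) * indicator {a..a+1} t \<partial>lborel) = ennreal (circle_mean F r)"
    by (intro nn_integral_has_integral_lebesgue') auto
  also have "(\<integral>\<^sup>+t. ennreal (?g t) * indicator {a..a+1} t \<partial>lborel) = (\<integral>\<^sup>+t. ennreal (?g t) * indicator {a<..<a+1} t \<partial>lborel)"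
    by (rule nn_integral_cong_AE, use AE_lborel_singleton[of a] AE_lborel_singleton[of "a+1"] in eventually_elim)
       (auto simp: indicator_def)
  finally show ?thesis by simp
qed

lemma circle_mean_nonneg: "circle_mean F r \<ge> 0"
  unfolding circle_mean_def
  by (metis Henstock_Kurzweil_Integration.integral_nonneg norm_ge_zero not_integrable_integral order_refl)

text \<open>Duality reduces this to the maximum principle. Integrating the rotations of
  \<open>F\<close> against a multiplier \<open>\<kappa>\<close> of modulus at most one gives a
  holomorphic \<open>\<Phi>\<close> with \<open>cmod (\<Phi> w)\<close> at most the mean of
  \<open>F\<close> at radius \<open>cmod w\<close>; \<open>\<kappa>\<close> is chosen so that this
  bound is attained at \<open>r\<close> up to \<open>e\<close>.\<close>

lemma circle_mean_mono:
  assumes F: "F holomorphic_on ball 0 1" and r: "0 \<le> r" "r \<le> R" "R < 1"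
  shows "circle_mean F r \<le> circle_mean F R"
proof (cases "R = 0")
  case True
  then show ?thesis using r by simp
next
  case False
  with r have R: "R > 0" by simp
  have cF: "continuous_on (ball 0 1) F" by (rule holomorphic_on_imp_continuous_on[OF F])
  have cF': "continuous_on (ball 0 1) (deriv F)"
    by (intro holomorphic_on_imp_continuous_on holomorphic_deriv F) auto
  let ?e = "\<lambda>t. cis (2 * pi * t)"
  have cont: "continuous_on UNIV (\<lambda>t. F (w * ?e t))" if "cmod w < 1" for w
    using circle_mean_arc(2)[OF cF that] .
  show ?thesis
  proof (rule field_le_epsilon)
    fix e :: real assume e: "e > 0"
    \<comment> \<open>The \<open>e\<close> in the denominator keeps the conjugate phase of
      \<open>F\<close> continuous at zeros of \<open>F\<close>. It costs at most \<open>e\<close>,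
      because \<open>x\<^sup>2 / (x + e)\<close> is at least \<open>x - e\<close>.\<close>
    define \<kappa> where "\<kappa> t = cnj (F (of_real r * ?e t)) / of_real (cmod (F (of_real r * ?e t)) + e)" for t
    have pos: "cmod (F w) + e > 0" for w using e by (simp add: add_nonneg_pos)
    have c\<kappa>: "continuous_on UNIV \<kappa>"
    proof -
      have "complex_of_real (cmod (F (of_real r * ?e t)) + e) \<noteq> 0" for t
        using pos[of "of_real r * ?e t"] by (metis less_irrefl of_real_eq_0_iff)
      then show ?thesis
        unfolding \<kappa>_def using cont[of "of_real r"] r by (intro continuous_intros) auto
    qed
    have n\<kappa>: "cmod (\<kappa> t) \<le> 1" for t
      using pos[of "of_real r * ?e t"] e by (simp add: \<kappa>_def norm_divide del: of_real_add)
    define \<Phi> where "\<Phi> w = integral (cbox 0 1) (\<lambda>t. \<kappa> t * F (w * ?e t))" for w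
    have int: "(\<lambda>t. \<kappa> t * F (w * ?e t)) integrable_on cbox 0 1" if "cmod w < 1" for w
      by (intro integrable_continuous continuous_intros continuous_on_subset[OF cont[OF that]]
          continuous_on_subset[OF c\<kappa>]) auto
    have hol: "\<Phi> holomorphic_on ball 0 1"
      unfolding \<Phi>_def
    proof (rule leibniz_rule_holomorphic[where fx = "\<lambda>w t. \<kappa> t * (deriv F (w * ?e t) * ?e t)"])
      fix w :: complex and t :: real assume w: "w \<in> ball 0 1"
      then have "w * ?e t \<in> ball 0 1" by (simp add: norm_mult)
      then have "(F has_field_derivative deriv F (w * ?e t)) (at (w * ?e t))"
        using F by (intro holomorphic_derivI[where S="ball 0 1"]) auto
      then show "((\<lambda>w. \<kappa> t * F (w * ?e t)) has_field_derivative \<kappa> t * (deriv F (w * ?e t) * ?e t)) (at w within ball 0 1)"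
        by (auto intro!: derivative_eq_intros DERIV_chain2[of F])
    next
      show "(\<lambda>t. \<kappa> t * F (w * ?e t)) integrable_on cbox 0 1" if "w \<in> ball 0 1" for w
        using int that by simp
      show "continuous_on (ball 0 1 \<times> cbox 0 1) (\<lambda>(w, t). \<kappa> t * (deriv F (w * ?e t) * ?e t))"
        unfolding case_prod_unfold
        by (intro continuous_intros continuous_on_compose2[OF c\<kappa>] continuous_on_compose2[OF cF'])
           (auto simp: norm_mult)
    qed auto
    have "circle_mean F r - e \<le> Re (\<Phi> (of_real r))"
    proof -
      have hr: "cmod (of_real r) < 1" using r by simp
      have h1: "((\<lambda>t. Re (\<kappa> t * F (of_real r * ?e t))) has_integral Re (\<Phi> (of_real r))) {0..1}"
        using has_integral_linear[OF integrable_integral[OF int[OF hr]] bounded_linear_Re]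
        by (simp add: \<Phi>_def o_def)
      have h2: "((\<lambda>t. cmod (F (of_real r * ?e t))) has_integral circle_mean F r) {0..1}"
        unfolding circle_mean_def 
        by (intro integrable_integral integrable_continuous_real continuous_on_norm continuous_on_subset[OF cont[OF hr]]) auto
      have h3: "((\<lambda>t. cmod (F (of_real r * ?e t)) - e) has_integral (circle_mean F r - e)) {0..1}"
        using has_integral_diff[OF h2 has_integral_const_real[of e 0 1]] by simp
      show ?thesis
      proof (rule has_integral_le[OF h3 h1])
        fix t :: real
        define x where "x = cmod (F (of_real r * ?e t))"
        have "\<kappa> t * F (of_real r * ?e t) = of_real (x\<^sup>2 / (x + e))"
          using complex_norm_square[of "F (of_real r * ?e t)"]
          unfolding \<kappa>_def x_def by (simp add: mult.commute)
        moreover have "x - e \<le> x\<^sup>2 / (x + e)"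
        proof -
          have "x + e > 0" using pos[of "of_real r * ?e t"] by (simp add: x_def)
          moreover have "(x - e) * (x + e) \<le> x\<^sup>2"
            by (simp add: algebra_simps power2_eq_square)
          ultimately show ?thesis by (simp add: pos_le_divide_eq)
        qed
        ultimately show "cmod (F (of_real r * ?e t)) - e \<le> Re (\<kappa> t * F (of_real r * ?e t))"
          by (simp add: x_def[symmetric])
      qed
    qed
    also have "\<dots> \<le> cmod (\<Phi> (of_real r))" by (rule complex_Re_le_cmod)
    also have "\<dots> \<le> circle_mean F R"
    proof (rule maximum_modulus_frontier[of \<Phi> "cball 0 R"])
      show "\<Phi> holomorphic_on interior (cball 0 R)" 
        using hol r by (auto intro: holomorphic_on_subset)
      show "continuous_on (closure (cball 0 R)) \<Phi>"
        using hol r by (auto intro!: holomorphic_on_imp_continuous_on intro: holomorphic_on_subset)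
      fix w :: complex assume "w \<in> frontier (cball 0 R)"
      then have w: "cmod w = R" using R by simp
      then have w1: "cmod w < 1" using r by simp
      have "cmod (\<Phi> w) \<le> integral (cbox 0 1) (\<lambda>t. cmod (F (w * ?e t)))"
        unfolding \<Phi>_def
      proof (rule integral_norm_bound_integral[OF int[OF w1]])
        show "(\<lambda>t. cmod (F (w * ?e t))) integrable_on cbox 0 1"
          by (intro integrable_continuous continuous_on_norm continuous_on_subset[OF cont[OF w1]]) auto
        show "cmod (\<kappa> t * F (w * ?e t)) \<le> cmod (F (w * ?e t))" for t
          using mult_right_mono[OF n\<kappa>[of t] norm_ge_zero] by (simp add: norm_mult)
      qed
      also have "\<dots> = circle_mean F R"
        using circle_mean_arc(1)[OF cF w1, of 0] w by simp
      finally show "cmod (\<Phi> w) \<le> circle_mean F R" .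
    qed (use r in auto)
    finally show "circle_mean F r \<le> circle_mean F R + e" by simp
  qed
qed

text \<open>Cauchy's formula on the circle of radius \<open>R\<close>, where the kernel is at most
  \<open>1 / (R - cmod z)\<close> and the arc length contributes \<open>R\<close>. This is the
  passage from integral bounds to pointwise ones.\<close>

lemma cmod_le_circle_mean:
  assumes F: "F holomorphic_on ball 0 1" and z: "cmod z < R" and R: "R < 1"
  shows "cmod (F z) \<le> circle_mean F R * (R / (R - cmod z))"
proof -
  have R0: "R > 0" using z norm_ge_zero[of z] by linarith
  have cF: "continuous_on (ball 0 1) F" by (rule holomorphic_on_imp_continuous_on[OF F])
  let ?e = "\<lambda>t. cis (2 * pi * t)"
  have cont: "continuous_on UNIV (\<lambda>t. F (of_real R * ?e t))"
    using circle_mean_arc(2)[OF cF, of "of_real R"] R R0 by simp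
  have "((\<lambda>u. F u / (u - z)) has_contour_integral (2 * of_real pi * \<i> * F z)) (circlepath 0 R)"
    using F z R by (intro Cauchy_integral_circlepath_simple) (auto intro: holomorphic_on_subset)
  then have "((\<lambda>t. F (circlepath 0 R t) / (circlepath 0 R t - z) * vector_derivative (circlepath 0 R) (at t within {0..1}))
       has_integral (2 * of_real pi * \<i> * F z)) {0..1}"
    by (simp add: has_contour_integral_def)
  then have "((\<lambda>t. F (of_real R * ?e t) / (of_real R * ?e t - z) * (2 * of_real pi * \<i> * of_real R * ?e t))
       has_integral (2 * of_real pi * \<i> * F z)) {0..1}"
  proof (rule has_integral_eq[rotated])
    fix t :: real assume "t \<in> {0..1}"
    then have "vector_derivative (circlepath 0 R) (at t within {0..1}) = 2 * of_real pi * \<i> * of_real R * ?e t"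
      by (simp add: vector_derivative_circlepath01 cis_conv_exp mult_ac)
    moreover have "circlepath 0 R t = of_real R * ?e t"
      by (simp add: circlepath cis_conv_exp mult_ac)
    ultimately show "F (circlepath 0 R t) / (circlepath 0 R t - z) * vector_derivative (circlepath 0 R) (at t within {0..1})
      = F (of_real R * ?e t) / (of_real R * ?e t - z) * (2 * of_real pi * \<i> * of_real R * ?e t)" by simp
  qed
  then have "((\<lambda>t. (F (of_real R * ?e t) / (of_real R * ?e t - z) * (2 * of_real pi * \<i> * of_real R * ?e t)) * (1 / (2 * of_real pi * \<i>)))
       has_integral (2 * of_real pi * \<i> * F z) * (1 / (2 * of_real pi * \<i>))) {0..1}"
    by (rule has_integral_mult_left)
  then have h: "((\<lambda>t. F (of_real R * ?e t) / (of_real R * ?e t - z) * (of_real R * ?e t)) has_integral F z) {0..1}"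
    by simp
  have "cmod (F z) = cmod (integral {0..1} (\<lambda>t. F (of_real R * ?e t) / (of_real R * ?e t - z) * (of_real R * ?e t)))"
    using h by (simp add: integral_unique)
  also have "\<dots> \<le> integral {0..1} (\<lambda>t. cmod (F (of_real R * ?e t)) * (R / (R - cmod z)))"
  proof (rule integral_norm_bound_integral)
    show "(\<lambda>t. cmod (F (of_real R * ?e t)) * (R / (R - cmod z))) integrable_on {0..1}"
      by (intro integrable_continuous_real continuous_intros continuous_on_subset[OF cont]) auto
    fix t :: real
    have "R - cmod z \<le> cmod (of_real R * ?e t - z)"
      using norm_triangle_ineq2[of "of_real R * ?e t" z] R0 by (simp add: norm_mult)
    then have "cmod (F (of_real R * ?e t)) * R / cmod (of_real R * ?e t - z) \<le> cmod (F (of_real R * ?e t)) * R / (R - cmod z)"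
      using z R0 by (intro divide_left_mono mult_pos_pos mult_nonneg_nonneg) auto
    then show "cmod (F (of_real R * ?e t) / (of_real R * ?e t - z) * (of_real R * ?e t)) \<le> cmod (F (of_real R * ?e t)) * (R / (R - cmod z))"
      using R0 by (simp add: norm_mult norm_divide)
  qed (use h in \<open>auto simp: integrable_on_def\<close>)
  also have "\<dots> = circle_mean F R * (R / (R - cmod z))"
    unfolding circle_mean_def by simp
  finally show ?thesis .
qed

lemma circle_mean_le_bound:
  assumes F: "continuous_on (ball 0 1) F" and r: "0 \<le> r" "r < 1" and B: "\<And>z. cmod z = r \<Longrightarrow> cmod (F z) \<le> B"
  shows "circle_mean F r \<le> B"
proof -
  have "(\<lambda>t. cmod (F (of_real r * cis (2 * pi * t)))) integrable_on {0..1}"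
    using circle_mean_arc(2)[OF F, of "of_real r"] r
    by (intro integrable_continuous_real continuous_on_norm) (auto intro: continuous_on_subset)
  then have "circle_mean F r \<le> integral {0..1} (\<lambda>t::real. B)"
    unfolding circle_mean_def by (rule integral_le) (use r in \<open>auto intro!: B simp: norm_mult\<close>)
  then show ?thesis by simp
qed

text \<open>Increasing functions are Borel. The indicator restricts to the radii where
  \<open>circle_mean_mono\<close> applies.\<close>

lemma circle_mean_borel_measurable:
  assumes F: "F holomorphic_on ball 0 1" 
  shows "(\<lambda>r. circle_mean F r * indicator {0..<1} r) \<in> borel_measurable borel"
proof -
  have "mono_on {0..<1} (circle_mean F)"
    by (rule mono_onI) (auto intro!: circle_mean_mono[OF F])
  then have "circle_mean F \<in> borel_measurable (restrict_space borel {0..<1})"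
    by (rule borel_measurable_mono_on_fnc)
  then show ?thesis
    by (subst (asm) borel_measurable_restrict_space_iff) (auto simp: mult.commute)
qed

lemma D1_integral_eq_radial:
  assumes \<omega>: "set_integrable lborel {0..<1::real} \<omega>" "\<forall>s\<in>{0..<1}. 0 \<le> \<omega> s" and f: "f holomorphic_on ball 0 1"
  shows "D1_integral \<omega> f = (\<integral>\<^sup>+r. ennreal (2 * r * \<omega> r * circle_mean (deriv f) r) * indicator {0<..<1} r \<partial>lborel)"
proof -
  have f': "deriv f holomorphic_on ball 0 1" by (rule holomorphic_deriv[OF f]) auto
  then have cf': "continuous_on (ball 0 1) (deriv f)" by (rule holomorphic_on_imp_continuous_on)
  \<comment> \<open>The weight and the derivative are controlled only on \<open>{0..<1}\<close> and
    on the disc, so both are extended by zero to Borel functions before polar coordinates are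
    applied to the whole plane.\<close>
  define w where "w r = indicator {0..<1} r * \<omega> r" for r :: real
  have [measurable]: "w \<in> borel_measurable borel"
    using \<omega>(1) by (auto simp: w_def[abs_def] set_integrable_def integrable_iff_bounded)
  define g where "g z = indicator (ball 0 1) z *\<^sub>R deriv f z" for z
  have [measurable]: "g \<in> borel_measurable borel"
    unfolding g_def[abs_def] using cf' by (intro borel_measurable_continuous_on_indicator) auto
  have "D1_integral \<omega> f = (\<integral>\<^sup>+z. ennreal (cmod (g z) * w (cmod z) / pi) \<partial>lborel)"
    unfolding D1_integral_def by (intro nn_integral_cong) (auto simp: indicator_def g_def w_def)
  also have "\<dots> = (\<integral>\<^sup>+r. ennreal (2 * pi * r) *
    (\<integral>\<^sup>+t. ennreal (cmod (g (of_real r * cis (2 * pi * t))) * w (cmod (of_real r * cis (2 * pi * t))) / pi) * indicator {-1/4<..<3/4} t \<partial>lborel) * indicator {0<..} r \<partial>lborel)"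
    by (rule nn_integral_polar) measurable
  also have "\<dots> = (\<integral>\<^sup>+r. ennreal (2 * r * \<omega> r * circle_mean (deriv f) r) * indicator {0<..<1} r \<partial>lborel)"
  proof (rule nn_integral_cong)
    fix r :: real
    show "ennreal (2 * pi * r) *
      (\<integral>\<^sup>+t. ennreal (cmod (g (of_real r * cis (2 * pi * t))) * w (cmod (of_real r * cis (2 * pi * t))) / pi) * indicator {-1/4<..<3/4} t \<partial>lborel) * indicator {0<..} r
      = ennreal (2 * r * \<omega> r * circle_mean (deriv f) r) * indicator {0<..<1} r"
    proof (cases "r \<in> {0<..<1}")
      case True
      then have r: "0 \<le> r" "r < 1" by auto
      have w: "\<omega> r \<ge> 0" using \<omega> r by auto
      have "(\<integral>\<^sup>+t. ennreal (cmod (g (of_real r * cis (2 * pi * t))) * w (cmod (of_real r * cis (2 * pi * t))) / pi) * indicator {-1/4<..<3/4} t \<partial>lborel)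
         = (\<integral>\<^sup>+t. ennreal (\<omega> r / pi) * (ennreal (cmod (deriv f (of_real r * cis (2 * pi * t)))) * indicator {-1/4<..<-1/4+1} t) \<partial>lborel)"
      proof (rule nn_integral_cong)
        fix t :: real
        have "ennreal (cmod (g (of_real r * cis (2 * pi * t))) * w (cmod (of_real r * cis (2 * pi * t))) / pi) 
           = ennreal (\<omega> r / pi * cmod (deriv f (of_real r * cis (2 * pi * t))))"
          using r by (simp add: g_def w_def norm_mult mult.commute)
        also have "\<dots> = ennreal (\<omega> r / pi) * ennreal (cmod (deriv f (of_real r * cis (2 * pi * t))))"
          using w by (intro ennreal_mult) auto
        finally show "ennreal (cmod (g (of_real r * cis (2 * pi * t))) * w (cmod (of_real r * cis (2 * pi * t))) / pi) * indicator {-1/4<..<3/4} t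
          = ennreal (\<omega> r / pi) * (ennreal (cmod (deriv f (of_real r * cis (2 * pi * t)))) * indicator {-1/4<..<-1/4+1} t)"
          by (simp add: mult.assoc)
      qed
      also have "\<dots> = ennreal (\<omega> r / pi) * ennreal (circle_mean (deriv f) r)"
      proof (subst nn_integral_cmult)
        have "continuous_on UNIV (\<lambda>t. deriv f (of_real r * cis (2 * pi * t)))"
          using circle_mean_arc(2)[OF cf', of "of_real r"] r by simp
        then have [measurable]: "(\<lambda>t. deriv f (of_real r * cis (2 * pi * t))) \<in> borel_measurable borel"
          by (rule borel_measurable_continuous_onI)
        show "(\<lambda>t. ennreal (cmod (deriv f (of_real r * cis (2 * pi * t)))) * indicator {-1/4<..<-1/4+1} t) \<in> borel_measurable lborel"
          by measurable
        show "ennreal (\<omega> r / pi) * (\<integral>\<^sup>+t. ennreal (cmod (deriv f (of_real r * cis (2 * pi * t)))) * indicator {-1/4<..<-1/4+1} t \<partial>lborel)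
          = ennreal (\<omega> r / pi) * ennreal (circle_mean (deriv f) r)"
          by (subst circle_mean_eq_nn_integral[OF cf' r]) simp
      qed
      finally have "ennreal (2 * pi * r) *
        (\<integral>\<^sup>+t. ennreal (cmod (g (of_real r * cis (2 * pi * t))) * w (cmod (of_real r * cis (2 * pi * t))) / pi) * indicator {-1/4<..<3/4} t \<partial>lborel)
         = ennreal (2 * pi * r) * (ennreal (\<omega> r / pi) * ennreal (circle_mean (deriv f) r))" by simp
      also have "\<dots> = ennreal (2 * r * \<omega> r * circle_mean (deriv f) r)"
        using w r circle_mean_nonneg[of "deriv f" r]
        by (simp add: ennreal_mult[symmetric] mult_ac)
      finally show ?thesis using True by simp
    next
      case False
      then consider "r \<le> 0" | "r \<ge> 1" by fastforce
      then show ?thesis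
      proof cases
        case 2
        then have "g (of_real r * cis (2 * pi * t)) = 0" for t by (simp add: g_def norm_mult)
        then show ?thesis using False by simp
      qed auto
    qed
  qed
  finally show ?thesis .
qed

subsection \<open>Weighted area integrals as radial integrals\<close>

text \<open>Layer cake: the superlevel sets of an increasing function are end segments.\<close>

lemma nn_integral_mono_on_tail_comparison:
  fixes \<phi> v w :: "real \<Rightarrow> real"
  assumes \<phi>: "mono_on {\<rho>..<1} \<phi>" "\<And>x. x \<in> {\<rho>..<1} \<Longrightarrow> 0 \<le> \<phi> x"
    and [measurable]: "v \<in> borel_measurable borel" "w \<in> borel_measurable borel"
    and tail: "\<And>s. s \<in> {\<rho>..<1} \<Longrightarrow> (\<integral>\<^sup>+x. ennreal (v x) * indicator {s..<1} x \<partial>lborel) \<le> (\<integral>\<^sup>+x. ennreal (w x) * indicator {s..<1} x \<partial>lborel)"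
  shows "(\<integral>\<^sup>+x. ennreal (v x) * ennreal (\<phi> x) * indicator {\<rho>..<1} x \<partial>lborel)
     \<le> (\<integral>\<^sup>+x. ennreal (w x) * ennreal (\<phi> x) * indicator {\<rho>..<1} x \<partial>lborel)"
proof -
  \<comment> \<open>Extension by zero confines the superlevel sets at positive heights to
    \<open>{\<rho>..<1}\<close>; only positive heights enter the layer-cake formula.\<close>
  define \<psi> where "\<psi> x = indicator {\<rho>..<1} x * \<phi> x" for x
  have [measurable]: "\<psi> \<in> borel_measurable borel"
  proof -
    have "\<phi> \<in> borel_measurable (restrict_space borel {\<rho>..<1})"
      using \<phi>(1) by (rule borel_measurable_mono_on_fnc)
    then show ?thesis
      by (subst (asm) borel_measurable_restrict_space_iff) (auto simp: \<psi>_def[abs_def])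
  qed
  have layer: "(\<integral>\<^sup>+x. ennreal (u x) * ennreal (\<phi> x) * indicator {\<rho>..<1} x \<partial>lborel)
      = (\<integral>\<^sup>+t. (\<integral>\<^sup>+x. ennreal (u x) * indicator {x. t < \<psi> x} x \<partial>lborel) * indicator {0<..} t \<partial>lborel)"
    if [measurable]: "u \<in> borel_measurable borel" for u
  proof -
    have "(\<integral>\<^sup>+x. ennreal (u x) * ennreal (\<phi> x) * indicator {\<rho>..<1} x \<partial>lborel)
        = (\<integral>\<^sup>+x. \<integral>\<^sup>+t. ennreal (u x) * indicator {x. t < \<psi> x} x * indicator {0<..} t \<partial>lborel \<partial>lborel)"
    proof (rule nn_integral_cong)
      fix x
      have "(\<integral>\<^sup>+t. ennreal (u x) * indicator {x. t < \<psi> x} x * indicator {0<..} t \<partial>lborel)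
         = (\<integral>\<^sup>+t. ennreal (u x) * indicator {0<..<\<psi> x} t \<partial>lborel)"
        by (intro nn_integral_cong) (auto simp: indicator_def)
      also have "\<dots> = ennreal (u x) * emeasure lborel {0<..<\<psi> x}"
        by (simp add: nn_integral_cmult_indicator)
      also have "emeasure lborel {0<..<\<psi> x} = ennreal (\<psi> x)"
        using \<phi>(2)[of x] by (subst emeasure_lborel_Ioo) (auto simp: \<psi>_def indicator_def)
      also have "ennreal (u x) * ennreal (\<psi> x) = ennreal (u x) * ennreal (\<phi> x) * indicator {\<rho>..<1} x"
        by (auto simp: \<psi>_def indicator_def)
      finally show "ennreal (u x) * ennreal (\<phi> x) * indicator {\<rho>..<1} x = 
         (\<integral>\<^sup>+t. ennreal (u x) * indicator {x. t < \<psi> x} x * indicator {0<..} t \<partial>lborel)" by simp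
    qed
    also have "\<dots> = (\<integral>\<^sup>+t. \<integral>\<^sup>+x. ennreal (u x) * indicator {x. t < \<psi> x} x * indicator {0<..} t \<partial>lborel \<partial>lborel)"
      by (rule lborel_pair.Fubini'[symmetric]) (simp add: indicator_def[of "Collect _"] case_prod_unfold)
    also have "\<dots> = (\<integral>\<^sup>+t. (\<integral>\<^sup>+x. ennreal (u x) * indicator {x. t < \<psi> x} x \<partial>lborel) * indicator {0<..} t \<partial>lborel)"
      by (intro nn_integral_cong nn_integral_multc) measurable
    finally show ?thesis .
  qed
  have "(\<integral>\<^sup>+x. ennreal (v x) * indicator {x. t < \<psi> x} x \<partial>lborel) \<le> (\<integral>\<^sup>+x. ennreal (w x) * indicator {x. t < \<psi> x} x \<partial>lborel)"
    if t: "t > 0" for t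
  proof (cases "{x. t < \<psi> x} = {}")
    case True
    then show ?thesis by simp
  next
    case False
    define S where "S = {x. t < \<psi> x}"
    have S: "S \<subseteq> {\<rho>..<1}" using t by (auto simp: S_def \<psi>_def indicator_def split: if_splits)
    define s where "s = Inf S"
    have bdd: "bdd_below S" using S by (intro bdd_belowI[of _ \<rho>]) auto
    have ne: "S \<noteq> {}" using False by (simp add: S_def)
    have "s \<ge> \<rho>" unfolding s_def using S ne by (intro cInf_greatest) auto
    obtain x0 where "x0 \<in> S" using ne by blast
    then have "s < 1" using S cInf_lower[OF _ bdd, of x0] by (auto simp: s_def)
    have up: "y \<in> S" if "x \<in> S" "x \<le> y" "y < 1" for x y
    proof -
      have x: "x \<in> {\<rho>..<1}" "t < \<phi> x" using that S by (auto simp: S_def \<psi>_def)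
      then have "\<phi> x \<le> \<phi> y" using that by (intro mono_onD[OF \<phi>(1)]) auto
      then show ?thesis using x that by (auto simp: S_def \<psi>_def)
    qed
    have "y \<in> S" if "s < y" "y < 1" for y
      using that up by (metis cInf_lessD less_imp_le ne s_def)
    \<comment> \<open>Whether the infimum \<open>s\<close> itself belongs to \<open>S\<close>
      depends on whether \<phi> jumps there; a single point does not affect the integrals.\<close>
    then have eq: "y \<in> S \<longleftrightarrow> y \<in> {s..<1}" if "y \<noteq> s" for y
      using that S cInf_lower[OF _ bdd, of y] by (fastforce simp: s_def)
    have "(\<integral>\<^sup>+x. ennreal (u x) * indicator S x \<partial>lborel) = (\<integral>\<^sup>+x. ennreal (u x) * indicator {s..<1} x \<partial>lborel)" for u
      by (rule nn_integral_cong_AE, use AE_lborel_singleton[of s] in eventually_elim)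
         (use eq in \<open>auto simp: indicator_def\<close>)
    then show ?thesis using tail[of s] \<open>s \<ge> \<rho>\<close> \<open>s < 1\<close> by (simp add: S_def[symmetric])
  qed
  then show ?thesis
    unfolding layer[OF \<open>v \<in> _\<close>] layer[OF \<open>w \<in> _\<close>]
    by (intro nn_integral_mono) (auto simp: indicator_def)
qed

section \<open>Area integrals against a fixed radial weight\<close>

locale weight =
  fixes \<omega> :: "real \<Rightarrow> real"
  assumes rw: "radial_weight \<omega>"
begin

lemma nonneg: "0 \<le> s \<Longrightarrow> s < 1 \<Longrightarrow> 0 \<le> \<omega> s"
  and int: "set_integrable lborel {0..<1} \<omega>"
  and hat_pos: "0 \<le> s \<Longrightarrow> s < 1 \<Longrightarrow> omega_hat \<omega> s > 0"
  using rw by (auto simp: radial_weight_def)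

lemma int_subset: "A \<in> sets borel \<Longrightarrow> A \<subseteq> {0..<1} \<Longrightarrow> set_integrable lborel A \<omega>"
  using set_integrable_subset[OF int] by auto

lemma int_power: "A \<in> sets borel \<Longrightarrow> A \<subseteq> {0..<1} \<Longrightarrow> set_integrable lborel A (\<lambda>s. s ^ k * \<omega> s)"
proof (rule set_integrable_bound[OF int_subset])
  assume A: "A \<in> sets borel" "A \<subseteq> {0..<1}"
  have [measurable]: "(\<lambda>s. indicator A s * \<omega> s) \<in> borel_measurable borel"
    using int_subset[OF A] by (auto simp: set_integrable_def integrable_iff_bounded)
  have "(\<lambda>s. s ^ k * (indicator A s * \<omega> s)) \<in> borel_measurable lborel"
    by measurable
  then show "set_borel_measurable lborel A (\<lambda>s. s ^ k * \<omega> s)"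
    by (simp add: set_borel_measurable_def mult_ac)
  show "AE x in lborel. x \<in> A \<longrightarrow> norm (x ^ k * \<omega> x) \<le> norm (\<omega> x)"
  proof (intro AE_I2 impI)
    fix x assume "x \<in> A"
    then have "0 \<le> x" "x < 1" using A by auto
    then have "\<bar>x ^ k\<bar> \<le> 1" by (simp add: power_le_one)
    then show "norm (x ^ k * \<omega> x) \<le> norm (\<omega> x)"
      by (simp add: abs_mult mult_left_le_one_le)
  qed
qed auto

lemma nn_integral_hat:
  assumes "0 \<le> s" "s < 1"
  shows "(\<integral>\<^sup>+x. ennreal (indicator {0..<1} x * \<omega> x) * indicator {s..<1} x \<partial>lborel) = ennreal (omega_hat \<omega> s)"
proof -
  have "(\<integral>\<^sup>+x. ennreal (indicator {0..<1} x * \<omega> x) * indicator {s..<1} x \<partial>lborel)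
      = (\<integral>\<^sup>+x. ennreal (indicator {s..<1} x *\<^sub>R \<omega> x) \<partial>lborel)"
    using assms by (intro nn_integral_cong) (auto simp: indicator_def)
  also have "\<dots> = ennreal (omega_hat \<omega> s)"
    unfolding omega_hat_def set_lebesgue_integral_def
    using int_subset[of "{s..<1}"] assms
    by (intro nn_integral_eq_integral) (auto simp: set_integrable_def indicator_def intro!: AE_I2 nonneg)
  finally show ?thesis .
qed

lemma weight_measurable: "(\<lambda>x. indicator {0..<1} x * \<omega> x) \<in> borel_measurable borel"
  using int by (auto simp: set_integrable_def integrable_iff_bounded)

lemma nn_integral_moment:
  "(\<integral>\<^sup>+x. ennreal (x ^ k * \<omega> x) * indicator {0..<1} x \<partial>lborel) = ennreal (moment \<omega> k)"
proof -
  have "(\<integral>\<^sup>+x. ennreal (x ^ k * \<omega> x) * indicator {0..<1} x \<partial>lborel)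
      = (\<integral>\<^sup>+x. ennreal (indicator {0..<1} x *\<^sub>R (x ^ k * \<omega> x)) \<partial>lborel)"
    by (intro nn_integral_cong) (auto simp: indicator_def)
  also have "\<dots> = ennreal (moment \<omega> k)"
    unfolding moment_def set_lebesgue_integral_def
    using int_power[of "{0..<1}" k]
    by (intro nn_integral_eq_integral) (auto simp: set_integrable_def indicator_def intro!: AE_I2 nonneg mult_nonneg_nonneg)
  finally show ?thesis .
qed

lemma D1_integral_radial:
  assumes "f holomorphic_on ball 0 1"
  shows "D1_integral \<omega> f = (\<integral>\<^sup>+r. ennreal (2 * r * \<omega> r * circle_mean (deriv f) r) * indicator {0<..<1} r \<partial>lborel)"
  by (rule D1_integral_eq_radial) (use int nonneg assms in auto)

text \<open>On \<open>{R..<1}\<close> the product of the radius and the mean is at least its value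
  at \<open>R\<close>, so the integral over this annulus alone suffices. A bound on the weighted
  integral thus becomes a bound on every circle.\<close>

lemma circle_mean_le_D1_integral:
  assumes f: "f holomorphic_on ball 0 1" and R: "0 < R" "R < 1"
  shows "ennreal (2 * R * omega_hat \<omega> R * circle_mean (deriv f) R) \<le> D1_integral \<omega> f"
proof -
  have f': "deriv f holomorphic_on ball 0 1" by (rule holomorphic_deriv[OF f]) auto
  note [measurable] = weight_measurable
  have "ennreal (2 * R * omega_hat \<omega> R * circle_mean (deriv f) R)
      = ennreal (2 * R * circle_mean (deriv f) R) * ennreal (omega_hat \<omega> R)"
    using R hat_pos[of R] circle_mean_nonneg[of "deriv f" R] by (subst ennreal_mult[symmetric]) (auto simp: mult_ac)
  also have "\<dots> = (\<integral>\<^sup>+x. ennreal (2 * R * circle_mean (deriv f) R) * (ennreal (indicator {0..<1} x * \<omega> x) * indicator {R..<1} x) \<partial>lborel)"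
    using R by (subst nn_integral_cmult) (auto simp: nn_integral_hat)
  also have "\<dots> \<le> D1_integral \<omega> f"
    unfolding D1_integral_radial[OF f]
  proof (rule nn_integral_mono)
    fix x
    show "ennreal (2 * R * circle_mean (deriv f) R) * (ennreal (indicator {0..<1} x * \<omega> x) * indicator {R..<1} x)
       \<le> ennreal (2 * x * \<omega> x * circle_mean (deriv f) x) * indicator {0<..<1} x"
    proof (cases "x \<in> {R..<1}")
      case True
      then have x: "R \<le> x" "0 \<le> x" "x < 1" using R by auto
      have "R * circle_mean (deriv f) R \<le> x * circle_mean (deriv f) x"
        using R x circle_mean_nonneg[of "deriv f" R] by (intro mult_mono circle_mean_mono[OF f']) auto
      then have "2 * R * circle_mean (deriv f) R * \<omega> x \<le> 2 * x * \<omega> x * circle_mean (deriv f) x"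
        using nonneg[of x] x mult_right_mono[of _ _ "\<omega> x"] by (simp add: mult_ac) (metis mult.commute mult.left_commute)
      then show ?thesis using True R x nonneg[of x] circle_mean_nonneg[of "deriv f" R]
        by (simp add: ennreal_mult[symmetric] ennreal_leI)
    qed auto
  qed
  finally show ?thesis .
qed

text \<open>The integral is cut at \<rho>. Below it, \<open>2 * r * M r\<close> is at most
  \<open>2 * M \<rho>\<close> on an interval of length at most one. Above it, \<open>tail\<close> is
  precisely the hypothesis of the tail comparison between the constant \<open>1\<close> and
  \<open>\<epsilon> * \<omega>\<close>. The factor \<open>1 / \<rho>\<close> restores the radius
  that was dropped before comparing: \<open>1 \<le> r / \<rho>\<close>.\<close>

lemma D1_integral_one_le:
  assumes f: "f holomorphic_on ball 0 1" and \<rho>: "0 < \<rho>" "\<rho> < 1" and \<epsilon>: "\<epsilon> > 0"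
    and tail: "\<And>s. \<rho> \<le> s \<Longrightarrow> s < 1 \<Longrightarrow> 1 - s \<le> \<epsilon> * omega_hat \<omega> s"
  shows "D1_integral (\<lambda>_. 1) f \<le> ennreal (2 * circle_mean (deriv f) \<rho>) + ennreal (\<epsilon> / \<rho>) * D1_integral \<omega> f"
proof -
  have f': "deriv f holomorphic_on ball 0 1" by (rule holomorphic_deriv[OF f]) auto
  let ?M = "circle_mean (deriv f)"
  have mono: "mono_on {\<rho>..<1} ?M" using \<rho> by (intro mono_onI circle_mean_mono[OF f']) auto
  note [measurable] = weight_measurable
  have [measurable]: "(\<lambda>r. circle_mean (deriv f) r * indicator {0..<1} r) \<in> borel_measurable borel"
    by (rule circle_mean_borel_measurable[OF f'])
  have "D1_integral (\<lambda>_. 1) f = (\<integral>\<^sup>+r. ennreal (2 * r * 1 * ?M r) * indicator {0<..<1} r \<partial>lborel)"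
    by (rule D1_integral_eq_radial) (auto simp: f set_integrable_def)
  also have "\<dots> \<le> (\<integral>\<^sup>+r. ennreal (2 * ?M \<rho>) * indicator {0..1} r + 2 * (ennreal 1 * ennreal (?M r) * indicator {\<rho>..<1} r) \<partial>lborel)"
  proof (rule nn_integral_mono)
    fix r
    consider "r \<le> 0 \<or> r \<ge> 1" | "0 < r" "r < \<rho>" | "\<rho> \<le> r" "r < 1" by linarith
    then show "ennreal (2 * r * 1 * ?M r) * indicator {0<..<1} r
      \<le> ennreal (2 * ?M \<rho>) * indicator {0..1} r + 2 * (ennreal 1 * ennreal (?M r) * indicator {\<rho>..<1} r)"
    proof cases
      case 2
      have "r * ?M r \<le> 1 * ?M \<rho>"
        using 2 \<rho> circle_mean_nonneg[of "deriv f" r] by (intro mult_mono circle_mean_mono[OF f']) auto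
      then show ?thesis using 2 \<rho> by (auto simp: indicator_def intro!: ennreal_leI)
    next
      case 3
      have "r * ?M r \<le> 1 * ?M r"
        using 3 \<rho> circle_mean_nonneg[of "deriv f" r] by (intro mult_right_mono) auto
      then have "ennreal (2 * r * ?M r) \<le> ennreal (2 * ?M r)" by (intro ennreal_leI) auto
      also have "\<dots> = 2 * ennreal (?M r)"
        using circle_mean_nonneg[of "deriv f" r] by (simp add: ennreal_mult)
      finally have "ennreal (2 * r * ?M r) \<le> 2 * ennreal (?M r)" .
      then have "ennreal (2 * r * ?M r) \<le> ennreal (2 * ?M \<rho>) + 2 * ennreal (?M r)"
        by (rule add_increasing[OF zero_le])
      then show ?thesis using 3 \<rho> by (auto simp: indicator_def)
    qed (auto simp: indicator_def)
  qed
  also have "\<dots> = ennreal (2 * ?M \<rho>) + 2 * (\<integral>\<^sup>+r. ennreal 1 * ennreal (?M r) * indicator {\<rho>..<1} r \<partial>lborel)"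
  proof -
    have "(\<lambda>r. ennreal (?M r * indicator {0..<1} r) * indicator {\<rho>..<1} r) \<in> borel_measurable lborel"
      by measurable
    also have "(\<lambda>r. ennreal (?M r * indicator {0..<1} r) * indicator {\<rho>..<1} r) = (\<lambda>r. ennreal (?M r) * indicator {\<rho>..<1} r)"
      using \<rho> by (auto simp: fun_eq_iff indicator_def)
    finally have [measurable]: "(\<lambda>r. ennreal (?M r) * indicator {\<rho>..<1} r) \<in> borel_measurable borel" by simp
    show ?thesis
      by (subst nn_integral_add) (auto simp: nn_integral_cmult nn_integral_cmult_indicator)
  qed
  also have "\<dots> \<le> ennreal (2 * ?M \<rho>) + 2 * (\<integral>\<^sup>+r. ennreal (\<epsilon> * (indicator {0..<1} r * \<omega> r)) * ennreal (?M r) * indicator {\<rho>..<1} r \<partial>lborel)"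
  proof (intro add_left_mono mult_left_mono nn_integral_mono_on_tail_comparison mono)
    fix s assume s: "s \<in> {\<rho>..<1}"
    have "(\<integral>\<^sup>+x. ennreal 1 * indicator {s..<1} x \<partial>lborel) = ennreal (1 - s)"
      using s by simp
    also have "\<dots> \<le> ennreal (\<epsilon> * omega_hat \<omega> s)"
      using tail[of s] s by (intro ennreal_leI) auto
    also have "\<dots> = ennreal \<epsilon> * (\<integral>\<^sup>+x. ennreal (indicator {0..<1} x * \<omega> x) * indicator {s..<1} x \<partial>lborel)"
      using s \<rho> \<epsilon> hat_pos[of s] by (subst nn_integral_hat) (auto simp: ennreal_mult)
    also have "\<dots> = (\<integral>\<^sup>+x. ennreal \<epsilon> * (ennreal (indicator {0..<1} x * \<omega> x) * indicator {s..<1} x) \<partial>lborel)"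
      by (rule nn_integral_cmult[symmetric]) measurable
    also have "\<dots> = (\<integral>\<^sup>+x. ennreal (\<epsilon> * (indicator {0..<1} x * \<omega> x)) * indicator {s..<1} x \<partial>lborel)"
      using \<epsilon> nonneg by (intro nn_integral_cong) (auto simp: indicator_def ennreal_mult)
    finally show "(\<integral>\<^sup>+x. ennreal 1 * indicator {s..<1} x \<partial>lborel) \<le> \<dots>" .
  qed (auto simp: circle_mean_nonneg)
  also have "2 * (\<integral>\<^sup>+r. ennreal (\<epsilon> * (indicator {0..<1} r * \<omega> r)) * ennreal (?M r) * indicator {\<rho>..<1} r \<partial>lborel) \<le> ennreal (\<epsilon> / \<rho>) * D1_integral \<omega> f"
  proof -
    have m: "(\<lambda>r. ennreal (2 * r * (indicator {0..<1} r * \<omega> r) * (?M r * indicator {0..<1} r)) * indicator {0<..<1} r) \<in> borel_measurable lborel"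
      by measurable
    have e: "(\<lambda>r. ennreal (2 * r * (indicator {0..<1} r * \<omega> r) * (?M r * indicator {0..<1} r)) * indicator {0<..<1} r)
       = (\<lambda>r. ennreal (2 * r * \<omega> r * ?M r) * indicator {0<..<1} r)"
      by (auto simp: fun_eq_iff indicator_def)
    have m': "(\<lambda>r. ennreal (\<epsilon> * (indicator {0..<1} r * \<omega> r)) * ennreal (?M r * indicator {0..<1} r) * indicator {\<rho>..<1} r) \<in> borel_measurable lborel"
      by measurable
    have e': "(\<lambda>r. ennreal (\<epsilon> * (indicator {0..<1} r * \<omega> r)) * ennreal (?M r * indicator {0..<1} r) * indicator {\<rho>..<1} r)
       = (\<lambda>r. ennreal (\<epsilon> * (indicator {0..<1} r * \<omega> r)) * ennreal (?M r) * indicator {\<rho>..<1} r)"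
      using \<rho> by (auto simp: fun_eq_iff indicator_def)
    have "2 * (\<integral>\<^sup>+r. ennreal (\<epsilon> * (indicator {0..<1} r * \<omega> r)) * ennreal (?M r) * indicator {\<rho>..<1} r \<partial>lborel)
       = (\<integral>\<^sup>+r. 2 * (ennreal (\<epsilon> * (indicator {0..<1} r * \<omega> r)) * ennreal (?M r) * indicator {\<rho>..<1} r) \<partial>lborel)"
      using m'[unfolded e'] by (rule nn_integral_cmult[symmetric])
    also have "\<dots> \<le> (\<integral>\<^sup>+r. ennreal (\<epsilon> / \<rho>) * (ennreal (2 * r * \<omega> r * ?M r) * indicator {0<..<1} r) \<partial>lborel)"
    proof (rule nn_integral_mono)
      fix r
      show "2 * (ennreal (\<epsilon> * (indicator {0..<1} r * \<omega> r)) * ennreal (?M r) * indicator {\<rho>..<1} r)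
        \<le> ennreal (\<epsilon> / \<rho>) * (ennreal (2 * r * \<omega> r * ?M r) * indicator {0<..<1} r)"
      proof (cases "r \<in> {\<rho>..<1}")
        case True
        then have r: "0 < r" "r < 1" "\<rho> \<le> r" using \<rho> by auto
        have nn: "0 \<le> \<epsilon> * \<omega> r * ?M r" using nonneg[of r] r \<epsilon> circle_mean_nonneg[of "deriv f" r] by simp
        have "2 * (ennreal (\<epsilon> * \<omega> r) * ennreal (?M r)) = ennreal (2 * (\<epsilon> * \<omega> r * ?M r))"
          using nonneg[of r] r \<epsilon> circle_mean_nonneg[of "deriv f" r] by (simp add: ennreal_mult)
        also have "\<dots> \<le> ennreal (2 * (\<epsilon> * \<omega> r * ?M r) * (r / \<rho>))"
          using mult_left_mono[of 1 "r / \<rho>" "2 * (\<epsilon> * \<omega> r * ?M r)"] r \<rho> nn by (intro ennreal_leI) auto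
        also have "\<dots> = ennreal (\<epsilon> / \<rho> * (2 * r * \<omega> r * ?M r))"
          by (simp add: mult_ac)
        also have "\<dots> = ennreal (\<epsilon> / \<rho>) * ennreal (2 * r * \<omega> r * ?M r)"
          using nonneg[of r] r \<epsilon> \<rho> circle_mean_nonneg[of "deriv f" r] by (intro ennreal_mult) auto
        finally show ?thesis using True r by (simp add: mult.assoc)
      qed auto
    qed
    also have "\<dots> = ennreal (\<epsilon> / \<rho>) * D1_integral \<omega> f"
      unfolding D1_integral_radial[OF f] using m[unfolded e] by (rule nn_integral_cmult)
    finally show ?thesis .
  qed
  finally show ?thesis by (simp add: add_left_mono)
qed

end

subsection \<open>Moments of a weight\<close>

context weight
begin

lemma integral_split_at:
  assumes "0 \<le> r" "r \<le> s" "s \<le> 1"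
  shows "(LBINT x:{r..<1}. x ^ k * \<omega> x) = (LBINT x:{r..<s}. x ^ k * \<omega> x) + (LBINT x:{s..<1}. x ^ k * \<omega> x)"
proof -
  have "{r..<1} = {r..<s} \<union> {s..<1}" using assms by auto
  moreover have "(LBINT x:{r..<s} \<union> {s..<1}. x ^ k * \<omega> x) = (LBINT x:{r..<s}. x ^ k * \<omega> x) + (LBINT x:{s..<1}. x ^ k * \<omega> x)"
    using assms by (intro set_integral_Un int_power) auto
  ultimately show ?thesis by simp
qed

lemma integral_power_nonneg: "0 \<le> r \<Longrightarrow> s \<le> 1 \<Longrightarrow> 0 \<le> (LBINT x:{r..<s}. x ^ k * \<omega> x)"
  unfolding set_lebesgue_integral_def using nonneg
  by (intro Bochner_Integration.integral_nonneg) (auto simp: indicator_def)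

lemma hat_split: "0 \<le> r \<Longrightarrow> r \<le> s \<Longrightarrow> s \<le> 1 \<Longrightarrow> omega_hat \<omega> r = (LBINT x:{r..<s}. \<omega> x) + omega_hat \<omega> s"
  using integral_split_at[of r s 0] by (simp add: omega_hat_def)

lemma hat_antimono: "0 \<le> r \<Longrightarrow> r \<le> s \<Longrightarrow> s \<le> 1 \<Longrightarrow> omega_hat \<omega> s \<le> omega_hat \<omega> r"
  using hat_split[of r s] integral_power_nonneg[of r s 0] by simp

text \<open>On \<open>{s..<1}\<close> the power is at least \<open>s ^ k\<close>. The free choice of
  \<open>s\<close> matters: \<open>s\<close> near \<open>1 - 1/k\<close> gives comparability with
  the tail, a fixed \<open>s\<close> shows that moments decay no faster than
  \<open>s ^ k\<close>.\<close>

lemma power_mult_hat_le_moment: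
  assumes "0 \<le> s" "s < 1"
  shows "s ^ k * omega_hat \<omega> s \<le> moment \<omega> k"
proof -
  have "s ^ k * omega_hat \<omega> s = (LBINT x:{s..<1}. s ^ k * \<omega> x)"
    by (simp add: omega_hat_def)
  also have "\<dots> \<le> (LBINT x:{s..<1}. x ^ k * \<omega> x)"
    using assms by (intro set_integral_mono set_integrable_mult_right int_power int_subset)
      (auto intro!: mult_right_mono power_mono nonneg)
  also have "\<dots> \<le> moment \<omega> k"
    using integral_split_at[of 0 s k] integral_power_nonneg[of 0 s k] assms by (simp add: moment_def)
  finally show ?thesis .
qed

lemma moment_pos: "moment \<omega> k > 0"
proof -
  have "0 < (1/2) ^ k * omega_hat \<omega> (1/2)" using hat_pos[of "1/2"] by simp
  also have "\<dots> \<le> moment \<omega> k" by (rule power_mult_hat_le_moment) auto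
  finally show ?thesis .
qed

lemma moment_antimono: "k \<le> l \<Longrightarrow> moment \<omega> l \<le> moment \<omega> k"
  unfolding moment_def
  by (intro set_integral_mono int_power) (auto intro!: mult_right_mono power_decreasing nonneg)

text \<open>The interval below \<open>r\<close> is cut at the points
  \<open>1 - 2 ^ n * (1 - r)\<close>. Each step towards the origin costs a factor \<open>C\<close>
  by doubling, while \<open>s ^ k\<close> is at most \<open>exp (- (2 ^ n))\<close> there because
  \<open>k * (1 - r)\<close> is at least one. The double exponential beats the powers of
  \<open>C\<close>.\<close>

lemma moment_le_hat:
  assumes D: "D_hat \<omega>"
  obtains K where "K > 0" "\<And>r k. 0 \<le> r \<Longrightarrow> r < 1 \<Longrightarrow> 1 \<le> real k * (1 - r) \<Longrightarrow> moment \<omega> k \<le> K * omega_hat \<omega> r"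
proof -
  obtain C where C: "C \<ge> 1" "\<And>r. 0 \<le> r \<Longrightarrow> r < 1 \<Longrightarrow> omega_hat \<omega> r \<le> C * omega_hat \<omega> ((1 + r) / 2)"
    using D by (auto simp: D_hat_def)
  \<comment> \<open>Bound for the piece between \<open>T (Suc i)\<close> and \<open>T i\<close>,
    relative to the tail at \<open>r\<close>: the exponential bounds the power, and
    \<open>i + 1\<close> doublings lead from \<open>r\<close> to \<open>T (Suc i)\<close>.\<close>
  define a where "a i = exp (- (2 ^ i)) * C ^ (i + 1)" for i :: nat
  have a0: "a i \<ge> 0" for i using C by (simp add: a_def)
  have "summable a"
  proof -
    obtain N :: nat where N: "2 * C \<le> real N" using real_arch_simple by blast
    show ?thesis
    proof (rule summable_ratio_test[of "1/2" N])
      fix n assume n: "n \<ge> N"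
      have "2 * C \<le> 2 ^ n" using N n of_nat_less_two_power[of n, where 'a=real] by linarith
      also have "(2::real) ^ n \<le> exp (2 ^ n)" using exp_ge_add_one_self[of "2 ^ n"] by linarith
      finally have c: "C * exp (- (2 ^ n)) \<le> 1/2" by (simp add: exp_minus field_simps)
      have "a (Suc n) = (C * exp (- (2 ^ n))) * a n"
        by (simp add: a_def mult_ac flip: exp_add)
      also have "\<dots> \<le> 1/2 * a n" using c a0 by (rule mult_right_mono)
      finally show "norm (a (Suc n)) \<le> 1/2 * norm (a n)" using a0 by simp
    qed simp
  qed
  then have sum_a: "(\<Sum>i<n. a i) \<le> suminf a" for n using a0 by (intro sum_le_suminf) auto
  show ?thesis
  proof
    show "0 < 1 + suminf a" using suminf_nonneg[OF \<open>summable a\<close> a0] by linarith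
    fix r :: real and k :: nat assume r: "0 \<le> r" "r < 1" and k: "1 \<le> real k * (1 - r)"
    define x where "x = 1 - r"
    have x: "0 < x" "x \<le> 1" "1 \<le> real k * x" using r k by (auto simp: x_def)
    \<comment> \<open>Truncation at \<open>0\<close> makes the chain reach the origin after finitely
      many steps. Before truncation, \<open>T n\<close> is exactly the midpoint of
      \<open>T (Suc n)\<close> and \<open>1\<close>, which is the point that the doubling condition
      compares with.\<close>
    define T where "T n = max 0 (1 - 2 ^ n * x)" for n :: nat
    have T: "0 \<le> T n" "T n < 1" "T (Suc n) \<le> T n" "T n \<le> (1 + T (Suc n)) / 2" for n
      using x mult_pos_pos[of "2 ^ n" x] by (auto simp: T_def max_def)
    have T0: "T 0 = r" using r by (simp add: T_def x_def)
    have W: "omega_hat \<omega> (T (Suc n)) \<le> C * omega_hat \<omega> (T n)" for n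
    proof -
      have "omega_hat \<omega> (T (Suc n)) \<le> C * omega_hat \<omega> ((1 + T (Suc n)) / 2)"
        using T[of "Suc n"] by (intro C)
      also have "\<dots> \<le> C * omega_hat \<omega> (T n)"
        using T[of n] T[of "Suc n"] C by (intro mult_left_mono hat_antimono) auto
      finally show ?thesis .
    qed
    have WC: "omega_hat \<omega> (T n) \<le> C ^ n * omega_hat \<omega> r" for n
    proof (induction n)
      case (Suc n)
      have "omega_hat \<omega> (T (Suc n)) \<le> C * omega_hat \<omega> (T n)" by (rule W)
      also have "\<dots> \<le> C * (C ^ n * omega_hat \<omega> r)" using C Suc by (intro mult_left_mono) auto
      finally show ?case by (simp add: mult.assoc)
    qed (simp add: T0)
    \<comment> \<open>The summand \<open>1\<close> accounts for the outermost piece from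
      \<open>r\<close> to \<open>1\<close>, where the power is bounded by one.\<close>
    have J: "(LBINT s:{T n..<1}. s ^ k * \<omega> s) \<le> (1 + (\<Sum>i<n. a i)) * omega_hat \<omega> r" for n
    proof (induction n)
      case 0
      have "(LBINT s:{r..<1}. s ^ k * \<omega> s) \<le> (LBINT s:{r..<1}. \<omega> s)"
        using r by (intro set_integral_mono int_power int_subset)
          (auto intro!: mult_left_le_one_le power_le_one nonneg)
      then show ?case by (simp add: T0 omega_hat_def)
    next
      case (Suc n)
      have "(LBINT s:{T (Suc n)..<T n}. s ^ k * \<omega> s) \<le> a n * omega_hat \<omega> r"
      proof (cases "T n = 0")
        case True
        then have "T (Suc n) = 0" using T(3)[of n] T(1)[of "Suc n"] by simp
        then show ?thesis using True a0[of n] hat_pos[of r] r by (simp add: set_lebesgue_integral_def)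
      next
        case False
        then have Tn: "T n = 1 - 2 ^ n * x" "T n > 0" using T(1)[of n] by (auto simp: T_def max_def split: if_splits)
        have "(LBINT s:{T (Suc n)..<T n}. s ^ k * \<omega> s) \<le> (LBINT s:{T (Suc n)..<T n}. T n ^ k * \<omega> s)"
          using T[of n] T[of "Suc n"]
          by (intro set_integral_mono set_integrable_mult_right int_power int_subset)
            (auto intro!: mult_right_mono power_mono nonneg)
        also have "\<dots> = T n ^ k * (omega_hat \<omega> (T (Suc n)) - omega_hat \<omega> (T n))"
          using hat_split[of "T (Suc n)" "T n"] T[of n] T[of "Suc n"] by simp
        also have "\<dots> \<le> T n ^ k * omega_hat \<omega> (T (Suc n))"
          using hat_pos[of "T n"] T[of n] by (intro mult_left_mono) auto
        also have "\<dots> \<le> exp (- (2 ^ n)) * (C ^ Suc n * omega_hat \<omega> r)"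
        proof (intro mult_mono WC)
          have "T n ^ k \<le> exp (- (2 ^ n * x)) ^ k"
            using Tn exp_ge_add_one_self[of "- (2 ^ n * x)"] by (intro power_mono) auto
          also have "\<dots> = exp (- (2 ^ n * (real k * x)))"
            by (simp add: mult_ac flip: exp_of_nat_mult)
          also have "\<dots> \<le> exp (- (2 ^ n))" using x by simp
          finally show "T n ^ k \<le> exp (- (2 ^ n))" .
        qed (use hat_pos[of "T (Suc n)"] T[of "Suc n"] in auto)
        finally show ?thesis by (simp add: a_def mult_ac)
      qed
      moreover have "(LBINT s:{T (Suc n)..<1}. s ^ k * \<omega> s) = 
         (LBINT s:{T (Suc n)..<T n}. s ^ k * \<omega> s) + (LBINT s:{T n..<1}. s ^ k * \<omega> s)"
        using T[of n] T[of "Suc n"] by (intro integral_split_at) auto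
      ultimately show ?case using Suc by (simp add: algebra_simps)
    qed
    obtain n :: nat where "1 / x \<le> real n" using real_arch_simple by blast
    then have "1 \<le> real n * x" using x by (simp add: field_simps)
    also have "\<dots> \<le> 2 ^ n * x" using x of_nat_less_two_power[of n, where 'a=real] by (intro mult_right_mono) auto
    finally have "T n = 0" by (simp add: T_def)
    then have "moment \<omega> k \<le> (1 + (\<Sum>i<n. a i)) * omega_hat \<omega> r" using J[of n] by (simp add: moment_def)
    also have "\<dots> \<le> (1 + suminf a) * omega_hat \<omega> r"
      using sum_a[of n] hat_pos[of r] r by (intro mult_right_mono) auto
    finally show "moment \<omega> k \<le> (1 + suminf a) * omega_hat \<omega> r" .
  qed
qed

text \<open>With \<open>s\<close> between \<open>r\<close> and \<open>1\<close> the moments dominate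
  \<open>s ^ (k + 1)\<close> up to a constant, and the series is geometric with ratio
  \<open>r / s\<close>. The series over orders from \<open>1\<close> on is indexed from
  \<open>0\<close>, hence order \<open>k + 1\<close> with the factor \<open>k + 2\<close>.\<close>

lemma summable_moment_series:
  assumes r: "0 \<le> r" "r < 1"
  shows "summable (\<lambda>k. r ^ (k + 1) / (real (k + 2) * moment \<omega> (k + 1)))"
proof -
  define s where "s = (1 + r) / 2"
  have s: "0 < s" "r < s" "s < 1" using r by (auto simp: s_def)
  show ?thesis
  proof (rule summable_comparison_test')
    show "summable (\<lambda>k. (r / s) ^ k * (r / s / omega_hat \<omega> s))"
      using r s by (intro summable_mult2 summable_geometric) auto
    fix k :: nat
    have p: "0 < s ^ (k + 1) * omega_hat \<omega> s" using s hat_pos[of s] by simp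
    have "s ^ (k + 1) * omega_hat \<omega> s \<le> 1 * moment \<omega> (k + 1)"
      using power_mult_hat_le_moment[of s "k+1"] s by simp
    also have "\<dots> \<le> real (k + 2) * moment \<omega> (k + 1)"
      using moment_pos[of "k+1"] by (intro mult_right_mono) auto
    finally have "r ^ (k + 1) / (real (k + 2) * moment \<omega> (k + 1)) \<le> r ^ (k + 1) / (s ^ (k + 1) * omega_hat \<omega> s)"
      using r p moment_pos[of "k+1"] by (intro divide_left_mono mult_pos_pos[of _ "s ^ (k + 1) * _"]) auto
    also have "\<dots> = (r / s) ^ k * (r / s / omega_hat \<omega> s)"
      by (simp add: power_divide mult_ac)
    finally show "norm (r ^ (k + 1) / (real (k + 2) * moment \<omega> (k + 1))) \<le> (r / s) ^ k * (r / s / omega_hat \<omega> s)"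
      using r moment_pos[of "k+1"] by simp
  qed
qed

section \<open>Consequences of a positive upper limit for moments and Abel means\<close>

text \<open>Passage from a radius to an integer order: \<open>n\<close> is
  \<open>1 / (1 - r)\<close> rounded up, and rounding adds at most \<open>1 - r \<le> 1/2\<close> to
  \<open>n * (1 - r)\<close>, whence \<open>3/2\<close>. The tail in the moment estimate is replaced
  by \<open>(1 - r) / c\<close>.\<close>

lemma moment_bound_at_index:
  assumes D: "D_hat \<omega>" and c: "c > 0"
  obtains B where "B > 0"
    "\<And>r. 1/2 \<le> r \<Longrightarrow> r < 1 \<Longrightarrow> (1 - r) / omega_hat \<omega> r > c \<Longrightarrow>
       \<exists>n. 1 \<le> real n * (1 - r) \<and> real n * (1 - r) \<le> 3/2 \<and> moment \<omega> n \<le> B * (1 - r)"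
proof -
  obtain K where K: "K > 0" "\<And>r k. 0 \<le> r \<Longrightarrow> r < 1 \<Longrightarrow> 1 \<le> real k * (1 - r) \<Longrightarrow> moment \<omega> k \<le> K * omega_hat \<omega> r"
    using moment_le_hat[OF D] by blast
  show ?thesis
  proof
    show "K / c > 0" using K c by simp
    fix r :: real assume r: "1/2 \<le> r" "r < 1" "(1 - r) / omega_hat \<omega> r > c"
    define n where "n = nat \<lceil>1 / (1 - r)\<rceil>"
    have n: "1 / (1 - r) \<le> real n" "real n < 1 / (1 - r) + 1"
      using r by (auto simp: n_def of_nat_nat ceiling_le_iff intro: less_ceiling_iff) linarith+
    then have n': "1 \<le> real n * (1 - r)" "real n * (1 - r) \<le> 3/2" using r by (auto simp: field_simps)
    have "moment \<omega> n \<le> K * omega_hat \<omega> r" using r n' by (intro K) auto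
    also have "\<dots> \<le> K * ((1 - r) / c)"
      using r c K hat_pos[of r] by (intro mult_left_mono) (auto simp: field_simps)
    finally have "moment \<omega> n \<le> K / c * (1 - r)" by simp
    with n' show "\<exists>n. 1 \<le> real n * (1 - r) \<and> real n * (1 - r) \<le> 3/2 \<and> moment \<omega> n \<le> K / c * (1 - r)" by blast
  qed
qed

lemma moments_frequently_small:
  assumes D: "D_hat \<omega>" and c: "c > 0" and fr: "\<exists>\<^sub>F r in at_left 1. (1 - r) / omega_hat \<omega> r > c"
  obtains B where "\<And>N. \<exists>n\<ge>N. real n * moment \<omega> n \<le> B"
proof -
  obtain B where B: "B > 0" "\<And>r. 1/2 \<le> r \<Longrightarrow> r < 1 \<Longrightarrow> (1 - r) / omega_hat \<omega> r > c \<Longrightarrow>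
       \<exists>n. 1 \<le> real n * (1 - r) \<and> real n * (1 - r) \<le> 3/2 \<and> moment \<omega> n \<le> B * (1 - r)"
    using moment_bound_at_index[OF D c] by blast
  show ?thesis
  proof
    fix N :: nat
    \<comment> \<open>The second entry forces
      \<open>(N + 1) * (1 - r) \<le> 1 \<le> n * (1 - r)\<close>, hence \<open>n > N\<close>; the
      first one meets the requirement \<open>1/2 \<le> r\<close> of the index bound.\<close>
    define \<rho> where "\<rho> = max (1/2) (1 - 1 / (real N + 1))"
    have "\<rho> < 1" by (auto simp: \<rho>_def)
    then have "\<forall>\<^sub>F r in at_left 1. \<rho> < r \<and> r < 1"
      by (auto simp: eventually_at_left_field)
    then obtain r where r: "\<rho> < r" "r < 1" "(1 - r) / omega_hat \<omega> r > c"
      using frequently_eventually_frequently[OF fr] by (metis (mono_tags, lifting) frequently_ex)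
    then obtain n where n: "1 \<le> real n * (1 - r)" "real n * (1 - r) \<le> 3/2" "moment \<omega> n \<le> B * (1 - r)"
      using B(2)[of r] by (auto simp: \<rho>_def)
    have "(real N + 1) * (1 - r) \<le> 1" using r by (auto simp: \<rho>_def field_simps)
    then have "(real N + 1) * (1 - r) \<le> real n * (1 - r)" using n by linarith
    then have "real N + 1 \<le> real n" using r by simp
    then have "n \<ge> N" by linarith
    moreover have "real n * moment \<omega> n \<le> 3/2 * B"
    proof -
      have "real n * moment \<omega> n \<le> real n * (B * (1 - r))" using n by (intro mult_left_mono) auto
      also have "\<dots> = (real n * (1 - r)) * B" by simp
      also have "\<dots> \<le> 3/2 * B" using n B by (intro mult_right_mono) auto
      finally show ?thesis .
    qed
    ultimately show "\<exists>n\<ge>N. real n * moment \<omega> n \<le> 3/2 * B" by blast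
  qed
qed

text \<open>The \<open>n\<close> terms with index from \<open>n\<close> to \<open>2 * n - 1\<close>
  suffice. For them \<open>k + 2 \<le> 3 * n\<close>, the moment is at most that of order
  \<open>n\<close>, and the power of \<open>r\<close> is at least \<open>exp (-6)\<close>; together
  they contribute at least a constant times \<open>1 / (1 - r)\<close>.\<close>

lemma Abel_mean_frequently_large:
  assumes D: "D_hat \<omega>" and c: "c > 0" and fr: "\<exists>\<^sub>F r in at_left 1. (1 - r) / omega_hat \<omega> r > c"
  obtains c' where "c' > 0"
    "\<exists>\<^sub>F r in at_left 1. (1 - r) * (\<Sum>k. r ^ (k + 1) / (real (k + 2) * moment \<omega> (k + 1))) > c'"
proof -
  obtain B where B: "B > 0" "\<And>r. 1/2 \<le> r \<Longrightarrow> r < 1 \<Longrightarrow> (1 - r) / omega_hat \<omega> r > c \<Longrightarrow>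
       \<exists>n. 1 \<le> real n * (1 - r) \<and> real n * (1 - r) \<le> 3/2 \<and> moment \<omega> n \<le> B * (1 - r)"
    using moment_bound_at_index[OF D c] by blast
  have main: "(1 - r) * (\<Sum>k. r ^ (k + 1) / (real (k + 2) * moment \<omega> (k + 1))) \<ge> exp (-6) / (3 * B)"
    if r: "1/2 \<le> r" "r < 1" "(1 - r) / omega_hat \<omega> r > c" for r
  proof -
    obtain n where n: "1 \<le> real n * (1 - r)" "real n * (1 - r) \<le> 3/2" "moment \<omega> n \<le> B * (1 - r)"
      using B(2)[OF r] by auto
    then have n1: "n \<ge> 1" by (cases n) auto
    \<comment> \<open>From \<open>ln (1 - x) \<ge> - x - 2 * x\<^sup>2\<close> with
      \<open>x = 1 - r \<le> 1/2\<close>. Raised to the power \<open>2 * n\<close> with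
      \<open>n * (1 - r) \<le> 3/2\<close>, it yields the constant \<open>exp (-6)\<close>.\<close>
    have re: "exp (-2 * (1 - r)) \<le> r"
    proof -
      have "- (1 - r) - 2 * (1 - r)\<^sup>2 \<le> ln (1 - (1 - r))"
        using r by (intro ln_one_minus_pos_lower_bound) auto
      moreover have "(1 - r)\<^sup>2 \<le> (1 - r) * (1/2)" unfolding power2_eq_square using r by (intro mult_left_mono) auto
      ultimately have "-2 * (1 - r) \<le> ln r" by simp
      then have "exp (-2 * (1 - r)) \<le> exp (ln r)" by (simp only: exp_le_cancel_iff)
      then show ?thesis using r by simp
    qed
    have summand: "exp (-6) / (3 * real n * (B * (1 - r))) \<le> r ^ (k + 1) / (real (k + 2) * moment \<omega> (k + 1))"
      if k: "k \<in> {n..<2*n}" for k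
    proof (rule frac_le)
      have "exp (-6) \<le> exp (-4 * (real n * (1 - r)))" using n by simp
      also have "\<dots> = exp (-2 * (1 - r)) ^ (2 * n)" by (simp add: mult_ac flip: exp_of_nat_mult)
      also have "\<dots> \<le> r ^ (2 * n)" using re by (intro power_mono) auto
      also have "\<dots> \<le> r ^ (k + 1)" using k r by (intro power_decreasing) auto
      finally show "exp (-6) \<le> r ^ (k + 1)" .
      have "moment \<omega> (k + 1) \<le> moment \<omega> n" using k by (intro moment_antimono) auto
      then show "real (k + 2) * moment \<omega> (k + 1) \<le> 3 * real n * (B * (1 - r))"
        using n n1 k moment_pos[of "k+1"] by (intro mult_mono) auto
    qed (use moment_pos[of "k+1"] r in auto)
    have "exp (-6) / (3 * B) = (1 - r) * (real n * (exp (-6) / (3 * real n * (B * (1 - r)))))"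
      using r n1 B by (simp add: field_simps)
    also have "real n * (exp (-6) / (3 * real n * (B * (1 - r)))) = (\<Sum>k\<in>{n..<2*n}. exp (-6) / (3 * real n * (B * (1 - r))))"
      by simp
    also have "\<dots> \<le> (\<Sum>k\<in>{n..<2*n}. r ^ (k + 1) / (real (k + 2) * moment \<omega> (k + 1)))"
      by (rule sum_mono) (rule summand)
    also have "\<dots> \<le> (\<Sum>k. r ^ (k + 1) / (real (k + 2) * moment \<omega> (k + 1)))"
      using r moment_pos by (intro sum_le_suminf summable_moment_series) (auto intro!: divide_nonneg_pos)
    finally show ?thesis using r by (simp add: mult_left_mono)
  qed
  show ?thesis
  proof
    \<comment> \<open>Halved because the bound in \<open>main\<close> is not strict.\<close>
    show "exp (-6) / (3 * B) / 2 > 0" using B by simp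
    have "\<forall>\<^sub>F r in at_left (1::real). 1/2 < r \<and> r < 1"
      unfolding eventually_at_left_field by (intro exI[of _ "1/2"]) auto
    from frequently_eventually_frequently[OF fr this]
    show "\<exists>\<^sub>F r in at_left 1. (1 - r) * (\<Sum>k. r ^ (k + 1) / (real (k + 2) * moment \<omega> (k + 1))) > exp (-6) / (3 * B) / 2"
    proof (rule frequently_elim1)
      fix r assume "(1 - r) / omega_hat \<omega> r > c \<and> 1/2 < r \<and> r < 1"
      then have "exp (-6) / (3 * B) \<le> (1 - r) * (\<Sum>k. r ^ (k + 1) / (real (k + 2) * moment \<omega> (k + 1)))"
        by (intro main) auto
      moreover have "x / 2 < x" if "x > 0" for x :: real using that by simp
      from this[of "exp (-6) / (3 * B)"] B have "exp (-6) / (3 * B) / 2 < exp (-6) / (3 * B)" by simp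
      ultimately show "(1 - r) * (\<Sum>k. r ^ (k + 1) / (real (k + 2) * moment \<omega> (k + 1))) > exp (-6) / (3 * B) / 2"
        by (rule less_le_trans[rotated])
    qed
  qed
qed

end

section \<open>Abel means of null sequences, and positivity of an upper limit\<close>

text \<open>The weights \<open>(1 - r) * r ^ (k + 1)\<close> have total mass below one, so terms
  below \<open>y / 2\<close> contribute at most \<open>y / 2\<close>; the finitely many others
  contribute at most \<open>(1 - r) * A\<close>, which vanishes in the limit.\<close>

lemma Abel_mean_tendsto_zero:
  fixes a :: "nat \<Rightarrow> real"
  assumes a: "\<And>k. a k \<ge> 0" "a \<longlonglongrightarrow> 0"
  shows "((\<lambda>r. (1 - r) * (\<Sum>k. r ^ (k + 1) * a k)) \<longlongrightarrow> 0) (at_left 1)"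
proof (rule order_tendstoI)
  obtain M where M: "\<And>k. a k \<le> M" 
    using convergent_imp_Bseq[OF convergentI[OF a(2)]] by (auto simp: Bseq_def) (metis abs_le_D1)
  have sm: "summable (\<lambda>k. r ^ (k + 1) * a k)" if "0 < r" "r < 1" for r
  proof (rule summable_comparison_test')
    show "summable (\<lambda>k. r ^ k * M)" using that by (intro summable_mult2 summable_geometric) auto
    fix k
    have "r ^ (k + 1) * a k \<le> r ^ k * M"
      using that a(1)[of k] M[of k] by (intro mult_mono power_decreasing) auto
    then show "norm (r ^ (k + 1) * a k) \<le> r ^ k * M" using that a(1)[of k] by simp
  qed
  have ev: "\<forall>\<^sub>F r in at_left (1::real). 0 < r \<and> r < 1"
    unfolding eventually_at_left_field by (intro exI[of _ 0]) auto
  {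
    fix y :: real assume "y < 0"
    show "\<forall>\<^sub>F r in at_left 1. y < (1 - r) * (\<Sum>k. r ^ (k + 1) * a k)"
      using ev
    proof eventually_elim
      case (elim r)
      then have "0 \<le> (1 - r) * (\<Sum>k. r ^ (k + 1) * a k)"
        using a sm[of r] by (intro mult_nonneg_nonneg suminf_nonneg) auto
      then show ?case using \<open>y < 0\<close> by linarith
    qed
  }
  fix y :: real assume y: "0 < y"
  obtain N where N: "\<And>k. k \<ge> N \<Longrightarrow> a k < y / 2"
    using order_tendstoD(2)[OF a(2), of "y/2"] y by (auto simp: eventually_sequentially)
  define A where "A = (\<Sum>k<N. a k)"
  have A: "A \<ge> 0" using a by (auto simp: A_def intro: sum_nonneg)
  have "((\<lambda>r::real. (1 - r) * A) \<longlongrightarrow> (1 - 1) * A) (at_left 1)" by (intro tendsto_intros)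
  then have "\<forall>\<^sub>F r in at_left 1. (1 - r) * A < y / 2" using y by (intro order_tendstoD(2)) auto
  then show "\<forall>\<^sub>F r in at_left 1. (1 - r) * (\<Sum>k. r ^ (k + 1) * a k) < y"
    using ev
  proof eventually_elim
    case (elim r)
    then have r: "0 < r" "r < 1" by auto
    have s1: "(\<lambda>k. r ^ k * (y / 2)) sums (1 / (1 - r) * (y / 2))" 
      using r by (intro sums_mult2 geometric_sums) auto
    have s2: "(\<lambda>k. if k < N then a k else 0) sums A"
      using sums_If_finite_set[of "{..<N}" a] by (simp add: A_def)
    have "(\<Sum>k. r ^ (k + 1) * a k) \<le> (\<Sum>k. r ^ k * (y / 2) + (if k < N then a k else 0))"
    proof (intro suminf_le sm r)
      fix k
      show "r ^ (k + 1) * a k \<le> r ^ k * (y / 2) + (if k < N then a k else 0)"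
      proof (cases "k < N")
        case True
        have "r ^ (k + 1) * a k \<le> 1 * a k" using r a by (intro mult_right_mono power_le_one) auto
        moreover have "0 \<le> r ^ k * (y / 2)" using r y by simp
        ultimately show ?thesis using True by simp
      next
        case False
        have "r ^ (k + 1) * a k \<le> r ^ k * (y / 2)"
          using r a(1)[of k] N[of k] False y by (intro mult_mono power_decreasing) auto
        then show ?thesis using False by simp
      qed
    qed (use sums_add[OF s1 s2] in \<open>auto simp: sums_iff\<close>)
    also have "\<dots> = 1 / (1 - r) * (y / 2) + A" using sums_add[OF s1 s2] by (simp add: sums_iff)
    finally have "(1 - r) * (\<Sum>k. r ^ (k + 1) * a k) \<le> (1 - r) * (1 / (1 - r) * (y / 2) + A)"
      using r by (intro mult_left_mono) auto
    also have "\<dots> = y / 2 + (1 - r) * A" using r by (simp add: field_simps)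
    also have "\<dots> < y" using elim by simp
    finally show ?case .
  qed
qed

text \<open>The radius \<open>s k = 1 - 1 / (k + 2)\<close> fits twice: \<open>1 - s k\<close> is
  the factor \<open>1 / (k + 2)\<close> of the coefficient, and \<open>s k ^ (k + 1)\<close> is at
  least \<open>exp (-1)\<close>, so the moment of order \<open>k + 1\<close> is bounded below by a
  constant times the tail at \<open>s k\<close>.\<close>

lemma (in weight) Abel_mean_tendsto_zero_if_hat:
  assumes h: "((\<lambda>r. (1 - r) / omega_hat \<omega> r) \<longlongrightarrow> 0) (at_left 1)"
  shows "((\<lambda>r. (1 - r) * (\<Sum>k. r ^ (k + 1) / (real (k + 2) * moment \<omega> (k + 1)))) \<longlongrightarrow> 0) (at_left 1)"
proof -
  define a where "a k = 1 / (real (k + 2) * moment \<omega> (k + 1))" for k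
  have a0: "a k \<ge> 0" for k using moment_pos[of "k+1"] by (simp add: a_def)
  define s where "s k = 1 - 1 / real (k + 2)" for k
  have "filterlim s (at_left 1) sequentially"
  proof (rule tendsto_imp_filterlim_at_left)
    have "(\<lambda>k. 1 / real (k + 2)) \<longlonglongrightarrow> 0"
      using LIMSEQ_ignore_initial_segment[OF lim_1_over_n, of 2] by simp
    from tendsto_diff[OF tendsto_const[of 1] this] show "s \<longlonglongrightarrow> 1" by (simp add: s_def[abs_def])
  qed (auto simp: s_def)
  from filterlim_compose[OF h this] have lim: "(\<lambda>k. exp 1 * ((1 - s k) / omega_hat \<omega> (s k))) \<longlonglongrightarrow> 0"
    using tendsto_mult_right_zero by blast
  have "a \<longlonglongrightarrow> 0"
  proof (rule tendsto_sandwich[OF _ _ tendsto_const lim])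
    show "\<forall>\<^sub>F k in sequentially. a k \<le> exp 1 * ((1 - s k) / omega_hat \<omega> (s k))"
    proof (rule always_eventually, rule allI)
      fix k :: nat
      have s: "0 < s k" "s k < 1" by (auto simp: s_def field_simps)
      have "1 / s k \<le> exp (1 / real (k + 1))"
        using exp_ge_add_one_self[of "1 / real (k + 1)"] by (auto simp: s_def field_simps)
      then have "(1 / s k) ^ (k + 1) \<le> exp (1 / real (k + 1)) ^ (k + 1)" using s by (intro power_mono) auto
      also have "\<dots> = exp (real (k + 1) * (1 / real (k + 1)))" by (rule exp_of_nat_mult[symmetric])
      also have "\<dots> = exp 1" by simp
      finally have "1 \<le> exp 1 * s k ^ (k + 1)" using s by (simp add: power_divide field_simps)
      then have "omega_hat \<omega> (s k) \<le> (exp 1 * s k ^ (k + 1)) * omega_hat \<omega> (s k)"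
        using hat_pos[of "s k"] s by simp
      also have "\<dots> \<le> exp 1 * moment \<omega> (k + 1)"
        using power_mult_hat_le_moment[of "s k" "k+1"] s by (simp add: mult.assoc)
      finally have *: "omega_hat \<omega> (s k) \<le> exp 1 * moment \<omega> (k + 1)" .
      have "a k = exp 1 * (1 / real (k + 2)) / (exp 1 * moment \<omega> (k + 1))" by (simp add: a_def)
      also have "\<dots> \<le> exp 1 * (1 / real (k + 2)) / omega_hat \<omega> (s k)"
        using * hat_pos[of "s k"] s moment_pos[of "k+1"] by (intro divide_left_mono) auto
      also have "1 / real (k + 2) = 1 - s k" by (simp add: s_def)
      finally show "a k \<le> exp 1 * ((1 - s k) / omega_hat \<omega> (s k))" by simp
    qed
  qed (use a0 in auto)
  from Abel_mean_tendsto_zero[OF a0 this] show ?thesis by (simp add: a_def)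
qed

text \<open>Trades the extended-real upper limit for a frequently attained real threshold. The
  witness \<open>y\<close> may be infinite, so a real \<open>c\<close> is interposed.\<close>

lemma Limsup_ereal_pos_iff:
  "Limsup F (\<lambda>x. ereal (f x)) > 0 \<longleftrightarrow> (\<exists>c>0. \<exists>\<^sub>F x in F. f x > c)"
proof
  assume "Limsup F (\<lambda>x. ereal (f x)) > 0"
  then obtain y where y: "y > 0" "\<not> (\<forall>\<^sub>F x in F. ereal (f x) < y)"
    using Limsup_le_iff[of F "\<lambda>x. ereal (f x)" 0] by (auto simp: not_le[symmetric])
  then have fr: "\<exists>\<^sub>F x in F. y \<le> ereal (f x)" by (simp add: frequently_def not_le)
  obtain c where c: "0 < ereal c" "ereal c < y" using ereal_dense2[OF y(1)] by blast
  from fr have "\<exists>\<^sub>F x in F. f x > c" by (rule frequently_elim1) (use c in \<open>metis less_le_trans less_ereal.simps(1)\<close>)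
  then show "\<exists>c>0. \<exists>\<^sub>F x in F. f x > c" using c by auto
next
  assume "\<exists>c>0. \<exists>\<^sub>F x in F. f x > c"
  then obtain c where c: "c > 0" "\<exists>\<^sub>F x in F. f x > c" by blast
  show "Limsup F (\<lambda>x. ereal (f x)) > 0"
  proof (rule ccontr)
    assume "\<not> ?thesis"
    then have "\<forall>\<^sub>F x in F. ereal (f x) < ereal c"
      using Limsup_le_iff[of F "\<lambda>x. ereal (f x)" 0] c(1) by (metis ereal_less(2) not_less)
    then have "\<forall>\<^sub>F x in F. \<not> f x > c" by eventually_elim auto
    with c(2) show False by (simp add: frequently_def)
  qed
qed

subsection \<open>Compactness of the identity\<close>

lemma holomorphic_D1_integrand_measurable:
  assumes \<omega>: "set_integrable lborel {0..<1::real} \<omega>" and f: "f holomorphic_on ball 0 1"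
  shows "(\<lambda>z. ennreal (cmod (deriv f z) * \<omega> (cmod z) / pi) * indicator (ball 0 1) z) \<in> borel_measurable lborel"
proof -
  have cf': "continuous_on (ball 0 1) (deriv f)" 
    by (intro holomorphic_on_imp_continuous_on holomorphic_deriv f) auto
  define w where "w r = indicator {0..<1} r * \<omega> r" for r :: real
  have [measurable]: "w \<in> borel_measurable borel"
    using \<omega> by (auto simp: w_def[abs_def] set_integrable_def integrable_iff_bounded)
  define g where "g z = indicator (ball 0 1) z *\<^sub>R deriv f z" for z
  have [measurable]: "g \<in> borel_measurable borel"
    unfolding g_def[abs_def] using cf' by (intro borel_measurable_continuous_on_indicator) auto
  have "(\<lambda>z. ennreal (cmod (g z) * w (cmod z) / pi)) \<in> borel_measurable lborel"
    by measurable
  also have "(\<lambda>z. ennreal (cmod (g z) * w (cmod z) / pi))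
     = (\<lambda>z. ennreal (cmod (deriv f z) * \<omega> (cmod z) / pi) * indicator (ball 0 1) z)"
    by (auto simp: fun_eq_iff g_def w_def indicator_def)
  finally show ?thesis .
qed

lemma deriv_diff_on_ball:
  assumes "f holomorphic_on ball 0 1" "g holomorphic_on ball 0 1" "z \<in> ball 0 1"
  shows "deriv (\<lambda>z. f z - g z) z = deriv f z - deriv g z"
  using assms by (intro deriv_diff) (auto intro: holomorphic_on_imp_differentiable_at)

lemma D1_integral_diff_le:
  assumes \<omega>: "set_integrable lborel {0..<1::real} \<omega>" "\<forall>s\<in>{0..<1}. 0 \<le> \<omega> s"
    and f: "f holomorphic_on ball 0 1" and g: "g holomorphic_on ball 0 1"
  shows "D1_integral \<omega> (\<lambda>z. f z - g z) \<le> D1_integral \<omega> f + D1_integral \<omega> g"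
proof -
  have "D1_integral \<omega> (\<lambda>z. f z - g z) \<le> (\<integral>\<^sup>+z. ennreal (cmod (deriv f z) * \<omega> (cmod z) / pi) * indicator (ball 0 1) z
      + ennreal (cmod (deriv g z) * \<omega> (cmod z) / pi) * indicator (ball 0 1) z \<partial>lborel)"
    unfolding D1_integral_def
  proof (rule nn_integral_mono)
    fix z :: complex
    show "ennreal (cmod (deriv (\<lambda>z. f z - g z) z) * \<omega> (cmod z) / pi) * indicator (ball 0 1) z
      \<le> ennreal (cmod (deriv f z) * \<omega> (cmod z) / pi) * indicator (ball 0 1) z
      + ennreal (cmod (deriv g z) * \<omega> (cmod z) / pi) * indicator (ball 0 1) z"
    proof (cases "z \<in> ball 0 1")
      case True
      then have w: "\<omega> (cmod z) \<ge> 0" using \<omega> by auto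
      have "cmod (deriv (\<lambda>z. f z - g z) z) * \<omega> (cmod z) / pi \<le> (cmod (deriv f z) + cmod (deriv g z)) * \<omega> (cmod z) / pi"
        unfolding deriv_diff_on_ball[OF f g True]
        using w by (intro divide_right_mono mult_right_mono norm_triangle_ineq4) auto
      also have "\<dots> = cmod (deriv f z) * \<omega> (cmod z) / pi + cmod (deriv g z) * \<omega> (cmod z) / pi"
        by (simp add: field_simps)
      finally show ?thesis using True w by (simp flip: ennreal_plus add: ennreal_leI)
    qed auto
  qed
  also have "\<dots> = D1_integral \<omega> f + D1_integral \<omega> g"
    unfolding D1_integral_def by (intro nn_integral_add holomorphic_D1_integrand_measurable \<omega> f g)
  finally show ?thesis .
qed

section \<open>Local bounds in the weighted space and compactness by Montel's theorem\<close>

context weight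
begin

lemma D1_integral_le_bound:
  assumes "f \<in> D1_space \<omega>" "D1_norm \<omega> f \<le> B"
  shows "D1_integral \<omega> f \<le> ennreal B" "cmod (f 0) \<le> B" "0 \<le> B"
proof -
  have fin: "D1_integral \<omega> f < \<infinity>" using assms by (simp add: D1_space_def)
  have "enn2real (D1_integral \<omega> f) \<le> B" using assms norm_ge_zero[of "f 0"] unfolding D1_norm_def by linarith
  then have "ennreal (enn2real (D1_integral \<omega> f)) \<le> ennreal B" by (rule ennreal_leI)
  then show "D1_integral \<omega> f \<le> ennreal B" using fin by simp
  show "cmod (f 0) \<le> B" using assms enn2real_nonneg[of "D1_integral \<omega> f"] unfolding D1_norm_def by linarith
  then show "0 \<le> B" using norm_ge_zero[of "f 0"] by linarith
qed

text \<open>Combines the bound on the circle of radius \<open>R\<close> with Cauchy's formula; the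
  factor \<open>R\<close> cancels. It makes the derivatives of a norm-bounded family locally
  bounded, as Montel's theorem requires.\<close>

lemma cmod_deriv_le:
  assumes f: "f \<in> D1_space \<omega>" "D1_norm \<omega> f \<le> B" and z: "cmod z < R" "R < 1"
  shows "cmod (deriv f z) \<le> B / (2 * omega_hat \<omega> R) / (R - cmod z)"
proof -
  have R: "0 < R" using z norm_ge_zero[of z] by linarith
  have hf: "f holomorphic_on ball 0 1" using f by (simp add: D1_space_def)
  have hf': "deriv f holomorphic_on ball 0 1" by (rule holomorphic_deriv[OF hf]) auto
  have W: "omega_hat \<omega> R > 0" using R z by (intro hat_pos) auto
  have "ennreal (2 * R * omega_hat \<omega> R * circle_mean (deriv f) R) \<le> D1_integral \<omega> f"
    using R z by (intro circle_mean_le_D1_integral hf)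
  also have "\<dots> \<le> ennreal B" by (rule D1_integral_le_bound[OF f])
  finally have "2 * R * omega_hat \<omega> R * circle_mean (deriv f) R \<le> B"
    using D1_integral_le_bound(3)[OF f] by (simp add: ennreal_le_iff)
  then have M: "circle_mean (deriv f) R * R \<le> B / (2 * omega_hat \<omega> R)"
    using W by (simp add: field_simps)
  have "cmod (deriv f z) \<le> circle_mean (deriv f) R * (R / (R - cmod z))"
    by (rule cmod_le_circle_mean[OF hf' z])
  also have "\<dots> = circle_mean (deriv f) R * R / (R - cmod z)" by simp
  also have "\<dots> \<le> B / (2 * omega_hat \<omega> R) / (R - cmod z)"
    using M z by (intro divide_right_mono) auto
  finally show ?thesis .
qed

lemma hat_tail:
  assumes h: "((\<lambda>r. (1 - r) / omega_hat \<omega> r) \<longlongrightarrow> 0) (at_left 1)" and \<epsilon>: "\<epsilon> > 0"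
  obtains \<rho> where "1/2 \<le> \<rho>" "\<rho> < 1" "\<And>s. \<rho> \<le> s \<Longrightarrow> s < 1 \<Longrightarrow> 1 - s \<le> \<epsilon> * omega_hat \<omega> s"
proof -
  have "\<forall>\<^sub>F r in at_left 1. (1 - r) / omega_hat \<omega> r < \<epsilon>" using order_tendstoD(2)[OF h \<epsilon>] .
  then obtain b where b: "b < 1" "\<And>r. b < r \<Longrightarrow> r < 1 \<Longrightarrow> (1 - r) / omega_hat \<omega> r < \<epsilon>"
    unfolding eventually_at_left_field by blast
  show ?thesis
  proof
    \<comment> \<open>The bound \<open>1/2\<close> keeps the later loss \<open>1 / \<rho>\<close> at
      most \<open>2\<close>. The midpoint replaces \<open>b\<close> because the limit controls only
      radii strictly beyond \<open>b\<close>, whereas the estimate must hold at \<rho> too.\<close>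
    show "1/2 \<le> max (1/2) ((b + 1) / 2)" "max (1/2) ((b + 1) / 2) < 1" using b by auto
    fix s assume s: "max (1/2) ((b + 1) / 2) \<le> s" "s < 1"
    then have "b < s" "0 \<le> s" using b by auto
    with b(2)[of s] s hat_pos[of s] show "1 - s \<le> \<epsilon> * omega_hat \<omega> s" by (simp add: field_simps)
  qed
qed

text \<open>The norm sees only the derivative and the value at \<open>0\<close>, so a subsequence is
  extracted for each: by Montel for the derivatives and by compactness of a closed disc for the
  values. Uniform convergence on \<open>cball 0 \<rho>\<close> then controls the mean at \<rho>, and
  the tail estimate controls the rest.\<close>

theorem identity_compact_if_hat:
  assumes h: "((\<lambda>r. (1 - r) / omega_hat \<omega> r) \<longlongrightarrow> 0) (at_left 1)"
  shows "identity_compact_D1 \<omega>"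
  unfolding identity_compact_D1_def
proof (intro conjI allI impI)
  show "D1_space \<omega> \<subseteq> D1_space (\<lambda>_. 1)"
  proof
    fix f assume f: "f \<in> D1_space \<omega>"
    obtain \<rho> where \<rho>: "1/2 \<le> \<rho>" "\<rho> < 1" "\<And>s. \<rho> \<le> s \<Longrightarrow> s < 1 \<Longrightarrow> 1 - s \<le> 1 * omega_hat \<omega> s"
      using hat_tail[OF h zero_less_one] by metis
    have "D1_integral (\<lambda>_. 1) f \<le> ennreal (2 * circle_mean (deriv f) \<rho>) + ennreal (1 / \<rho>) * D1_integral \<omega> f"
      using f \<rho> by (intro D1_integral_one_le) (auto simp: D1_space_def)
    also have "\<dots> < \<infinity>" using f by (auto simp: D1_space_def ennreal_mult_less_top)
    finally show "f \<in> D1_space (\<lambda>_. 1)" using f by (simp add: D1_space_def)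
  qed
next
  fix F :: "nat \<Rightarrow> complex \<Rightarrow> complex" and B :: real
  assume FB: "\<forall>n. F n \<in> D1_space \<omega> \<and> D1_norm \<omega> (F n) \<le> B"
  then have hF: "F n holomorphic_on ball 0 1" for n by (simp add: D1_space_def)
  have B0: "0 \<le> B" using FB D1_integral_le_bound(3) by blast
  have bound: "\<exists>b. \<forall>h\<in>range (\<lambda>n. deriv (F n)). \<forall>z\<in>K. cmod (h z) \<le> b" if K: "compact K" "K \<subseteq> ball 0 1" for K
  proof (cases "K = {}")
    case False
    then obtain x where x: "x \<in> K" "\<And>y. y \<in> K \<Longrightarrow> cmod y \<le> cmod x"
      using continuous_attains_sup[OF K(1) False, of cmod] by (auto intro: continuous_intros)
    have x1: "cmod x < 1" using x K by auto
    define R where "R = (1 + cmod x) / 2"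
    have R: "cmod x < R" "R < 1" using x1 by (auto simp: R_def)
    have W: "omega_hat \<omega> R > 0" using R norm_ge_zero[of x] by (intro hat_pos) linarith+
    have "cmod (deriv (F n) y) \<le> B / (2 * omega_hat \<omega> R) / (R - cmod x)" if "y \<in> K" for n y
    proof -
      have "cmod (deriv (F n) y) \<le> B / (2 * omega_hat \<omega> R) / (R - cmod y)"
        using FB x(2)[OF that] R by (intro cmod_deriv_le) auto
      also have "\<dots> \<le> B / (2 * omega_hat \<omega> R) / (R - cmod x)"
        using x(2)[OF that] R B0 W by (intro divide_left_mono) auto
      finally show ?thesis .
    qed
    then show ?thesis by blast
  qed auto
  obtain G r1 where r1: "strict_mono (r1 :: nat \<Rightarrow> nat)"
    and ul: "\<And>K. compact K \<Longrightarrow> K \<subseteq> ball 0 1 \<Longrightarrow> uniform_limit K ((\<lambda>n. deriv (F n)) \<circ> r1) G sequentially"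
    by (rule Montel[of "ball 0 1" "range (\<lambda>n. deriv (F n))" "\<lambda>n. deriv (F n)"])
       (use bound hF in \<open>auto intro: holomorphic_deriv\<close>)
  have "\<forall>n. F (r1 n) 0 \<in> cball 0 B" using FB D1_integral_le_bound(2) by auto
  then obtain l r2 where r2: "strict_mono (r2 :: nat \<Rightarrow> nat)" "((\<lambda>n. F (r1 n) 0) \<circ> r2) \<longlonglongrightarrow> l"
    using compact_imp_seq_compact[OF compact_cball, of "0::complex" B] unfolding seq_compact_def by metis
  define \<phi> where "\<phi> = r1 \<circ> r2"
  have \<phi>: "strict_mono \<phi>" unfolding \<phi>_def using r1 r2 by (simp add: strict_mono_o)
  show "\<exists>\<phi>::nat\<Rightarrow>nat. strict_mono \<phi> \<and> (\<forall>e>0. \<exists>N. \<forall>m\<ge>N. \<forall>n\<ge>N. D1_norm (\<lambda>_. 1) (\<lambda>z. F (\<phi> m) z - F (\<phi> n) z) < e)"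
  proof (intro exI[of _ \<phi>] conjI \<phi> allI impI)
    fix e :: real assume e: "e > 0"
    \<comment> \<open>With \<open>1 / \<rho> \<le> 2\<close> and weighted integral at most
      \<open>2 * B\<close> for the difference, the outer part is at most \<open>e / 4\<close>. The
      \<open>+ 1\<close> allows for \<open>B = 0\<close>. The inner part adds \<open>e / 8\<close>,
      leaving \<open>e / 2\<close> for the value at \<open>0\<close>.\<close>
    define \<epsilon> where "\<epsilon> = e / (16 * (B + 1))"
    have \<epsilon>: "\<epsilon> > 0" using e B0 by (simp add: \<epsilon>_def)
    obtain \<rho> where \<rho>: "1/2 \<le> \<rho>" "\<rho> < 1" "\<And>s. \<rho> \<le> s \<Longrightarrow> s < 1 \<Longrightarrow> 1 - s \<le> \<epsilon> * omega_hat \<omega> s"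
      using hat_tail[OF h \<epsilon>] by metis
    have "uniform_limit (cball 0 \<rho>) ((\<lambda>n. deriv (F n)) \<circ> r1) G sequentially"
      using \<rho> by (intro ul) auto
    then have "\<forall>\<^sub>F n in sequentially. \<forall>z\<in>cball 0 \<rho>. dist (deriv (F (r1 n)) z) (G z) < e / 32"
      using e unfolding uniform_limit_iff o_def by (meson divide_pos_pos zero_less_numeral)
    then obtain N1 where N1: "\<And>n z. n \<ge> N1 \<Longrightarrow> z \<in> cball 0 \<rho> \<Longrightarrow> dist (deriv (F (r1 n)) z) (G z) < e / 32"
      unfolding eventually_sequentially by blast
    obtain N2 where N2: "\<And>n. n \<ge> N2 \<Longrightarrow> dist (F (\<phi> n) 0) l < e / 8"
      using metric_LIMSEQ_D[OF r2(2), of "e/8"] e by (auto simp: \<phi>_def)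
    show "\<exists>N. \<forall>m\<ge>N. \<forall>n\<ge>N. D1_norm (\<lambda>_. 1) (\<lambda>z. F (\<phi> m) z - F (\<phi> n) z) < e"
    proof (intro exI[of _ "max N1 N2"] allI impI)
      fix m n assume mn: "m \<ge> max N1 N2" "n \<ge> max N1 N2"
      define d where "d z = F (\<phi> m) z - F (\<phi> n) z" for z
      have hd: "d holomorphic_on ball 0 1" unfolding d_def by (intro holomorphic_intros hF)
      have hd': "deriv d holomorphic_on ball 0 1" by (rule holomorphic_deriv[OF hd]) auto
      have M: "circle_mean (deriv d) \<rho> \<le> e / 16"
      proof (rule circle_mean_le_bound)
        fix z assume z: "cmod z = \<rho>"
        have "r2 m \<ge> N1" "r2 n \<ge> N1" using mn seq_suble[OF r2(1)] by (meson max.boundedE order_trans)+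
        then have "dist (deriv (F (\<phi> m)) z) (G z) < e / 32" "dist (deriv (F (\<phi> n)) z) (G z) < e / 32"
          using N1[of _ z] z by (auto simp: \<phi>_def)
        then have "dist (deriv (F (\<phi> m)) z) (deriv (F (\<phi> n)) z) < e / 32 + e / 32"
          by (meson add_strict_mono dist_triangle2 order_le_less_trans)
        moreover have "deriv d z = deriv (F (\<phi> m)) z - deriv (F (\<phi> n)) z"
          unfolding d_def using z \<rho> by (intro deriv_diff_on_ball hF) auto
        ultimately show "cmod (deriv d z) \<le> e / 16" by (simp add: dist_norm)
      qed (use \<rho> hd' in \<open>auto intro: holomorphic_on_imp_continuous_on\<close>)
      have "D1_integral \<omega> d \<le> D1_integral \<omega> (F (\<phi> m)) + D1_integral \<omega> (F (\<phi> n))"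
        unfolding d_def using int nonneg by (intro D1_integral_diff_le hF) auto
      also have "\<dots> \<le> ennreal B + ennreal B"
        using FB by (intro add_mono D1_integral_le_bound(1)) auto
      also have "\<dots> = ennreal (2 * B)" using B0 by (simp flip: ennreal_plus)
      finally have dB: "D1_integral \<omega> d \<le> ennreal (2 * B)" .
      have "D1_integral (\<lambda>_. 1) d \<le> ennreal (2 * circle_mean (deriv d) \<rho>) + ennreal (\<epsilon> / \<rho>) * D1_integral \<omega> d"
        using \<rho> \<epsilon> by (intro D1_integral_one_le hd) auto
      also have "\<dots> \<le> ennreal (e / 8) + ennreal (e / 8 / (B + 1)) * ennreal (2 * B)"
      proof (intro add_mono mult_mono dB ennreal_leI)
        show "\<epsilon> / \<rho> \<le> e / 8 / (B + 1)"
        proof -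
          have "\<epsilon> / \<rho> \<le> \<epsilon> / (1/2)" using \<rho> \<epsilon> by (intro divide_left_mono) auto
          also have "\<dots> = e / 8 / (B + 1)" using B0 by (simp add: \<epsilon>_def field_simps)
          finally show ?thesis .
        qed
      qed (use M in auto)
      also have "\<dots> = ennreal (e / 8 + e / 4 * (B / (B + 1)))"
      proof -
        have "e / 8 / (B + 1) * (2 * B) = e / 4 * (B / (B + 1))"
          using B0 by (simp add: divide_simps)
        then have "ennreal (e / 8 / (B + 1)) * ennreal (2 * B) = ennreal (e / 4 * (B / (B + 1)))"
          using e B0 by (subst ennreal_mult[symmetric]) auto
        then show ?thesis using e B0 by (simp add: ennreal_plus[symmetric] del: ennreal_plus)
      qed
      also have "\<dots> \<le> ennreal (e / 2)"
      proof (rule ennreal_leI)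
        have "e / 4 * (B / (B + 1)) \<le> e / 4 * 1" using e B0 by (intro mult_left_mono) auto
        then show "e / 8 + e / 4 * (B / (B + 1)) \<le> e / 2" using e by linarith
      qed
      finally have 1: "enn2real (D1_integral (\<lambda>_. 1) d) \<le> e / 2" using e by (intro enn2real_leI) auto
      have "dist (F (\<phi> m) 0) (F (\<phi> n) 0) < e / 8 + e / 8"
        using N2[of m] N2[of n] mn by (meson add_strict_mono dist_triangle2 max.boundedE order_le_less_trans)
      then have "cmod (d 0) < e / 2" using e unfolding d_def dist_norm by linarith
      with 1 show "D1_norm (\<lambda>_. 1) (\<lambda>z. F (\<phi> m) z - F (\<phi> n) z) < e"
        by (simp add: D1_norm_def d_def[abs_def])
    qed
  qed
qed

end

subsection \<open>The integration operator\<close>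

lemma has_contour_integral_T_op:
  assumes f: "f holomorphic_on ball 0 1" and g: "g holomorphic_on ball 0 1" and z: "z \<in> ball 0 1"
  shows "((\<lambda>\<zeta>. f \<zeta> * deriv g \<zeta>) has_contour_integral T_op g f z) (linepath 0 z)"
  unfolding T_op_def
proof (rule has_contour_integral_integral, rule contour_integrable_continuous_linepath)
  have "closed_segment 0 z \<subseteq> ball 0 1" using z by (intro closed_segment_subset) auto
  moreover have "(\<lambda>\<zeta>. f \<zeta> * deriv g \<zeta>) holomorphic_on ball 0 1"
    using f g by (intro holomorphic_intros holomorphic_deriv) auto
  ultimately show "continuous_on (closed_segment 0 z) (\<lambda>\<zeta>. f \<zeta> * deriv g \<zeta>)"
    by (meson continuous_on_subset holomorphic_on_imp_continuous_on)
qed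

lemma T_op_diff:
  assumes f1: "f1 holomorphic_on ball 0 1" and f2: "f2 holomorphic_on ball 0 1" and g: "g holomorphic_on ball 0 1"
    and z: "z \<in> ball 0 1"
  shows "T_op g (\<lambda>z. f1 z - f2 z) z = T_op g f1 z - T_op g f2 z"
proof -
  have "((\<lambda>\<zeta>. f1 \<zeta> * deriv g \<zeta> - f2 \<zeta> * deriv g \<zeta>) has_contour_integral (T_op g f1 z - T_op g f2 z)) (linepath 0 z)"
    by (intro has_contour_integral_diff has_contour_integral_T_op assms)
  then have "((\<lambda>\<zeta>. (f1 \<zeta> - f2 \<zeta>) * deriv g \<zeta>) has_contour_integral (T_op g f1 z - T_op g f2 z)) (linepath 0 z)"
    by (simp add: left_diff_distrib)
  then show ?thesis unfolding T_op_def by (rule contour_integral_unique)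
qed

text \<open>On the convex disc \<open>f * g'\<close> has a primitive, and the integral along the
  radius is its increment.\<close>

lemma T_op_has_derivative:
  assumes f: "f holomorphic_on ball 0 1" and g: "g holomorphic_on ball 0 1" and z: "z \<in> ball 0 1"
  shows "(T_op g f has_field_derivative f z * deriv g z) (at z)"
proof -
  have h: "(\<lambda>\<zeta>. f \<zeta> * deriv g \<zeta>) holomorphic_on ball 0 1"
    using f g by (intro holomorphic_intros holomorphic_deriv) auto
  obtain G where G: "\<And>x. x \<in> ball 0 1 \<Longrightarrow> (G has_field_derivative f x * deriv g x) (at x within ball 0 1)"
    using holomorphic_convex_primitive'[OF convex_ball open_ball h] by blast
  have eq: "T_op g f w = G w - G 0" if "w \<in> ball 0 1" for w
  proof -
    have "((\<lambda>\<zeta>. f \<zeta> * deriv g \<zeta>) has_contour_integral (G (pathfinish (linepath 0 w)) - G (pathstart (linepath 0 w)))) (linepath 0 w)"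
    proof (rule contour_integral_primitive[OF G])
      have "closed_segment 0 w \<subseteq> ball 0 1" using that by (intro closed_segment_subset) auto
      then show "path_image (linepath 0 w) \<subseteq> ball 0 1" by simp
    qed auto
    then show ?thesis unfolding T_op_def by (simp add: contour_integral_unique)
  qed
  have "(G has_field_derivative f z * deriv g z) (at z)"
    using G[OF z] at_within_open[OF z open_ball] by simp
  from DERIV_diff[OF this DERIV_const[of "G 0"]]
  have "((\<lambda>w. G w - G 0) has_field_derivative f z * deriv g z) (at z)" by simp
  then show ?thesis
    by (rule has_field_derivative_transform_within_open[where S="ball 0 1"]) (use z eq in auto)
qed

text \<open>Taylor's formula at \<open>0\<close> gives \<open>T f(z) - z f(0) = \<integral>\<^sub>0\<^sup>1 (1 - t) z\<^sup>2 f'(tz) dt\<close>,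
  and Cauchy's formula on the circle of radius \<open>(1 + t)/2\<close> absorbs the factor \<open>1 - t\<close>.\<close>

lemma cmod_T_op_ident_le:
  assumes f: "f \<in> D1_space (\<lambda>_. 1)" and z: "z \<in> ball 0 1"
  shows "cmod (T_op (\<lambda>z. z) f z) \<le> 2 * D1_norm (\<lambda>_. 1) f"
proof -
  have hf: "f holomorphic_on ball 0 1" and fin: "D1_integral (\<lambda>_. 1) f < \<infinity>" using f by (auto simp: D1_space_def)
  have hf': "deriv f holomorphic_on ball 0 1" by (rule holomorphic_deriv[OF hf]) auto
  have cf': "continuous_on (ball 0 1) (deriv f)" by (rule holomorphic_on_imp_continuous_on[OF hf'])
  let ?M = "circle_mean (deriv f)"
  have z1: "cmod z < 1" using z by simp
  have tz: "of_real t * z \<in> ball 0 1" if "t \<in> {0..1}" for t :: real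
    using that z1 mult_left_le_one_le[of "cmod z" t] by (auto simp: norm_mult)
  have "((\<lambda>t. f (linepath 0 z t) * deriv (\<lambda>z. z) (linepath 0 z t) * (z - 0)) has_integral T_op (\<lambda>z. z) f z) {0..1}"
    using has_contour_integral_T_op[OF hf _ z, of "\<lambda>z. z"] by (simp add: has_contour_integral_linepath holomorphic_on_ident)
  then have i1: "((\<lambda>t. f (of_real t * z) * z) has_integral T_op (\<lambda>z. z) f z) {0..1}"
    by (simp add: linepath_def scaleR_conv_of_real)
  \<comment> \<open>Integration by parts: the derivative of \<open>P\<close> contains
    \<open>- z * f (t * z)\<close>, which cancels the integrand of the operator and leaves the term
    with \<open>1 - t\<close>.\<close>
  define P where "P t = of_real (1 - t) * z * f (of_real t * z)" for t :: real
  have "((\<lambda>t. - z * f (of_real t * z) + of_real (1 - t) * z * (deriv f (of_real t * z) * z)) has_integral (P 1 - P 0)) {0..1}"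
  proof (rule fundamental_theorem_of_calculus)
    fix t :: real assume t: "t \<in> {0..1}"
    have "(f has_field_derivative deriv f (of_real t * z)) (at (of_real t * z))"
      using hf tz[OF t] by (intro holomorphic_derivI[where S="ball 0 1"]) auto
    then have "((\<lambda>w. (1 - w) * z * f (w * z)) has_field_derivative
       (- z * f (of_real t * z) + of_real (1 - t) * z * (deriv f (of_real t * z) * z))) (at (of_real t))"
      by (auto intro!: derivative_eq_intros DERIV_chain2[of f])
    from has_vector_derivative_real_field[OF this]
    show "(P has_vector_derivative - z * f (of_real t * z) + of_real (1 - t) * z * (deriv f (of_real t * z) * z)) (at t within {0..1})"
      unfolding P_def by simp
  qed auto
  from has_integral_add[OF this i1]
  have i2: "((\<lambda>t. of_real (1 - t) * z * (deriv f (of_real t * z) * z)) has_integral (T_op (\<lambda>z. z) f z - z * f 0)) {0..1}"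
    by (simp add: P_def algebra_simps)
  have ct: "continuous_on {0..1} (\<lambda>t::real. deriv f (of_real t * z))"
    by (intro continuous_on_compose2[OF cf'] continuous_intros) (use tz in auto)
  define \<phi> where "\<phi> t = (1 - t) * cmod (deriv f (of_real t * z))" for t :: real
  have i3: "(\<phi> has_integral integral {0..1} \<phi>) {0..1}"
    unfolding \<phi>_def by (intro integrable_integral integrable_continuous_real continuous_intros ct)
  have \<phi>0: "\<phi> t \<ge> 0" if "t \<in> {0..1}" for t using that by (simp add: \<phi>_def)
  have "cmod (integral {0..1} (\<lambda>t. of_real (1 - t) * z * (deriv f (of_real t * z) * z))) \<le> integral {0..1} \<phi>"
  proof (rule integral_norm_bound_integral)
    fix t :: real assume t: "t \<in> {0..1}"
    have "\<phi> t * (cmod z * cmod z) \<le> \<phi> t * 1"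
      using \<phi>0[OF t] z1 mult_mono[of "cmod z" 1 "cmod z" 1] by (intro mult_left_mono) auto
    moreover have "cmod (of_real (1 - t) * z * (deriv f (of_real t * z) * z)) = \<phi> t * (cmod z * cmod z)"
      using t by (simp add: norm_mult \<phi>_def del: of_real_diff)
    ultimately show "cmod (of_real (1 - t) * z * (deriv f (of_real t * z) * z)) \<le> \<phi> t" by simp
  qed (use i2 i3 in \<open>auto simp: integrable_on_def\<close>)
  then have b1: "cmod (T_op (\<lambda>z. z) f z - z * f 0) \<le> integral {0..1} \<phi>"
    using i2 by (simp add: integral_unique)
  \<comment> \<open>With \<open>R\<close> the midpoint of \<open>t\<close> and \<open>1\<close>, the
    quotient \<open>(1 - t) / (R - t)\<close> is \<open>2\<close>. What remains is the radial
    integrand for the weight \<open>1\<close> at \<open>R\<close>, and the substitution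
    \<open>r = 1/2 + t/2\<close> yields the factor \<open>2\<close> of the lemma.\<close>
  have le: "\<phi> t \<le> 2 * (1/2 + 1/2 * t) * 1 * ?M (1/2 + 1/2 * t)" if t: "0 \<le> t" "t < 1" for t
  proof -
    define R where "R = 1/2 + 1/2 * t"
    have ct: "cmod (of_real t * z) \<le> t" using t z1 mult_left_le[of "cmod z" t] by (simp add: norm_mult)
    have R: "cmod (of_real t * z) < R" "R < 1" "R > 0" using ct t by (auto simp: R_def)
    have "cmod (deriv f (of_real t * z)) \<le> ?M R * (R / (R - cmod (of_real t * z)))"
      by (rule cmod_le_circle_mean[OF hf' R(1,2)])
    also have "\<dots> \<le> ?M R * (R / (R - t))"
      using ct R t circle_mean_nonneg[of "deriv f" R]
      by (intro mult_left_mono divide_left_mono) (auto simp: R_def)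
    finally have "\<phi> t \<le> (1 - t) * (?M R * (R / (R - t)))" unfolding \<phi>_def using t by (intro mult_left_mono) auto
    also have "R - t = (1 - t) / 2" by (simp add: R_def field_simps)
    also have "(1 - t) * (?M R * (R / ((1 - t) / 2))) = 2 * R * 1 * ?M R" using t by (simp add: field_simps)
    finally show ?thesis unfolding R_def .
  qed
  define g where "g r = ennreal (2 * r * 1 * ?M r) * indicator {0<..<1} r" for r
  have [measurable]: "g \<in> borel_measurable borel"
  proof -
    have [measurable]: "(\<lambda>r. ?M r * indicator {0..<1} r) \<in> borel_measurable borel"
      by (rule circle_mean_borel_measurable[OF hf'])
    have "(\<lambda>r. ennreal (2 * r * 1 * (?M r * indicator {0..<1} r)) * indicator {0<..<1} r) \<in> borel_measurable borel"
      by measurable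
    also have "(\<lambda>r. ennreal (2 * r * 1 * (?M r * indicator {0..<1} r)) * indicator {0<..<1} r) = g"
      by (auto simp: fun_eq_iff g_def indicator_def)
    finally show ?thesis .
  qed
  have D: "D1_integral (\<lambda>_. 1) f = (\<integral>\<^sup>+r. g r \<partial>lborel)"
    unfolding g_def by (rule D1_integral_eq_radial) (auto simp: hf set_integrable_def)
  have "ennreal (integral {0..1} \<phi>) = (\<integral>\<^sup>+t. ennreal (\<phi> t) * indicator {0..1} t \<partial>lborel)"
    using \<phi>0 i3 by (intro nn_integral_has_integral_lebesgue'[symmetric]) auto
  also have "\<dots> \<le> (\<integral>\<^sup>+t. g (1/2 + 1/2 * t) \<partial>lborel)"
  proof (rule nn_integral_mono)
    fix t :: real
    show "ennreal (\<phi> t) * indicator {0..1} t \<le> g (1/2 + 1/2 * t)"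
    proof (cases "0 \<le> t \<and> t < 1")
      case True
      then show ?thesis using le[of t] by (simp add: g_def ennreal_leI)
    qed (auto simp: indicator_def \<phi>_def)
  qed
  also have "\<dots> = 2 * (ennreal \<bar>1/2\<bar> * (\<integral>\<^sup>+t. g (1/2 + 1/2 * t) \<partial>lborel))"
  proof -
    have "2 * (ennreal \<bar>1/2\<bar> * X) = X" for X
    proof -
      have "2 * (ennreal \<bar>1/2\<bar> * X) = (ennreal 2 * ennreal (1/2)) * X" by (simp add: mult.assoc)
      also have "ennreal 2 * ennreal (1/2) = 1" by (subst ennreal_mult[symmetric]) auto
      finally show ?thesis by simp
    qed
    then show ?thesis by simp
  qed
  also have "ennreal \<bar>1/2\<bar> * (\<integral>\<^sup>+t. g (1/2 + 1/2 * t) \<partial>lborel) = (\<integral>\<^sup>+r. g r \<partial>lborel)"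
    by (rule nn_integral_real_affine[symmetric]) auto
  also have "2 * \<dots> = ennreal (2 * enn2real (D1_integral (\<lambda>_. 1) f))"
    unfolding D[symmetric] using fin by (simp add: ennreal_mult)
  finally have b2: "integral {0..1} \<phi> \<le> 2 * enn2real (D1_integral (\<lambda>_. 1) f)"
    by (simp add: ennreal_le_iff)
  have "cmod (T_op (\<lambda>z. z) f z) \<le> cmod (T_op (\<lambda>z. z) f z - z * f 0) + cmod (z * f 0)"
    using norm_triangle_ineq[of "T_op (\<lambda>z. z) f z - z * f 0" "z * f 0"] by simp
  moreover have "cmod (z * f 0) \<le> 2 * cmod (f 0)"
    using z1 by (simp add: norm_mult mult_right_mono)
  ultimately show ?thesis using b1 b2 unfolding D1_norm_def distrib_left by linarith
qed

theorem T_op_ident_compact: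
  assumes I: "identity_compact_D1 \<omega>"
  shows "(\<lambda>z. z) \<in> Tc_D1_Hinf \<omega>"
proof -
  have sub: "D1_space \<omega> \<subseteq> D1_space (\<lambda>_. 1)" using I by (simp add: identity_compact_D1_def)
  have diff: "(\<lambda>z. f z - g z) \<in> D1_space (\<lambda>_. 1)" if "f \<in> D1_space (\<lambda>_. 1)" "g \<in> D1_space (\<lambda>_. 1)" for f g
  proof -
    have "D1_integral (\<lambda>_. 1) (\<lambda>z. f z - g z) \<le> D1_integral (\<lambda>_. 1) f + D1_integral (\<lambda>_. 1) g"
      using that by (intro D1_integral_diff_le) (auto simp: D1_space_def set_integrable_def)
    also have "\<dots> < \<infinity>" using that by (auto simp: D1_space_def)
    finally show ?thesis using that by (auto simp: D1_space_def intro!: holomorphic_intros)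
  qed
  have "T_compact_D1_Hinf \<omega> (\<lambda>z. z)"
    unfolding T_compact_D1_Hinf_def
  proof (intro conjI ballI allI impI)
    fix f assume "f \<in> D1_space \<omega>"
    then have f: "f \<in> D1_space (\<lambda>_. 1)" using sub by blast
    show "bounded (T_op (\<lambda>z. z) f ` ball 0 1)"
      unfolding bounded_iff using cmod_T_op_ident_le[OF f] by blast
  next
    fix F :: "nat \<Rightarrow> complex \<Rightarrow> complex" and B :: real
    assume F: "\<forall>n. F n \<in> D1_space \<omega> \<and> D1_norm \<omega> (F n) \<le> B"
    then have F1: "F n \<in> D1_space (\<lambda>_. 1)" and hF: "F n holomorphic_on ball 0 1" for n
      using sub by (auto simp: D1_space_def)
    obtain \<phi> :: "nat \<Rightarrow> nat" where \<phi>: "strict_mono \<phi>"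
      "\<And>e. e > 0 \<Longrightarrow> \<exists>N. \<forall>m\<ge>N. \<forall>n\<ge>N. D1_norm (\<lambda>_. 1) (\<lambda>z. F (\<phi> m) z - F (\<phi> n) z) < e"
      using conjunct2[OF I[unfolded identity_compact_D1_def], rule_format, of F B] F by blast
    show "\<exists>\<phi>::nat\<Rightarrow>nat. strict_mono \<phi> \<and> (\<forall>e>0. \<exists>N. \<forall>m\<ge>N. \<forall>n\<ge>N. \<forall>z\<in>ball 0 1.
              cmod (T_op (\<lambda>z. z) (F (\<phi> m)) z - T_op (\<lambda>z. z) (F (\<phi> n)) z) < e)"
    proof (intro exI[of _ \<phi>] conjI \<phi>(1) allI impI)
      fix e :: real assume "e > 0"
      then obtain N where N: "\<And>m n. m \<ge> N \<Longrightarrow> n \<ge> N \<Longrightarrow> D1_norm (\<lambda>_. 1) (\<lambda>z. F (\<phi> m) z - F (\<phi> n) z) < e / 2"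
        using \<phi>(2)[of "e/2"] by (meson half_gt_zero)
      show "\<exists>N. \<forall>m\<ge>N. \<forall>n\<ge>N. \<forall>z\<in>ball 0 1. cmod (T_op (\<lambda>z. z) (F (\<phi> m)) z - T_op (\<lambda>z. z) (F (\<phi> n)) z) < e"
      proof (intro exI[of _ N] allI impI ballI)
        fix m n and z :: complex assume mn: "m \<ge> N" "n \<ge> N" and z: "z \<in> ball 0 1"
        have "T_op (\<lambda>z. z) (F (\<phi> m)) z - T_op (\<lambda>z. z) (F (\<phi> n)) z = T_op (\<lambda>z. z) (\<lambda>z. F (\<phi> m) z - F (\<phi> n) z) z"
          by (intro T_op_diff[symmetric] hF z holomorphic_on_ident)
        moreover have "cmod (T_op (\<lambda>z. z) (\<lambda>z. F (\<phi> m) z - F (\<phi> n) z) z) \<le> 2 * D1_norm (\<lambda>_. 1) (\<lambda>z. F (\<phi> m) z - F (\<phi> n) z)"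
          by (intro cmod_T_op_ident_le diff F1 z)
        ultimately show "cmod (T_op (\<lambda>z. z) (F (\<phi> m)) z - T_op (\<lambda>z. z) (F (\<phi> n)) z) < e"
          using N[OF mn] by simp
      qed
    qed
  qed
  then show ?thesis by (simp add: Tc_D1_Hinf_def holomorphic_on_ident)
qed

subsection \<open>Symbols of compact operators\<close>

lemma has_integral_cis_full_turns:
  fixes k :: int
  shows "((\<lambda>t. cis (2 * pi * (of_int k * t))) has_integral (if k = 0 then 1 else 0)) {0..1}"
proof (cases "k = 0")
  case True
  then show ?thesis using has_integral_const_real[of "1::complex" 0 1] by simp
next
  case False
  define \<alpha> where "\<alpha> = 2 * pi * of_int k"
  have \<alpha>: "\<alpha> \<noteq> 0" using False by (simp add: \<alpha>_def)
  have "((\<lambda>t. cis (\<alpha> * t)) has_integral (exp (\<i> * of_real \<alpha> * of_real 1) / (\<i> * of_real \<alpha>) - exp (\<i> * of_real \<alpha> * of_real 0) / (\<i> * of_real \<alpha>))) {0..1}"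
  proof (rule fundamental_theorem_of_calculus)
    fix t :: real
    have "((\<lambda>w. exp (\<i> * of_real \<alpha> * w) / (\<i> * of_real \<alpha>)) has_field_derivative exp (\<i> * of_real \<alpha> * of_real t)) (at (of_real t))"
      using \<alpha> by (auto intro!: derivative_eq_intros)
    from has_vector_derivative_real_field[OF this]
    show "((\<lambda>t. exp (\<i> * of_real \<alpha> * of_real t) / (\<i> * of_real \<alpha>)) has_vector_derivative cis (\<alpha> * t)) (at t within {0..1})"
      by (simp add: cis_conv_exp mult_ac)
  qed auto
  moreover have "exp (\<i> * of_real \<alpha>) = 1"
    using cis_multiple_2pi[of "of_int k"] by (simp add: \<alpha>_def cis_conv_exp mult_ac)
  ultimately show ?thesis using False by (simp add: \<alpha>_def mult.assoc)
qed

text \<open>Parseval's identity: after expanding the square, only the diagonal terms survive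
  integration over a full turn.\<close>

lemma circle_mean_square_geometric_sum:
  "((\<lambda>t. (cmod (\<Sum>i<n. (q * cis (2 * pi * t)) ^ i))\<^sup>2) has_integral (\<Sum>i<n. cmod q ^ (2 * i))) {0..1}"
proof -
  have "((\<lambda>t. \<Sum>i<n. \<Sum>j<n. q ^ i * cnj q ^ j * cis (2 * pi * (of_int (int i - int j) * t)))
      has_integral (\<Sum>i<n. \<Sum>j<n. q ^ i * cnj q ^ j * (if int i - int j = 0 then 1 else 0))) {0..1}"
    by (intro has_integral_sum has_integral_mult_right has_integral_cis_full_turns) auto
  also have "(\<lambda>t. \<Sum>i<n. \<Sum>j<n. q ^ i * cnj q ^ j * cis (2 * pi * (of_int (int i - int j) * t)))
     = (\<lambda>t. of_real ((cmod (\<Sum>i<n. (q * cis (2 * pi * t)) ^ i))\<^sup>2))"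
  proof
    fix t :: real
    have "of_real ((cmod (\<Sum>i<n. (q * cis (2 * pi * t)) ^ i))\<^sup>2) = (\<Sum>i<n. (q * cis (2 * pi * t)) ^ i) * (\<Sum>j<n. (cnj q * cis (- (2 * pi * t))) ^ j)"
      unfolding complex_norm_square by (simp add: cis_cnj)
    also have "\<dots> = (\<Sum>i<n. \<Sum>j<n. (q * cis (2 * pi * t)) ^ i * (cnj q * cis (- (2 * pi * t))) ^ j)"
      by (simp add: sum_product)
    also have "\<dots> = (\<Sum>i<n. \<Sum>j<n. q ^ i * cnj q ^ j * cis (2 * pi * (of_int (int i - int j) * t)))"
    proof (intro sum.cong refl)
      fix i j
      have "cis (2 * pi * t) ^ i * cis (- (2 * pi * t)) ^ j = cis (2 * pi * (of_int (int i - int j) * t))"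
        unfolding Complex.DeMoivre cis_mult by (simp add: algebra_simps)
      then show "(q * cis (2 * pi * t)) ^ i * (cnj q * cis (- (2 * pi * t))) ^ j = q ^ i * cnj q ^ j * cis (2 * pi * (of_int (int i - int j) * t))"
        by (simp add: power_mult_distrib mult_ac)
    qed
    finally show "(\<Sum>i<n. \<Sum>j<n. q ^ i * cnj q ^ j * cis (2 * pi * (of_int (int i - int j) * t)))
       = of_real ((cmod (\<Sum>i<n. (q * cis (2 * pi * t)) ^ i))\<^sup>2)" by simp
  qed
  also have "(\<Sum>i<n. \<Sum>j<n. q ^ i * cnj q ^ j * (if int i - int j = 0 then 1 else 0)) = of_real (\<Sum>i<n. cmod q ^ (2 * i))"
  proof -
    have "(\<Sum>j<n. q ^ i * cnj q ^ j * (if int i - int j = 0 then 1 else 0)) = of_real (cmod q ^ (2 * i))" if "i < n" for i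
    proof -
      have "(\<Sum>j<n. q ^ i * cnj q ^ j * (if int i - int j = 0 then 1 else 0)) = (\<Sum>j<n. if j = i then q ^ i * cnj q ^ i else 0)"
        by (intro sum.cong) auto
      also have "\<dots> = q ^ i * cnj q ^ i" using that by simp
      also have "\<dots> = (q * cnj q) ^ i" by (simp add: power_mult_distrib)
      also have "\<dots> = of_real (cmod q ^ (2 * i))"
        by (simp add: complex_norm_square[symmetric] power_mult)
      finally show ?thesis .
    qed
    then show ?thesis by simp
  qed
  finally have "((Re \<circ> (\<lambda>t. of_real ((cmod (\<Sum>i<n. (q * cis (2 * pi * t)) ^ i))\<^sup>2))) has_integral Re (of_real (\<Sum>i<n. cmod q ^ (2 * i)))) {0..1}"
    by (rule has_integral_linear[OF _ bounded_linear_Re])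
  then show ?thesis by (simp add: o_def)
qed

text \<open>The derivative is a Fejer kernel of order \<open>n\<close>, rotated so as to peak at \<open>cnj c\<close> and
  shifted to the frequencies from \<open>n\<close> on; the shift makes its area integral comparable to the
  moment of order \<open>n\<close>.\<close>

definition peak :: "nat \<Rightarrow> complex \<Rightarrow> complex \<Rightarrow> complex" where
  "peak n c z = (\<Sum>i<n. \<Sum>j<n. (c * z) ^ (n + i + j + 1) / of_nat (n + i + j + 1))"

lemma peak_has_derivative:
  "(peak n c has_field_derivative c * (c * z) ^ n * (\<Sum>i<n. (c * z) ^ i)\<^sup>2) (at z)"
proof -
  have "(peak n c has_field_derivative (\<Sum>i<n. \<Sum>j<n. c * (c * z) ^ (n + i + j))) (at z)"
    unfolding peak_def
  proof (intro DERIV_sum)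
    fix i j :: nat
    have "((\<lambda>z. (c * z) ^ (Suc (n + i + j)) / of_nat (Suc (n + i + j))) has_field_derivative 
      (of_nat (Suc (n + i + j)) * (c * z) ^ (n + i + j) * c / of_nat (Suc (n + i + j)))) (at z)"
      by (intro DERIV_cdivide) (auto intro!: derivative_eq_intros simp del: power_Suc of_nat_Suc)
    then show "((\<lambda>z. (c * z) ^ (n + i + j + 1) / of_nat (n + i + j + 1)) has_field_derivative c * (c * z) ^ (n + i + j)) (at z)"
      by (simp add: mult_ac del: power_Suc of_nat_Suc)
  qed
  also have "(\<Sum>i<n. \<Sum>j<n. c * (c * z) ^ (n + i + j)) = c * (c * z) ^ n * (\<Sum>i<n. (c * z) ^ i)\<^sup>2"
    unfolding power2_eq_square sum_product
    unfolding sum_distrib_left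
    by (intro sum.cong refl) (simp add: power_add mult_ac)
  finally show ?thesis .
qed

text \<open>The modulus of the derivative is a power times a squared modulus, so its mean is a sum
  that Parseval evaluates exactly, with \<open>n\<close> terms of size at most one. The factor
  \<open>r ^ n\<close> is kept so that integration against the weight produces the moment.\<close>

lemma circle_mean_deriv_peak_le:
  assumes c: "cmod c = 1" and r: "0 \<le> r" "r < 1" and b: "b \<ge> 0"
  shows "circle_mean (deriv (\<lambda>z. of_real b * peak n c z)) r \<le> b * (real n * r ^ n)"
proof -
  let ?q = "c * of_real r"
  have d: "deriv (\<lambda>z. of_real b * peak n c z) z = of_real b * (c * (c * z) ^ n * (\<Sum>i<n. (c * z) ^ i)\<^sup>2)" for z
    by (intro DERIV_imp_deriv DERIV_cmult peak_has_derivative)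
  have "(\<lambda>t. cmod (deriv (\<lambda>z. of_real b * peak n c z) (of_real r * cis (2 * pi * t))))
      = (\<lambda>t. b * r ^ n * (cmod (\<Sum>i<n. (?q * cis (2 * pi * t)) ^ i))\<^sup>2)"
    unfolding d using b c r by (simp add: fun_eq_iff norm_mult norm_power mult.assoc)
  then have "circle_mean (deriv (\<lambda>z. of_real b * peak n c z)) r = integral {0..1} (\<lambda>t. b * r ^ n * (cmod (\<Sum>i<n. (?q * cis (2 * pi * t)) ^ i))\<^sup>2)"
    by (simp add: circle_mean_def)
  also have "\<dots> = b * r ^ n * (\<Sum>i<n. cmod ?q ^ (2 * i))"
    by (intro integral_unique has_integral_mult_right circle_mean_square_geometric_sum)
  also have "\<dots> \<le> b * r ^ n * real n"
  proof (rule mult_left_mono)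
    have "(\<Sum>i<n. cmod ?q ^ (2 * i)) \<le> (\<Sum>i<n. 1)"
      using c r by (intro sum_mono) (auto simp: norm_mult intro: power_le_one)
    then show "(\<Sum>i<n. cmod ?q ^ (2 * i)) \<le> real n" by simp
  qed (use b r in auto)
  finally show ?thesis by (simp add: mult_ac)
qed

text \<open>The double sum has \<open>n * n\<close> terms, each at most
  \<open>cmod z ^ n / n\<close>.\<close>

lemma cmod_peak_le:
  assumes c: "cmod c = 1" and z: "cmod z < 1"
  shows "cmod (peak n c z) \<le> real n * cmod z ^ n"
proof (cases "n = 0")
  case False
  have "cmod (peak n c z) \<le> (\<Sum>i<n. \<Sum>j<n. cmod z ^ n / real n)"
    unfolding peak_def
  proof (rule order_trans[OF norm_sum], rule sum_mono, rule order_trans[OF norm_sum], rule sum_mono)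
    fix i j
    have "cmod z ^ (n + i + j + 1) / real (n + i + j + 1) \<le> cmod z ^ n / real n"
      using z False by (intro frac_le power_decreasing) auto
    then show "cmod ((c * z) ^ (n + i + j + 1) / of_nat (n + i + j + 1)) \<le> cmod z ^ n / real n"
      unfolding norm_divide norm_power norm_mult norm_of_nat c by simp
  qed
  also have "\<dots> = real n * cmod z ^ n" using False by simp
  finally show ?thesis .
qed (simp add: peak_def)

text \<open>In the direction where \<open>c * z\<close> is nonnegative there is no cancellation, and
  all exponents are at most \<open>3 * n - 1\<close>.\<close>

lemma cmod_peak_ge:
  assumes cz: "c * z = of_real \<rho>" and \<rho>: "0 \<le> \<rho>" "\<rho> < 1" 
  shows "real n * \<rho> ^ (3 * n) / 3 \<le> cmod (peak n c z)"
proof (cases "n = 0")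
  case False
  have "peak n c z = of_real (\<Sum>i<n. \<Sum>j<n. \<rho> ^ (n + i + j + 1) / real (n + i + j + 1))"
    unfolding peak_def cz by simp
  moreover have "real n * \<rho> ^ (3 * n) / 3 \<le> (\<Sum>i<n. \<Sum>j<n. \<rho> ^ (n + i + j + 1) / real (n + i + j + 1))"
  proof -
    have "real n * \<rho> ^ (3 * n) / 3 = (\<Sum>i<n. \<Sum>j<n. \<rho> ^ (3 * n) / real (3 * n))"
      using False by simp
    also have "\<dots> \<le> (\<Sum>i<n. \<Sum>j<n. \<rho> ^ (n + i + j + 1) / real (n + i + j + 1))"
      using \<rho> by (intro sum_mono frac_le power_decreasing) auto
    finally show ?thesis .
  qed
  ultimately have "real n * \<rho> ^ (3 * n) / 3 \<le> Re (peak n c z)" by (simp only: Re_complex_of_real)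
  then show ?thesis using complex_Re_le_cmod by (rule order_trans)
qed (simp add: peak_def)

section \<open>Test functions and symbols of compact operators\<close>

context weight
begin

text \<open>After scaling, the mean of the derivative is at most
  \<open>r ^ n / moment \<omega> n\<close>, whose integral against the weight is at most one; the
  \<open>2\<close> comes from the radial form of the area integral.\<close>

lemma scaled_peak_in_D1_space:
  assumes c: "cmod c = 1" and n: "n > 0"
  defines "f \<equiv> (\<lambda>z. of_real (1 / (real n * moment \<omega> n)) * peak n c z)"
  shows "f \<in> D1_space \<omega>" "D1_norm \<omega> f \<le> 2"
proof -
  have m: "moment \<omega> n > 0" by (rule moment_pos)
  have "peak n c field_differentiable at z" for z using peak_has_derivative field_differentiable_def by blast
  then have "peak n c holomorphic_on ball 0 1"
    by (simp add: holomorphic_on_def field_differentiable_at_within)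
  then have hf: "f holomorphic_on ball 0 1" unfolding f_def by (intro holomorphic_intros)
  have "D1_integral \<omega> f \<le> (\<integral>\<^sup>+r. ennreal (2 / moment \<omega> n) * (ennreal (r ^ n * \<omega> r) * indicator {0..<1} r) \<partial>lborel)"
    unfolding D1_integral_radial[OF hf]
  proof (rule nn_integral_mono)
    fix r
    show "ennreal (2 * r * \<omega> r * circle_mean (deriv f) r) * indicator {0<..<1} r
      \<le> ennreal (2 / moment \<omega> n) * (ennreal (r ^ n * \<omega> r) * indicator {0..<1} r)"
    proof (cases "r \<in> {0<..<1}")
      case True
      then have r: "0 \<le> r" "r < 1" by auto
      have "circle_mean (deriv f) r \<le> 1 / (real n * moment \<omega> n) * (real n * r ^ n)"
        unfolding f_def using m r by (intro circle_mean_deriv_peak_le c) auto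
      also have "\<dots> = r ^ n / moment \<omega> n" using n by simp
      finally have M: "circle_mean (deriv f) r \<le> r ^ n / moment \<omega> n" .
      have "2 * r * \<omega> r * circle_mean (deriv f) r \<le> 2 * 1 * \<omega> r * (r ^ n / moment \<omega> n)"
        using r nonneg[of r] M circle_mean_nonneg[of "deriv f" r] m by (intro mult_mono) auto
      also have "\<dots> = 2 / moment \<omega> n * (r ^ n * \<omega> r)" by simp
      finally have "ennreal (2 * r * \<omega> r * circle_mean (deriv f) r) \<le> ennreal (2 / moment \<omega> n * (r ^ n * \<omega> r))"
        by (rule ennreal_leI)
      also have "\<dots> = ennreal (2 / moment \<omega> n) * ennreal (r ^ n * \<omega> r)"
        using r m nonneg[of r] by (intro ennreal_mult) auto
      finally show ?thesis using True by simp
    qed auto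
  qed
  also have "\<dots> = ennreal (2 / moment \<omega> n) * ennreal (moment \<omega> n)"
  proof (subst nn_integral_cmult)
    note [measurable] = weight_measurable
    have "(\<lambda>r. ennreal (r ^ n * (indicator {0..<1} r * \<omega> r)) * indicator {0..<1} r) \<in> borel_measurable lborel"
      by measurable
    also have "(\<lambda>r. ennreal (r ^ n * (indicator {0..<1} r * \<omega> r)) * indicator {0..<1} r) = (\<lambda>r. ennreal (r ^ n * \<omega> r) * indicator {0..<1} r)"
      by (auto simp: fun_eq_iff indicator_def)
    finally show "(\<lambda>r. ennreal (r ^ n * \<omega> r) * indicator {0..<1} r) \<in> borel_measurable lborel" .
  qed (simp add: nn_integral_moment)
  also have "\<dots> = ennreal 2" using m by (subst ennreal_mult[symmetric]) auto
  finally have D: "D1_integral \<omega> f \<le> ennreal 2" .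
  then show "f \<in> D1_space \<omega>" using hf by (auto simp: D1_space_def intro: le_less_trans)
  have "f 0 = 0" by (simp add: f_def peak_def)
  moreover have "enn2real (D1_integral \<omega> f) \<le> 2" using D by (intro enn2real_leI) auto
  ultimately show "D1_norm \<omega> f \<le> 2" by (simp add: D1_norm_def)
qed

text \<open>Division by the moment could destroy the decay of \<open>q ^ n\<close>, but the moment
  is at least a constant times \<open>s ^ n\<close> with \<open>s > q\<close>. Hence the test
  functions tend to \<open>0\<close> locally uniformly.\<close>

lemma cmod_scaled_peak_le:
  assumes c: "cmod c = 1" and n: "n > 0" and z: "cmod z \<le> q" and q: "q < s" "s < 1"
  shows "cmod (of_real (1 / (real n * moment \<omega> n)) * peak n c z) \<le> (q / s) ^ n / omega_hat \<omega> s"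
proof -
  have q0: "0 \<le> q" using z norm_ge_zero[of z] by linarith
  have W: "omega_hat \<omega> s > 0" using q q0 by (intro hat_pos) auto
  have "cmod (of_real (1 / (real n * moment \<omega> n)) * peak n c z) = 1 / (real n * moment \<omega> n) * cmod (peak n c z)"
    using moment_pos[of n] unfolding norm_mult norm_of_real by simp
  also have "\<dots> \<le> 1 / (real n * moment \<omega> n) * (real n * cmod z ^ n)"
    using moment_pos[of n] z q by (intro mult_left_mono cmod_peak_le c) auto
  also have "\<dots> = cmod z ^ n / moment \<omega> n" using n by simp
  also have "\<dots> \<le> q ^ n / (s ^ n * omega_hat \<omega> s)"
    using z q q0 W power_mult_hat_le_moment[of s n] by (intro frac_le power_mono) auto
  also have "\<dots> = (q / s) ^ n / omega_hat \<omega> s" by (simp add: power_divide)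
  finally show ?thesis .
qed

text \<open>Suppose \<open>g'\<close> has modulus \<delta> at \<open>z0\<close>. Compactness makes
  the sup norm of one image at most \<open>e\<close>; Cauchy's estimate at the peak then bounds
  \<open>\<delta> / moment\<close>, up to constants, by \<open>e * n\<close>. Since
  \<open>n * moment \<le> B\<close>, a small \<open>e\<close> is contradictory.\<close>

theorem compact_T_op_imp_constant:
  assumes B: "\<And>N. \<exists>n\<ge>N. real n * moment \<omega> n \<le> B" and g: "g \<in> Tc_D1_Hinf \<omega>"
  shows "\<exists>c. \<forall>z\<in>ball 0 1. g z = c"
proof -
  have hg: "g holomorphic_on ball 0 1" and Tc: "T_compact_D1_Hinf \<omega> g" using g by (auto simp: Tc_D1_Hinf_def)
  have hg': "deriv g holomorphic_on ball 0 1" by (rule holomorphic_deriv[OF hg]) auto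
  have "deriv g z0 = 0" if z0: "z0 \<in> ball 0 1" for z0
  proof (rule ccontr)
    assume "deriv g z0 \<noteq> 0"
    define \<delta> where "\<delta> = cmod (deriv g z0)"
    have \<delta>: "\<delta> > 0" using \<open>deriv g z0 \<noteq> 0\<close> by (simp add: \<delta>_def)
    \<comment> \<open>Orders at least \<open>K\<close> give circles that enclose \<open>z0\<close>
      and have radius at least \<open>1/2\<close>.\<close>
    obtain K :: nat where K: "K \<ge> 2" "cmod z0 < 1 - 1 / real K"
    proof -
      obtain k :: nat where k: "1 / (1 - cmod z0) < real k" using reals_Archimedean2 by blast
      have "cmod z0 < 1 - 1 / real (max 2 k)"
      proof -
        have "1 / (1 - cmod z0) < real (max 2 k)" using k by linarith
        then show ?thesis using z0 by (simp add: field_simps)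
      qed
      then show ?thesis using that[of "max 2 k"] by simp
    qed
    have "\<forall>k. \<exists>n. n \<ge> max K k \<and> real n * moment \<omega> n \<le> B" using B by blast
    then obtain \<nu> where \<nu>: "\<And>k. \<nu> k \<ge> max K k" "\<And>k. real (\<nu> k) * moment \<omega> (\<nu> k) \<le> B" by metis
    define \<rho> where "\<rho> k = 1 - 1 / real (\<nu> k)" for k
    have \<nu>2: "\<nu> k \<ge> 2" "\<nu> k \<ge> k" "\<nu> k \<ge> K" for k using \<nu>(1)[of k] K by auto
    have \<rho>: "1/2 \<le> \<rho> k" "\<rho> k < 1" "cmod z0 < \<rho> k" for k
    proof -
      have "1 / real (\<nu> k) \<le> 1 / 2" "1 / real (\<nu> k) \<le> 1 / real K"
        using \<nu>2[of k] K by (auto intro!: frac_le)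
      then show "1/2 \<le> \<rho> k" "cmod z0 < \<rho> k" using K by (auto simp: \<rho>_def)
      show "\<rho> k < 1" using \<nu>2[of k] by (simp add: \<rho>_def)
    qed
    have B0: "B > 0"
    proof -
      have "0 < real (\<nu> 0) * moment \<omega> (\<nu> 0)" using \<nu>2[of 0] moment_pos by simp
      then show ?thesis using \<nu>(2)[of 0] by linarith
    qed
    \<comment> \<open>If \<open>g'\<close> stayed below \<delta> on the whole circle, the maximum
      principle would contradict its value at the enclosed point \<open>z0\<close>.\<close>
    have "\<exists>a. cmod a = \<rho> k \<and> cmod (deriv g a) \<ge> \<delta>" for k
    proof (rule ccontr)
      assume no: "\<not> ?thesis"
      obtain x where x: "x \<in> sphere 0 (\<rho> k)" "\<And>y. y \<in> sphere 0 (\<rho> k) \<Longrightarrow> cmod (deriv g y) \<le> cmod (deriv g x)"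
      proof -
        have ne: "sphere (0::complex) (\<rho> k) \<noteq> {}" using \<rho>(1)[of k] by simp
        have "continuous_on (sphere 0 (\<rho> k)) (\<lambda>y. cmod (deriv g y))"
          using hg' \<rho>(2)[of k] by (intro continuous_on_norm holomorphic_on_imp_continuous_on)
            (auto intro: holomorphic_on_subset)
        from continuous_attains_sup[OF compact_sphere ne this] show ?thesis using that by blast
      qed
      have "cmod (deriv g z0) \<le> cmod (deriv g x)"
      proof (rule maximum_modulus_frontier[of "deriv g" "cball 0 (\<rho> k)"])
        show "deriv g holomorphic_on interior (cball 0 (\<rho> k))" 
          using hg' \<rho>(2)[of k] by (auto intro: holomorphic_on_subset)
        show "continuous_on (closure (cball 0 (\<rho> k))) (deriv g)"
          using hg' \<rho>(2)[of k] by (auto intro!: holomorphic_on_imp_continuous_on intro: holomorphic_on_subset)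
        show "cmod (deriv g z) \<le> cmod (deriv g x)" if "z \<in> frontier (cball 0 (\<rho> k))" for z
          using x that \<rho>(1)[of k] by simp
      qed (use \<rho>(3)[of k] in auto)
      then show False using no x by (auto simp: \<delta>_def)
    qed
    then obtain a where a: "\<And>k. cmod (a k) = \<rho> k" "\<And>k. cmod (deriv g (a k)) \<ge> \<delta>" by metis
    \<comment> \<open>The rotation turns \<open>a k\<close> to the positive axis, where the peak
      sits.\<close>
    define c where "c k = cnj (a k) / of_real (\<rho> k)" for k
    have c: "cmod (c k) = 1" "c k * a k = of_real (\<rho> k)" for k
    proof -
      show "cmod (c k) = 1" using a(1)[of k] \<rho>(1)[of k] by (simp add: c_def norm_divide)
      have "c k * a k = of_real ((cmod (a k))\<^sup>2) / of_real (\<rho> k)"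
        unfolding c_def complex_norm_square by (simp add: mult.commute)
      then show "c k * a k = of_real (\<rho> k)" using a(1)[of k] \<rho>(1)[of k] by (simp add: power2_eq_square)
    qed
    define F where "F k = (\<lambda>z. of_real (1 / (real (\<nu> k) * moment \<omega> (\<nu> k))) * peak (\<nu> k) (c k) z)" for k
    have F: "F k \<in> D1_space \<omega> \<and> D1_norm \<omega> (F k) \<le> 2" for k
      unfolding F_def using \<nu>2[of k] by (intro conjI scaled_peak_in_D1_space c) auto
    then have hF: "F k holomorphic_on ball 0 1" for k by (simp add: D1_space_def)
    obtain \<phi> :: "nat \<Rightarrow> nat" where \<phi>: "strict_mono \<phi>"
      "\<And>e. e > 0 \<Longrightarrow> \<exists>N. \<forall>m\<ge>N. \<forall>n\<ge>N. \<forall>z\<in>ball 0 1. cmod (T_op g (F (\<phi> m)) z - T_op g (F (\<phi> n)) z) < e"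
      using conjunct2[OF Tc[unfolded T_compact_D1_Hinf_def], rule_format, of F 2] F by blast
    \<comment> \<open>Pointwise convergence is enough: the subsequence is uniformly Cauchy, so its
      uniform limit is identified as \<open>0\<close>.\<close>
    have pt: "(\<lambda>k. T_op g (F k) z) \<longlonglongrightarrow> 0" if z: "z \<in> ball 0 1" for z
    proof -
      define q where "q = cmod z"
      define s where "s = (1 + q) / 2"
      have qs: "0 \<le> q" "q < s" "s < 1" using z by (auto simp: q_def s_def)
      have seg: "closed_segment 0 z \<subseteq> cball 0 q" by (intro closed_segment_subset) (auto simp: q_def)
      have "compact (deriv g ` cball 0 q)"
        using hg' qs by (intro compact_continuous_image holomorphic_on_imp_continuous_on) (auto intro: holomorphic_on_subset)
      then obtain G where G: "\<And>x. x \<in> cball 0 q \<Longrightarrow> cmod (deriv g x) \<le> G"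
        using compact_imp_bounded by (metis bounded_iff imageI)
      have G0: "G \<ge> 0" using order_trans[OF norm_ge_zero G[of 0]] qs by simp
      have W: "omega_hat \<omega> s > 0" using qs by (intro hat_pos) auto
      have le: "cmod (T_op g (F k) z) \<le> (q / s) ^ k * (G / omega_hat \<omega> s * q)" for k
      proof -
        have "cmod (T_op g (F k) z) \<le> ((q / s) ^ k / omega_hat \<omega> s * G) * cmod (z - 0)"
        proof (rule has_contour_integral_bound_linepath[OF has_contour_integral_T_op[OF hF hg z]])
          show "0 \<le> (q / s) ^ k / omega_hat \<omega> s * G" using qs W G0 by simp
          fix x assume x: "x \<in> closed_segment 0 z"
          then have xq: "x \<in> cball 0 q" using seg by blast
          have "cmod (F k x) \<le> (q / s) ^ \<nu> k / omega_hat \<omega> s"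
            unfolding F_def using xq qs \<nu>2[of k] by (intro cmod_scaled_peak_le c) auto
          also have "\<dots> \<le> (q / s) ^ k / omega_hat \<omega> s"
            using qs W \<nu>2[of k] by (intro divide_right_mono power_decreasing) auto
          finally show "cmod (F k x * deriv g x) \<le> (q / s) ^ k / omega_hat \<omega> s * G"
            unfolding norm_mult using G[OF xq] G0 qs W by (intro mult_mono) auto
        qed
        then show ?thesis by (simp add: q_def mult_ac)
      qed
      have "(\<lambda>k. (q / s) ^ k * (G / omega_hat \<omega> s * q)) \<longlonglongrightarrow> 0"
        using qs by (intro tendsto_mult_left_zero LIMSEQ_power_zero) auto
      then show ?thesis using le by (rule Lim_null_comparison[OF always_eventually[OF allI], rotated])
    qed
    \<comment> \<open>Half of what is affordable: the final chain would give
      \<open>\<delta> * exp (-6) / 3 \<le> 2 * e * B\<close>, and the right side is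
      \<open>\<delta> * exp (-6) / 6\<close>.\<close>
    define e where "e = \<delta> * exp (-6) / (12 * B)"
    have e: "e > 0" using \<delta> B0 by (simp add: e_def)
    obtain N where N: "\<And>m n z. m \<ge> N \<Longrightarrow> n \<ge> N \<Longrightarrow> z \<in> ball 0 1 \<Longrightarrow> cmod (T_op g (F (\<phi> m)) z - T_op g (F (\<phi> n)) z) < e"
      using \<phi>(2)[OF e] by blast
    define k where "k = \<phi> N"
    have Tb: "cmod (T_op g (F k) z) \<le> e" if z: "z \<in> ball 0 1" for z
    proof -
      have "(\<lambda>n. T_op g (F (\<phi> n)) z) \<longlonglongrightarrow> 0" using LIMSEQ_subseq_LIMSEQ[OF pt[OF z] \<phi>(1)] by (simp add: o_def)
      then have "(\<lambda>n. cmod (T_op g (F k) z - T_op g (F (\<phi> n)) z)) \<longlonglongrightarrow> cmod (T_op g (F k) z - 0)"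
        by (intro tendsto_intros)
      then have "cmod (T_op g (F k) z - 0) \<le> e"
      proof (rule tendsto_upperbound)
        show "\<forall>\<^sub>F n in sequentially. cmod (T_op g (F k) z - T_op g (F (\<phi> n)) z) \<le> e"
          using eventually_ge_at_top[of N] unfolding k_def
          by eventually_elim (rule less_imp_le[OF N[OF order_refl _ z]])
      qed simp
      then show ?thesis by simp
    qed
    \<comment> \<open>Half the distance from \<open>a k\<close> to the unit circle; as that distance
      is \<open>1 / \<nu> k\<close>, Cauchy's estimate loses the factor
      \<open>2 * \<nu> k\<close>.\<close>
    define R where "R = (1 - \<rho> k) / 2"
    have R: "R > 0" using \<rho>(2)[of k] by (simp add: R_def)
    have sub: "cball (a k) R \<subseteq> ball 0 1"
    proof
      fix x assume "x \<in> cball (a k) R"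
      then have "cmod x \<le> \<rho> k + R" using a(1)[of k] norm_triangle_sub[of x "a k"] by (simp add: dist_norm norm_minus_commute)
      also have "\<dots> < 1" using \<rho>(2)[of k] by (simp add: R_def field_simps)
      finally show "x \<in> ball 0 1" by simp
    qed
    have hT: "T_op g (F k) holomorphic_on ball 0 1"
      using T_op_has_derivative[OF hF hg] by (meson field_differentiable_at_within field_differentiable_def holomorphic_onI)
    have ak: "a k \<in> ball 0 1" using a(1)[of k] \<rho>(2)[of k] by simp
    have "cmod ((deriv ^^ 1) (T_op g (F k)) (a k)) \<le> fact 1 * e / R ^ 1"
    proof (rule Cauchy_inequality)
      show "T_op g (F k) holomorphic_on ball (a k) R" using hT sub by (meson ball_subset_cball holomorphic_on_subset order_trans)
      show "continuous_on (cball (a k) R) (T_op g (F k))" using hT sub by (meson holomorphic_on_imp_continuous_on continuous_on_subset)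
      show "cmod (T_op g (F k) x) \<le> e" if "cmod (a k - x) = R" for x
        using sub that by (intro Tb) (auto simp: dist_norm)
    qed (rule R)
    then have "cmod (F k (a k) * deriv g (a k)) \<le> e / R"
      using DERIV_imp_deriv[OF T_op_has_derivative[OF hF hg ak]] by simp
    also have "e / R = 2 * e * real (\<nu> k)" using \<nu>2[of k] by (simp add: R_def \<rho>_def)
    finally have up: "cmod (F k (a k)) * cmod (deriv g (a k)) \<le> 2 * e * real (\<nu> k)" by (simp add: norm_mult)
    have low: "exp (-6) / (3 * moment \<omega> (\<nu> k)) \<le> cmod (F k (a k))"
    proof -
      define n where "n = \<nu> k"
      have n: "n \<ge> 2" using \<nu>2[of k] by (simp add: n_def)
      have m: "moment \<omega> n > 0" by (rule moment_pos)
      \<comment> \<open>The logarithm bound needs \<open>1 / n \<le> 1/2\<close>, which is why all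
        orders are at least \<open>2\<close>. The power \<open>3 * n\<close> turns it into
        \<open>exp (-6)\<close>.\<close>
      have re: "exp (-2 * (1 / real n)) \<le> \<rho> k"
      proof -
        have "- (1 / real n) - 2 * (1 / real n)\<^sup>2 \<le> ln (1 - 1 / real n)"
          using n by (intro ln_one_minus_pos_lower_bound) (auto simp: field_simps)
        moreover have "(1 / real n)\<^sup>2 \<le> (1 / real n) * (1/2)" unfolding power2_eq_square using n by (intro mult_left_mono) (auto simp: field_simps)
        ultimately have "-2 * (1 / real n) \<le> ln (\<rho> k)" by (simp add: \<rho>_def n_def)
        then have "exp (-2 * (1 / real n)) \<le> exp (ln (\<rho> k))" by (simp only: exp_le_cancel_iff)
        then show ?thesis using \<rho>(1)[of k] by simp
      qed
      have "exp (-6) = exp (real (3 * n) * (-2 * (1 / real n)))" using n by simp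
      also have "\<dots> = exp (-2 * (1 / real n)) ^ (3 * n)" by (rule exp_of_nat_mult)
      also have "\<dots> \<le> \<rho> k ^ (3 * n)" using re by (intro power_mono) auto
      finally have ex: "exp (-6) \<le> \<rho> k ^ (3 * n)" .
      have "exp (-6) / (3 * moment \<omega> n) = 1 / (real n * moment \<omega> n) * (real n * exp (-6) / 3)" using n by simp
      also have "\<dots> \<le> 1 / (real n * moment \<omega> n) * (real n * \<rho> k ^ (3 * n) / 3)"
        using ex m by (intro mult_left_mono divide_right_mono) auto
      also have "\<dots> \<le> 1 / (real n * moment \<omega> n) * cmod (peak n (c k) (a k))"
        using m \<rho>(1,2)[of k] by (intro mult_left_mono cmod_peak_ge c(2)) auto
      also have "\<dots> = cmod (F k (a k))"
        unfolding F_def norm_mult norm_of_real using m by (simp add: n_def)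
      finally show ?thesis by (simp add: n_def)
    qed
    have "\<delta> * exp (-6) / 3 = exp (-6) / (3 * moment \<omega> (\<nu> k)) * \<delta> * moment \<omega> (\<nu> k)" using moment_pos[of "\<nu> k"] by simp
    also have "\<dots> \<le> cmod (F k (a k)) * cmod (deriv g (a k)) * moment \<omega> (\<nu> k)"
      using low a(2)[of k] \<delta> moment_pos[of "\<nu> k"] by (intro mult_right_mono mult_mono) auto
    also have "\<dots> \<le> 2 * e * real (\<nu> k) * moment \<omega> (\<nu> k)" using up moment_pos[of "\<nu> k"] by (intro mult_right_mono) auto
    also have "\<dots> \<le> 2 * e * B" using \<nu>(2)[of k] e by (simp add: mult.assoc)
    also have "\<dots> = \<delta> * exp (-6) / 6" using B0 by (simp add: e_def)
    finally show False using \<delta> by (simp add: field_simps)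
  qed
  then have "(g has_field_derivative 0) (at z within ball 0 1)" if "z \<in> ball 0 1" for z
    using that hg by (metis holomorphic_derivI has_field_derivative_at_within open_ball)
  then show ?thesis by (intro has_field_derivative_zero_constant) auto
qed

end

subsection \<open>The equivalences\<close>

lemma frequently_greater_or_tendsto_zero:
  fixes f :: "'a \<Rightarrow> real"
  assumes "\<forall>\<^sub>F x in F. 0 \<le> f x" and "\<not> (\<exists>c>0. \<exists>\<^sub>F x in F. f x > c)"
  shows "(f \<longlongrightarrow> 0) F"
proof (rule order_tendstoI)
  fix y :: real assume "y < 0"
  show "\<forall>\<^sub>F x in F. y < f x" using assms(1) by eventually_elim (use \<open>y < 0\<close> in linarith)
next
  fix y :: real assume y: "0 < y"
  then have "\<forall>\<^sub>F x in F. f x \<le> y / 2"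
    using assms(2) half_gt_zero[OF y] unfolding not_frequently not_less[symmetric] frequently_def by blast
  then show "\<forall>\<^sub>F x in F. f x < y" by eventually_elim (use y in linarith)
qed

lemma tendsto_zero_not_frequently_greater:
  fixes f :: "'a \<Rightarrow> real"
  assumes "(f \<longlongrightarrow> 0) F"
  shows "\<not> (\<exists>c>0. \<exists>\<^sub>F x in F. f x > c)"
proof
  assume "\<exists>c>0. \<exists>\<^sub>F x in F. f x > c"
  then obtain c where c: "c > 0" "\<exists>\<^sub>F x in F. f x > c" by blast
  have "\<forall>\<^sub>F x in F. \<not> f x > c" using order_tendstoD(2)[OF assms c(1)] by eventually_elim simp
  with c(2) show False by (simp add: frequently_def)
qed

theorem mainTheorem4:
  fixes \<omega> :: "real \<Rightarrow> real"
  assumes "radial_weight \<omega>" and "D_hat \<omega>"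
  shows "((\<forall>g\<in>Tc_D1_Hinf \<omega>. \<exists>c. \<forall>z\<in>ball 0 1. g z = c)
           \<longleftrightarrow> Limsup (at_left (1::real)) (\<lambda>r. ereal ((1 - r) / omega_hat \<omega> r)) > 0)
       \<and> (Limsup (at_left (1::real)) (\<lambda>r. ereal ((1 - r) / omega_hat \<omega> r)) > 0
           \<longleftrightarrow> Limsup (at_left (1::real))
                 (\<lambda>r. ereal ((1 - r) * (\<Sum>k. r ^ (k + 1) / (real (k + 2) * moment \<omega> (k + 1))))) > 0)
       \<and> (Limsup (at_left (1::real))
                 (\<lambda>r. ereal ((1 - r) * (\<Sum>k. r ^ (k + 1) / (real (k + 2) * moment \<omega> (k + 1))))) > 0
           \<longleftrightarrow> \<not> identity_compact_D1 \<omega>)"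
proof -
  interpret weight \<omega> by unfold_locales (rule assms(1))
  let ?h = "\<lambda>r. (1 - r) / omega_hat \<omega> r"
  let ?S = "\<lambda>r. (1 - r) * (\<Sum>k. r ^ (k + 1) / (real (k + 2) * moment \<omega> (k + 1)))"
  define i where "i \<longleftrightarrow> (\<forall>g\<in>Tc_D1_Hinf \<omega>. \<exists>c. \<forall>z\<in>ball 0 1. g z = c)"
  define ii where "ii \<longleftrightarrow> (\<exists>c>0. \<exists>\<^sub>F r in at_left 1. ?h r > c)"
  define iii where "iii \<longleftrightarrow> (\<exists>c>0. \<exists>\<^sub>F r in at_left 1. ?S r > c)"
  have "\<forall>\<^sub>F r in at_left (1::real). 0 < r \<and> r < 1"
    unfolding eventually_at_left_field by (intro exI[of _ 0]) auto
  then have "\<forall>\<^sub>F r in at_left 1. 0 \<le> ?h r"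
    by eventually_elim (use hat_pos in \<open>auto intro!: divide_nonneg_pos\<close>)
  then have lim: "(?h \<longlongrightarrow> 0) (at_left 1)" if "\<not> ii"
    using that unfolding ii_def by (rule frequently_greater_or_tendsto_zero)
  have "i" if ii: ii
  proof -
    obtain c where c: "c > 0" "\<exists>\<^sub>F r in at_left 1. ?h r > c" using ii unfolding ii_def by blast
    obtain B where "\<And>N. \<exists>n\<ge>N. real n * moment \<omega> n \<le> B"
      using moments_frequently_small[OF assms(2) c] by blast
    then show ?thesis unfolding i_def using compact_T_op_imp_constant by blast
  qed
  moreover have "\<not> identity_compact_D1 \<omega>" if i
  proof
    assume "identity_compact_D1 \<omega>"
    then have "(\<lambda>z. z) \<in> Tc_D1_Hinf \<omega>" by (rule T_op_ident_compact)
    from bspec[OF \<open>i\<close>[unfolded i_def] this] obtain c :: complex where c: "\<forall>z\<in>ball 0 1. z = c" ..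
    have "0 = c" by (rule c[rule_format]) simp
    moreover have "1/2 = c" by (rule c[rule_format]) simp
    ultimately show False by simp
  qed
  moreover have "identity_compact_D1 \<omega>" if "\<not> ii"
    using lim[OF that] by (rule identity_compact_if_hat)
  moreover have "iii" if ii: ii
  proof -
    obtain c where c: "c > 0" "\<exists>\<^sub>F r in at_left 1. ?h r > c" using ii unfolding ii_def by blast
    show ?thesis using Abel_mean_frequently_large[OF assms(2) c] unfolding iii_def by blast
  qed
  moreover have "\<not> iii" if "\<not> ii"
    unfolding iii_def using Abel_mean_tendsto_zero_if_hat[OF lim[OF that]]
    by (rule tendsto_zero_not_frequently_greater)
  \<comment> \<open>The cycle from \<open>ii\<close> to \<open>i\<close>, to noncompactness, and
    back to \<open>ii\<close> by contraposition; \<open>iii\<close> is attached to \<open>ii\<close>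
    in both directions.\<close>
  ultimately have "(i \<longleftrightarrow> ii) \<and> (ii \<longleftrightarrow> iii) \<and> (iii \<longleftrightarrow> \<not> identity_compact_D1 \<omega>)" by blast
  then show ?thesis
    unfolding Limsup_ereal_pos_iff i_def[symmetric] ii_def[symmetric] iii_def[symmetric] .
qed

end
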